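(* Fix $j\in\{0,1,2,3\}$ and let $F=\widetilde V(\tau+\xi_j)$. If $p\in\mathfrak P_j$, there is a unique (up to isomorphism) $\Gamma$-equivariant structure on the $S'$-module $F\otimes k^2$ such that $M_p\cong(F\otimes k^2)^\Gamma$ as graded $A$-modules.
   Context: Let $k$ be an algebraically closed field of characteristic $\neq2,3$; $\alpha_1,\alpha_2,\alpha_3\in k\setminus\{0,1,-1\}$ with $\alpha_1+\alpha_2+\alpha_3+\alpha_1\alpha_2\alpha_3=0$; fix $a,b,c,\mathbf i\in k$ with $a^2=\alpha_1,b^2=\alpha_2,c^2=\alpha_3,\mathbf i^2=-1$. $S$ is the graded algebra generated by $x_0,\dots,x_3$ (degree 1) with relations $x_0x_i-x_ix_0=\alpha_i(x_jx_k+x_kx_j)$, $x_0x_i+x_ix_0=x_jx_k-x_kx_j$ for all cyclic permutations $(i,j,k)$ of $(1,2,3)$. $q_0=1$, $q_1=\begin{pmatrix}\mathbf i&0\\0&-\mathbf i\end{pmatrix}$, $q_2=\begin{pmatrix}0&\mathbf i\\\mathbf i&0\end{pmatrix}$, $q_3=\begin{pmatrix}0&-1\\1&0\end{pmatrix}$ in $M_2(k)$. $\Gamma=\{g_0=1,g_1,g_2,g_3\}\cong(\mathbb Z/2)^2$ acts on $S$ by graded algebra automorphisms: for $j=1,2,3$, $g_j$ fixes $x_0,x_j$ and changes the sign of the other two generators. It acts on $M_2(k)$ by $g_j(m)=q_jmq_j^{-1}$, and diagonally on $S'=S\otimes M_2(k)$. $A=(S')^\Gamma$; it is generated by $y_j=x_j\otimes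 q_j$ ($j=0,1,2,3$). $V(\tau+\xi_j)=k^2$ is the simple left $S$-module on which $(x_0,x_1,x_2,x_3)$ acts as $j=0$: $(1,q_1,q_2,q_3)$; $j=1$: $(bc\,q_1,-\mathbf i,-\mathbf ib\,q_3,-c\,q_2)$; $j=2$: $(ac\,q_2,-a\,q_3,-\mathbf i,-\mathbf ic\,q_1)$; $j=3$: $(ab\,q_3,-\mathbf ia\,q_2,-b\,q_1,-\mathbf i)$. (The symbols $\tau+\xi_j$ are here only labels.) $\widetilde V(\tau+\xi_j)=V(\tau+\xi_j)\otimes k[t]$ is the graded $S$-module with $V(\tau+\xi_j)\otimes t^m$ in degree $m$ and $s(v\otimes t^m)=(sv)\otimes t^{m+n}$ for $s\in S_n$; $F\otimes k^2$ is the resulting graded $S'$-module. A $\Gamma$-equivariant structure on a graded left $S'$-module $M$ is a degree-preserving linear action $(g,m)\mapsto m^g$ of $\Gamma$ with $(xm)^g=g(x)m^g$ for $x\in S'$; then the invariants $M^\Gamma$ form a graded $A$-module. Isomorphisms of equivariant structures are graded $S'$-module isomorphisms commuting with $\Gamma$. For $p\in\mathbb P(A_1^* )$, $p^\perp\subseteq A_1$ is the space of forms vanishing at $p$ and $M_p=A/Ap^\perp$. In coordinates $(y_0,\dots,y_3)$: $\mathfrak P_0=\{(1,1,1,1),(1,1,-1,-1),(1,-1,1,-1),(1,-1,-1,1)\}$; $\mathfrak P_1=\{(bc,-\mathbf i,-\mathbf ib,-c),(bc,-\mathbf i,\mathbf ib,c),(bc,\mathbf i,-\mathbf ib,c),(bc,\mathbf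 i,\mathbf ib,-c)\}$; $\mathfrak P_2=\{(ac,-a,-\mathbf i,-\mathbf ic),(ac,-a,\mathbf i,\mathbf ic),(ac,a,-\mathbf i,\mathbf ic),(ac,a,\mathbf i,-\mathbf ic)\}$; $\mathfrak P_3=\{(ab,-\mathbf ia,-b,-\mathbf i),(ab,-\mathbf ia,b,\mathbf i),(ab,\mathbf ia,-b,\mathbf i),(ab,\mathbf ia,b,-\mathbf i)\}$. *)

theory Defs
  imports
    "HOL-Analysis.Analysis"
    "HOL-Library.Poly_Mapping"
    "HOL-Computational_Algebra.Polynomial"
    "HOL-Algebra.QuotRing"
    "HOL-Algebra.Module"
begin

section \<open>Indices and the group \<open>\<Gamma>\<close>\<close>

text \<open>
  The indices \<open>0, 1, 2, 3\<close>. The same type indexes the generators \<open>x\<^sub>j\<close>, the matrices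
  \<open>q\<^sub>j\<close> and the elements \<open>g\<^sub>j\<close> of \<open>\<Gamma>\<close>; in the last role its product is \<open>klein_mult\<close>.
\<close>

datatype ix = I0 | I1 | I2 | I3

lemma UNIV_ix: "UNIV = {I0, I1, I2, I3}"
  using ix.exhaust by blast

instance ix :: finite
  by standard (simp add: UNIV_ix)

fun klein_mult :: "ix \<Rightarrow> ix \<Rightarrow> ix" where
  "klein_mult I0 h = h"
| "klein_mult g I0 = g"
| "klein_mult I1 I1 = I0" | "klein_mult I1 I2 = I3" | "klein_mult I1 I3 = I2"
| "klein_mult I2 I1 = I3" | "klein_mult I2 I2 = I0" | "klein_mult I2 I3 = I1"
| "klein_mult I3 I1 = I2" | "klein_mult I3 I2 = I1" | "klein_mult I3 I3 = I0"

definition cyclic_perms :: "(ix \<times> ix \<times> ix) set" where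
  "cyclic_perms = {(I1, I2, I3), (I2, I3, I1), (I3, I1, I2)}"


section \<open>The algebra \<open>S\<close>\<close>

text \<open>
  The free algebra on \<open>x\<^sub>0, \<dots>, x\<^sub>3\<close> is the monoid algebra of the monoid of words (lists under
  concatenation): the convolution product of \<^theory>\<open>HOL-Library.Poly_Mapping\<close>
  for the following additively written monoid.
\<close>

instantiation list :: (type) monoid_add
begin
definition zero_list :: "'a list" where "zero_list = []"
definition plus_list :: "'a list \<Rightarrow> 'a list \<Rightarrow> 'a list" where "plus_list = (@)"
instance by standard (simp_all add: zero_list_def plus_list_def)
end

type_synonym 'k free_alg = "ix list \<Rightarrow>\<^sub>0 'k"

definition free_ring :: "('k::field) free_alg ring" where
  "free_ring = \<lparr>carrier = UNIV, mult = (*), one = 1, zero = 0, add = (+)\<rparr>"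

definition fgen :: "ix \<Rightarrow> ('k::field) free_alg" where
  "fgen i = Poly_Mapping.single [i] 1"

definition fconst :: "'k \<Rightarrow> ('k::field) free_alg" where
  "fconst c = Poly_Mapping.single [] c"

definition S_relations :: "(ix \<Rightarrow> 'k::field) \<Rightarrow> 'k free_alg set" where
  "S_relations \<alpha> =
     (\<Union>(i, j, k)\<in>cyclic_perms.
       {fgen I0 * fgen i - fgen i * fgen I0
          - fconst (\<alpha> i) * (fgen j * fgen k + fgen k * fgen j),
        fgen I0 * fgen i + fgen i * fgen I0
          - (fgen j * fgen k - fgen k * fgen j)})"

definition S_ideal :: "(ix \<Rightarrow> 'k::field) \<Rightarrow> 'k free_alg set" where
  "S_ideal \<alpha> = genideal free_ring (S_relations \<alpha>)"

definition S_alg :: "(ix \<Rightarrow> 'k::field) \<Rightarrow> 'k free_alg set ring" where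
  "S_alg \<alpha> = free_ring Quot S_ideal \<alpha>"

definition S_class :: "(ix \<Rightarrow> 'k::field) \<Rightarrow> 'k free_alg \<Rightarrow> 'k free_alg set" where
  "S_class \<alpha> f = S_ideal \<alpha> +>\<^bsub>free_ring\<^esub> f"

definition S_deg :: "(ix \<Rightarrow> 'k::field) \<Rightarrow> nat \<Rightarrow> 'k free_alg set set" where
  "S_deg \<alpha> n = {S_class \<alpha> f | f. \<forall>w\<in>Poly_Mapping.keys f. length w = n}"

text \<open>
  \<open>g\<close> multiplies each word by a sign. On cosets the action is the direct image; this is
  again a coset because the ideal of relations is \<open>\<Gamma>\<close>-stable.
\<close>

definition gen_sign :: "ix \<Rightarrow> ix \<Rightarrow> 'k::field" where
  "gen_sign g i = (if g = I0 \<or> i = I0 \<or> i = g then 1 else -1)"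

definition free_act :: "ix \<Rightarrow> ('k::field) free_alg \<Rightarrow> 'k free_alg" where
  "free_act g f = Poly_Mapping.mapp (\<lambda>w c. prod_list (map (gen_sign g) w) * c) f"

definition S_act :: "ix \<Rightarrow> ('k::field) free_alg set \<Rightarrow> 'k free_alg set" where
  "S_act g X = free_act g ` X"


section \<open>The algebras \<open>S' = S \<otimes> M\<^sub>2(k)\<close> and \<open>A = (S')\<^sup>\<Gamma>\<close>\<close>

text \<open>Here \<open>\<iota>\<close> is the chosen square root of \<open>-1\<close>.\<close>

fun qmat :: "'k::field \<Rightarrow> ix \<Rightarrow> 'k^2^2" where
  "qmat \<iota> I0 = mat 1"
| "qmat \<iota> I1 = vector [vector [\<iota>, 0], vector [0, - \<iota>]]"
| "qmat \<iota> I2 = vector [vector [0, \<iota>], vector [\<iota>, 0]]"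
| "qmat \<iota> I3 = vector [vector [0, -1], vector [1, 0]]"

text \<open>
  \<open>S \<otimes> M\<^sub>2(k)\<close> is taken to be the matrix ring \<open>M\<^sub>2(S)\<close>, in which \<open>s \<otimes> m\<close> is the
  matrix with entries \<open>m\<^sub>r\<^sub>c s\<close>.
\<close>

definition mat2_ring :: "('a, 'b) ring_scheme \<Rightarrow> ('a^2^2) ring" where
  "mat2_ring R = \<lparr>
     carrier = {X. \<forall>r c. X $ r $ c \<in> carrier R},
     mult = (\<lambda>X Y. \<chi> r c. X $ r $ 1 \<otimes>\<^bsub>R\<^esub> Y $ 1 $ c \<oplus>\<^bsub>R\<^esub> X $ r $ 2 \<otimes>\<^bsub>R\<^esub> Y $ 2 $ c),
     one = (\<chi> r c. if r = c then \<one>\<^bsub>R\<^esub> else \<zero>\<^bsub>R\<^esub>),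
     zero = (\<chi> r c. \<zero>\<^bsub>R\<^esub>),
     add = (\<lambda>X Y. \<chi> r c. X $ r $ c \<oplus>\<^bsub>R\<^esub> Y $ r $ c)\<rparr>"

definition S'_alg :: "(ix \<Rightarrow> 'k::field) \<Rightarrow> ('k free_alg set^2^2) ring" where
  "S'_alg \<alpha> = mat2_ring (S_alg \<alpha>)"

definition S'_deg :: "(ix \<Rightarrow> 'k::field) \<Rightarrow> nat \<Rightarrow> ('k free_alg set^2^2) set" where
  "S'_deg \<alpha> n = {X. \<forall>r c. X $ r $ c \<in> S_deg \<alpha> n}"

definition tens ::
    "(ix \<Rightarrow> 'k::field) \<Rightarrow> 'k free_alg set \<Rightarrow> 'k^2^2 \<Rightarrow> 'k free_alg set^2^2" where
  "tens \<alpha> s m = (\<chi> r c. S_class \<alpha> (fconst (m $ r $ c)) \<otimes>\<^bsub>S_alg \<alpha>\<^esub> s)"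

definition S'_const :: "(ix \<Rightarrow> 'k::field) \<Rightarrow> 'k \<Rightarrow> 'k free_alg set^2^2" where
  "S'_const \<alpha> c = tens \<alpha> \<one>\<^bsub>S_alg \<alpha>\<^esub> (mat c)"

text \<open>
  The diagonal action: \<open>g\<close> entrywise, followed by conjugation by \<open>1 \<otimes> q\<^sub>g\<close>; so
  \<open>s \<otimes> m\<close> goes to \<open>g(s) \<otimes> q\<^sub>g m q\<^sub>g\<^sup>-\<^sup>1\<close>.
\<close>

definition S'_act ::
    "(ix \<Rightarrow> 'k::field) \<Rightarrow> 'k \<Rightarrow> ix \<Rightarrow> 'k free_alg set^2^2 \<Rightarrow> 'k free_alg set^2^2" where
  "S'_act \<alpha> \<iota> g X =
     tens \<alpha> \<one>\<^bsub>S_alg \<alpha>\<^esub> (qmat \<iota> g) \<otimes>\<^bsub>S'_alg \<alpha>\<^esub>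
       (\<chi> r c. S_act g (X $ r $ c)) \<otimes>\<^bsub>S'_alg \<alpha>\<^esub>
       tens \<alpha> \<one>\<^bsub>S_alg \<alpha>\<^esub> (matrix_inv (qmat \<iota> g))"

definition A_alg :: "(ix \<Rightarrow> 'k::field) \<Rightarrow> 'k \<Rightarrow> ('k free_alg set^2^2) ring" where
  "A_alg \<alpha> \<iota> = (S'_alg \<alpha>)\<lparr>carrier :=
     {X \<in> carrier (S'_alg \<alpha>). \<forall>g. S'_act \<alpha> \<iota> g X = X}\<rparr>"

definition A_deg :: "(ix \<Rightarrow> 'k::field) \<Rightarrow> 'k \<Rightarrow> nat \<Rightarrow> ('k free_alg set^2^2) set" where
  "A_deg \<alpha> \<iota> n = carrier (A_alg \<alpha> \<iota>) \<inter> S'_deg \<alpha> n"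

definition y_gen :: "(ix \<Rightarrow> 'k::field) \<Rightarrow> 'k \<Rightarrow> ix \<Rightarrow> 'k free_alg set^2^2" where
  "y_gen \<alpha> \<iota> j = tens \<alpha> (S_class \<alpha> (fgen j)) (qmat \<iota> j)"


section \<open>Graded left modules\<close>

text \<open>
  Left modules use the module record of HOL-Algebra, whose ring product and unit
  carry no meaning and are left undefined. All modules below vanish in negative
  degrees, so the degrees are natural numbers.
\<close>

record ('a, 'b) graded_module = "('a, 'b) module" +
  degpart :: "nat \<Rightarrow> 'b set"

definition graded_iso ::
    "('a, 'r) ring_scheme \<Rightarrow> ('a, 'b, 'm) graded_module_scheme \<Rightarrow>
     ('a, 'c, 'n) graded_module_scheme \<Rightarrow> ('b \<Rightarrow> 'c) \<Rightarrow> bool" where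
  "graded_iso R M N f \<longleftrightarrow>
     bij_betw f (carrier M) (carrier N) \<and>
     (\<forall>m\<in>carrier M. \<forall>m'\<in>carrier M. f (m \<oplus>\<^bsub>M\<^esub> m') = f m \<oplus>\<^bsub>N\<^esub> f m') \<and>
     (\<forall>x\<in>carrier R. \<forall>m\<in>carrier M. f (x \<odot>\<^bsub>M\<^esub> m) = x \<odot>\<^bsub>N\<^esub> f m) \<and>
     (\<forall>n. f ` degpart M n = degpart N n)"

definition graded_isomorphic ::
    "('a, 'r) ring_scheme \<Rightarrow> ('a, 'b, 'm) graded_module_scheme \<Rightarrow>
     ('a, 'c, 'n) graded_module_scheme \<Rightarrow> bool" where
  "graded_isomorphic R M N \<longleftrightarrow> (\<exists>f. graded_iso R M N f)"

definition left_ideal_gen :: "('a, 'r) ring_scheme \<Rightarrow> 'a set \<Rightarrow> 'a set" where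
  "left_ideal_gen R P =
     \<Inter> {L. additive_subgroup L R \<and> (\<forall>x\<in>carrier R. \<forall>l\<in>L. x \<otimes>\<^bsub>R\<^esub> l \<in> L) \<and> P \<subseteq> L}"

definition quotient_module ::
    "('a, 'r) ring_scheme \<Rightarrow> (nat \<Rightarrow> 'a set) \<Rightarrow> 'a set \<Rightarrow> ('a, 'a set) graded_module" where
  "quotient_module R gr L = \<lparr>
     carrier = a_rcosets\<^bsub>R\<^esub> L, mult = undefined, one = undefined,
     zero = L, add = set_add R,
     smult = (\<lambda>x X. \<Union>l\<in>X. L +>\<^bsub>R\<^esub> (x \<otimes>\<^bsub>R\<^esub> l)),
     degpart = (\<lambda>n. {L +>\<^bsub>R\<^esub> x | x. x \<in> gr n})\<rparr>"


section \<open>Equivariant structures\<close>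

definition equivariant_structure ::
    "(ix \<Rightarrow> 'k::field) \<Rightarrow> 'k \<Rightarrow> ('k free_alg set^2^2, 'b, 'm) graded_module_scheme \<Rightarrow>
     (ix \<Rightarrow> 'b \<Rightarrow> 'b) \<Rightarrow> bool" where
  "equivariant_structure \<alpha> \<iota> M \<phi> \<longleftrightarrow>
     (\<forall>g. \<forall>m\<in>carrier M. \<phi> g m \<in> carrier M) \<and>
     (\<forall>m\<in>carrier M. \<phi> I0 m = m) \<and>
     (\<forall>g h. \<forall>m\<in>carrier M. \<phi> (klein_mult g h) m = \<phi> g (\<phi> h m)) \<and>
     (\<forall>g. \<forall>m\<in>carrier M. \<forall>m'\<in>carrier M. \<phi> g (m \<oplus>\<^bsub>M\<^esub> m') = \<phi> g m \<oplus>\<^bsub>M\<^esub> \<phi> g m') \<and>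
     (\<forall>g c. \<forall>m\<in>carrier M. \<phi> g (S'_const \<alpha> c \<odot>\<^bsub>M\<^esub> m) = S'_const \<alpha> c \<odot>\<^bsub>M\<^esub> \<phi> g m) \<and>
     (\<forall>g n. \<forall>m\<in>degpart M n. \<phi> g m \<in> degpart M n) \<and>
     (\<forall>g. \<forall>x\<in>carrier (S'_alg \<alpha>). \<forall>m\<in>carrier M.
        \<phi> g (x \<odot>\<^bsub>M\<^esub> m) = S'_act \<alpha> \<iota> g x \<odot>\<^bsub>M\<^esub> \<phi> g m)"

definition equivariant_isomorphic ::
    "(ix \<Rightarrow> 'k::field) \<Rightarrow> ('k free_alg set^2^2, 'b, 'm) graded_module_scheme \<Rightarrow>
     (ix \<Rightarrow> 'b \<Rightarrow> 'b) \<Rightarrow> (ix \<Rightarrow> 'b \<Rightarrow> 'b) \<Rightarrow> bool" where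
  "equivariant_isomorphic \<alpha> M \<phi> \<psi> \<longleftrightarrow>
     (\<exists>\<theta>. graded_iso (S'_alg \<alpha>) M M \<theta> \<and>
        (\<forall>g. \<forall>m\<in>carrier M. \<theta> (\<phi> g m) = \<psi> g (\<theta> m)))"

definition invariants ::
    "('a, 'b, 'm) graded_module_scheme \<Rightarrow> (ix \<Rightarrow> 'b \<Rightarrow> 'b) \<Rightarrow>
     ('a, 'b, 'm) graded_module_scheme" where
  "invariants M \<phi> = M\<lparr>carrier := {m \<in> carrier M. \<forall>g. \<phi> g m = m},
     degpart := (\<lambda>n. {m \<in> degpart M n. \<forall>g. \<phi> g m = m})\<rparr>"


section \<open>The modules \<open>V(\<tau> + \<xi>\<^sub>j)\<close>, \<open>F\<close> and \<open>F \<otimes> k\<^sup>2\<close>\<close>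

abbreviation scale_mat :: "'k::field \<Rightarrow> 'k^2^2 \<Rightarrow> 'k^2^2" where
  "scale_mat c m \<equiv> map_matrix ((*) c) m"

text \<open>\<open>V_mat a b c \<iota> j i\<close> is the matrix by which \<open>x\<^sub>i\<close> acts on \<open>V(\<tau> + \<xi>\<^sub>j)\<close>.\<close>

fun V_mat :: "'k::field \<Rightarrow> 'k \<Rightarrow> 'k \<Rightarrow> 'k \<Rightarrow> ix \<Rightarrow> ix \<Rightarrow> 'k^2^2" where
  "V_mat a b c \<iota> I0 = case_ix (mat 1) (qmat \<iota> I1) (qmat \<iota> I2) (qmat \<iota> I3)"
| "V_mat a b c \<iota> I1 = case_ix
     (scale_mat (b * c) (qmat \<iota> I1)) (mat (- \<iota>))
     (scale_mat (- \<iota> * b) (qmat \<iota> I3)) (scale_mat (- c) (qmat \<iota> I2))"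
| "V_mat a b c \<iota> I2 = case_ix
     (scale_mat (a * c) (qmat \<iota> I2)) (scale_mat (- a) (qmat \<iota> I3))
     (mat (- \<iota>)) (scale_mat (- \<iota> * c) (qmat \<iota> I1))"
| "V_mat a b c \<iota> I3 = case_ix
     (scale_mat (a * b) (qmat \<iota> I3)) (scale_mat (- \<iota> * a) (qmat \<iota> I2))
     (scale_mat (- b) (qmat \<iota> I1)) (mat (- \<iota>))"

definition V_word :: "'k::field \<Rightarrow> 'k \<Rightarrow> 'k \<Rightarrow> 'k \<Rightarrow> ix \<Rightarrow> ix list \<Rightarrow> 'k^2 \<Rightarrow> 'k^2" where
  "V_word a b c \<iota> j w v = foldr (\<lambda>i u. V_mat a b c \<iota> j i *v u) w v"

text \<open>
  \<open>F = V \<otimes> k[t]\<close> consists of the polynomials with coefficients in \<open>V\<close>, and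
  \<open>monom v m\<close> is \<open>v \<otimes> t\<^sup>m\<close>. A word \<open>w\<close> is homogeneous of degree \<open>length w\<close>, hence
  sends \<open>v \<otimes> t\<^sup>m\<close> to \<open>wv \<otimes> t\<^bsup>m + length w\<^esup>\<close>. The action of the free algebra is
  constant on the elements of \<open>S\<close>, so \<open>F_act\<close> takes the common value.
\<close>

definition F_free_act ::
    "'k::field \<Rightarrow> 'k \<Rightarrow> 'k \<Rightarrow> 'k \<Rightarrow> ix \<Rightarrow> 'k free_alg \<Rightarrow> ('k^2) poly \<Rightarrow> ('k^2) poly" where
  "F_free_act a b c \<iota> j f p =
     (\<Sum>w\<in>Poly_Mapping.keys f. \<Sum>m\<le>degree p.
        monom (Poly_Mapping.lookup f w *s V_word a b c \<iota> j w (coeff p m)) (m + length w))"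

definition F_act ::
    "'k::field \<Rightarrow> 'k \<Rightarrow> 'k \<Rightarrow> 'k \<Rightarrow> ix \<Rightarrow> 'k free_alg set \<Rightarrow> ('k^2) poly \<Rightarrow> ('k^2) poly" where
  "F_act a b c \<iota> j s p = the_elem ((\<lambda>f. F_free_act a b c \<iota> j f p) ` s)"

definition F_module ::
    "'k::field \<Rightarrow> 'k \<Rightarrow> 'k \<Rightarrow> 'k \<Rightarrow> ix \<Rightarrow> ('k free_alg set, ('k^2) poly) graded_module" where
  "F_module a b c \<iota> j = \<lparr>
     carrier = UNIV, mult = undefined, one = undefined, zero = 0, add = (+),
     smult = F_act a b c \<iota> j,
     degpart = (\<lambda>n. {monom v n | v. True})\<rparr>"

text \<open>
  \<open>M \<otimes> k\<^sup>2\<close> is \<open>M\<^sup>2\<close>, where \<open>m \<otimes> u\<close> is \<open>(u\<^sub>1 m, u\<^sub>2 m)\<close>; the rule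
  \<open>(s \<otimes> a)(m \<otimes> u) = sm \<otimes> au\<close> becomes the action of 2-by-2 matrices on columns.
\<close>

definition column_module ::
    "('a, 'b, 'm) graded_module_scheme \<Rightarrow> ('a^2^2, 'b^2) graded_module" where
  "column_module M = \<lparr>
     carrier = {v. \<forall>r. v $ r \<in> carrier M}, mult = undefined, one = undefined,
     zero = (\<chi> r. \<zero>\<^bsub>M\<^esub>), add = (\<lambda>v v'. \<chi> r. v $ r \<oplus>\<^bsub>M\<^esub> v' $ r),
     smult = (\<lambda>X v. \<chi> r. X $ r $ 1 \<odot>\<^bsub>M\<^esub> v $ 1 \<oplus>\<^bsub>M\<^esub> X $ r $ 2 \<odot>\<^bsub>M\<^esub> v $ 2),
     degpart = (\<lambda>n. {v. \<forall>r. v $ r \<in> degpart M n})\<rparr>"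

definition Fk2_module ::
    "'k::field \<Rightarrow> 'k \<Rightarrow> 'k \<Rightarrow> 'k \<Rightarrow> ix \<Rightarrow>
     ('k free_alg set^2^2, ('k^2) poly^2) graded_module" where
  "Fk2_module a b c \<iota> j = column_module (F_module a b c \<iota> j)"


section \<open>Points and the modules \<open>M\<^sub>p\<close>\<close>

text \<open>
  A point of \<open>\<bbbP>(A\<^sub>1\<^sup>*)\<close> is a set of coordinate vectors, namely a nonzero vector
  with all its nonzero multiples. The coordinates of a functional are its values at
  \<open>y\<^sub>0, \<dots>, y\<^sub>3\<close>, which form a basis of \<open>A\<^sub>1\<close>.
\<close>

definition proj_point :: "'k::field \<Rightarrow> 'k \<Rightarrow> 'k \<Rightarrow> 'k \<Rightarrow> (ix \<Rightarrow> 'k) set" where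
  "proj_point v\<^sub>0 v\<^sub>1 v\<^sub>2 v\<^sub>3 = {\<lambda>i. l * case_ix v\<^sub>0 v\<^sub>1 v\<^sub>2 v\<^sub>3 i | l. l \<noteq> 0}"

fun PP :: "'k::field \<Rightarrow> 'k \<Rightarrow> 'k \<Rightarrow> 'k \<Rightarrow> ix \<Rightarrow> (ix \<Rightarrow> 'k) set set" where
  "PP a b c \<iota> I0 =
     {proj_point 1 1 1 1, proj_point 1 1 (-1) (-1),
      proj_point 1 (-1) 1 (-1), proj_point 1 (-1) (-1) 1}"
| "PP a b c \<iota> I1 =
     {proj_point (b * c) (- \<iota>) (- \<iota> * b) (- c), proj_point (b * c) (- \<iota>) (\<iota> * b) c,
      proj_point (b * c) \<iota> (- \<iota> * b) c, proj_point (b * c) \<iota> (\<iota> * b) (- c)}"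
| "PP a b c \<iota> I2 =
     {proj_point (a * c) (- a) (- \<iota>) (- \<iota> * c), proj_point (a * c) (- a) \<iota> (\<iota> * c),
      proj_point (a * c) a (- \<iota>) (\<iota> * c), proj_point (a * c) a \<iota> (- \<iota> * c)}"
| "PP a b c \<iota> I3 =
     {proj_point (a * b) (- \<iota> * a) (- b) (- \<iota>), proj_point (a * b) (- \<iota> * a) b \<iota>,
      proj_point (a * b) (\<iota> * a) (- b) \<iota>, proj_point (a * b) (\<iota> * a) b (- \<iota>)}"

definition perp ::
    "(ix \<Rightarrow> 'k::field) \<Rightarrow> 'k \<Rightarrow> (ix \<Rightarrow> 'k) set \<Rightarrow> ('k free_alg set^2^2) set" where
  "perp \<alpha> \<iota> p = {f \<in> A_deg \<alpha> \<iota> 1. \<exists>d.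
     f = (\<Oplus>\<^bsub>S'_alg \<alpha>\<^esub>j\<in>UNIV. S'_const \<alpha> (d j) \<otimes>\<^bsub>S'_alg \<alpha>\<^esub> y_gen \<alpha> \<iota> j) \<and>
     (\<forall>v\<in>p. (\<Sum>j\<in>UNIV. d j * v j) = 0)}"

definition point_module ::
    "(ix \<Rightarrow> 'k::field) \<Rightarrow> 'k \<Rightarrow> (ix \<Rightarrow> 'k) set \<Rightarrow>
     ('k free_alg set^2^2, ('k free_alg set^2^2) set) graded_module" where
  "point_module \<alpha> \<iota> p =
     quotient_module (A_alg \<alpha> \<iota>) (A_deg \<alpha> \<iota>) (left_ideal_gen (A_alg \<alpha> \<iota>) (perp \<alpha> \<iota> p))"

end

theory Submission
  imports Defs
begin

text \<open>
  Let \<open>X\<^sub>i\<close> be the matrix of \<open>x\<^sub>i\<close> on \<open>V(\<tau> + \<xi>\<^sub>j)\<close>. An element of degree \<open>n\<close> of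
  \<open>F \<otimes> k\<^sup>2\<close> is a 2-by-2 matrix \<open>N\<close> (times \<open>t\<^sup>n\<close>), and \<open>x\<^sub>i \<otimes> m\<close> sends it to
  \<open>m N X\<^sub>i\<^sup>T\<close> in degree \<open>n + 1\<close>. Each \<open>X\<^sub>i\<close> is a nonzero multiple of one of the
  matrices \<open>q\<close>, namely the one whose index is the product of \<open>i\<close> and \<open>j\<close> in \<open>\<Gamma>\<close>, and
  the \<open>q\<close> commute up to the signs by which \<open>\<Gamma>\<close> acts on the generators. Hence, for every
  \<open>h\<close>, the maps \<open>N \<mapsto> \<plusminus> q\<^sub>g N q\<^sub>g\<^sup>T\<close>, with the sign \<open>gen_sign g h\<close> in degree \<open>0\<close> and an
  additional factor \<open>gen_sign g j\<close> for each further degree, form an equivariant structure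
  (\<open>equivariant_structure_map\<close>).

  \<^emph>\<open>Existence.\<close> Put \<open>r\<^sub>i = p\<^sub>i / p\<^sub>0\<close>. A product \<open>E\<close> of two of the \<open>q\<close>, regarded as an
  element \<open>e\<close> of degree \<open>0\<close>, satisfies \<open>y\<^sub>i e = r\<^sub>i y\<^sub>0 e\<close>, and \<open>e\<close> is invariant for a
  suitable \<open>h\<close> (\<open>exists_point_datum\<close>). Two invariant matrices of the same degree differ by
  a matrix that commutes with all \<open>q\<close>, that is, by a scalar. So the invariants in degree
  \<open>n\<close> are the line through \<open>y\<^sub>0\<^sup>n e\<close>, and \<open>x \<mapsto> x e\<close> maps \<open>A\<close> onto the invariants and
  kills \<open>p\<^sup>\<bottom>\<close>. The point is that its kernel is not larger than \<open>A p\<^sup>\<bottom>\<close>, for which it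
  suffices that the powers of \<open>y\<^sub>0\<close> span \<open>A\<close> modulo \<open>A p\<^sup>\<bottom>\<close> (\<open>A_reduce\<close>). As \<open>A\<close> is
  spanned by the products of the \<open>y\<^sub>i\<close>, this means that every \<open>y\<^sub>i y\<^sub>0\<^sup>n\<close> is a multiple of
  \<open>y\<^sub>0\<^bsup>n+1\<^esup>\<close>. If \<open>y\<^sub>i u \<equiv> r\<^sub>i y\<^sub>0 u\<close> for all \<open>i\<close>, then the relations
  \<open>y\<^sub>0 y\<^sub>i + y\<^sub>i y\<^sub>0 = y\<^sub>k y\<^sub>l + y\<^sub>l y\<^sub>k\<close> applied to \<open>u\<close> become three linear equations for
  \<open>y\<^sub>1 y\<^sub>0 u, y\<^sub>2 y\<^sub>0 u, y\<^sub>3 y\<^sub>0 u\<close> in terms of \<open>y\<^sub>0 y\<^sub>0 u\<close>. Their determinant is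
  \<open>1 - r\<^sub>1\<^sup>2 - r\<^sub>2\<^sup>2 - r\<^sub>3\<^sup>2 - 2 r\<^sub>1 r\<^sub>2 r\<^sub>3\<close>; for the points of \<open>\<PP>\<^sub>1\<close> it is a nonzero
  multiple of \<open>(\<alpha>\<^sub>2 - 1) (\<alpha>\<^sub>3 + 1)\<close>, and similarly for the other \<open>\<PP>\<^sub>j\<close>. The unique solution
  is again a point of \<open>\<PP>\<^sub>j\<close>, obtained from \<open>r\<close> by applying \<open>g\<^sub>j\<close>, so that the argument
  can be repeated with \<open>y\<^sub>0 u\<close> in place of \<open>u\<close> (\<open>point_step\<close>).

  \<^emph>\<open>Uniqueness.\<close> If \<open>M\<^sub>p\<close> is isomorphic to the invariants of some structure \<open>\<psi>\<close>, the image
  of its generator is a nonzero \<open>\<psi>\<close>-invariant element of degree \<open>0\<close> killed by \<open>p\<^sup>\<bottom>\<close>.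
  Again by commutation with the \<open>q\<close>, such an element is a multiple of \<open>e\<close>. So \<open>e\<close> itself is
  \<open>\<psi>\<close>-invariant, and since it generates \<open>F \<otimes> k\<^sup>2\<close> over \<open>S'\<close>, the rule
  \<open>\<psi>\<^sub>g(x e) = g(x) e\<close> determines \<open>\<psi>\<close> completely (\<open>structure_determined\<close>).
\<close>

section \<open>The free algebra and its quotient \<open>S\<close>\<close>

lemma poly_mapping_support_induct [consumes 1, case_names single zero add]:
  fixes f :: "'a \<Rightarrow>\<^sub>0 'b::monoid_add"
  assumes "Poly_Mapping.keys f \<subseteq> W"
    and "\<And>w c. w \<in> W \<Longrightarrow> P (Poly_Mapping.single w c)" and "P 0"
    and "\<And>f g. P f \<Longrightarrow> P g \<Longrightarrow> P (f + g)"
  shows "P f"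
  using assms(1)
proof (induction f rule: update_induct)
  case const
  show ?case by (rule assms(3))
next
  case (update f a b)
  have "Poly_Mapping.update a b f = f + Poly_Mapping.single a b"
    using update(1)
    by (intro poly_mapping_eqI)
      (auto simp: lookup_update lookup_add lookup_single in_keys_iff when_def)
  moreover have "Poly_Mapping.keys f \<subseteq> W" "a \<in> W"
    using update(2,4) by (auto simp: keys_update)
  ultimately show ?case
    using update(3) assms(2,4) by simp
qed

lemma poly_mapping_single_induct [case_names single add]:
  fixes f :: "'a \<Rightarrow>\<^sub>0 'b::monoid_add"
  assumes "\<And>w c. P (Poly_Mapping.single w c)" and "\<And>f g. P f \<Longrightarrow> P g \<Longrightarrow> P (f + g)"
  shows "P f"
  using poly_mapping_support_induct[of f UNIV P] assms single_zero by (metis subset_UNIV)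

lemma ring_free_ring: "ring (free_ring :: 'k::field free_alg ring)"
proof (intro ringI abelian_groupI monoidI)
  fix x :: "'k free_alg"
  show "\<exists>y\<in>carrier free_ring. y \<oplus>\<^bsub>free_ring\<^esub> x = \<zero>\<^bsub>free_ring\<^esub>"
    by (rule bexI[of _ "- x"]) (auto simp: free_ring_def)
qed (auto simp: free_ring_def algebra_simps)

lemma ideal_S_ideal: "ideal (S_ideal \<alpha>) free_ring"
  unfolding S_ideal_def
  by (rule ring.genideal_ideal[OF ring_free_ring]) (simp add: free_ring_def)

lemma free_ring_minus: "\<ominus>\<^bsub>free_ring\<^esub> f = - (f :: 'k::field free_alg)"
proof -
  interpret ring "free_ring :: 'k free_alg ring" by (rule ring_free_ring)
  show ?thesis
    by (rule minus_equality) (auto simp: free_ring_def)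
qed

lemma S_ideal_zero: "0 \<in> S_ideal \<alpha>"
  and S_ideal_add: "f \<in> S_ideal \<alpha> \<Longrightarrow> g \<in> S_ideal \<alpha> \<Longrightarrow> f + g \<in> S_ideal \<alpha>"
  and S_ideal_uminus: "f \<in> S_ideal \<alpha> \<Longrightarrow> - f \<in> S_ideal \<alpha>"
  and S_ideal_mult_left: "f \<in> S_ideal \<alpha> \<Longrightarrow> h * f \<in> S_ideal \<alpha>"
  and S_ideal_mult_right: "f \<in> S_ideal \<alpha> \<Longrightarrow> f * h \<in> S_ideal \<alpha>"
proof -
  interpret ideal "S_ideal \<alpha>" free_ring by (rule ideal_S_ideal)
  note sub = additive_subgroup.zero_closed[OF is_additive_subgroup]
    additive_subgroup.a_closed[OF is_additive_subgroup]
    additive_subgroup.a_inv_closed[OF is_additive_subgroup]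
  show "0 \<in> S_ideal \<alpha>" using sub(1) by (simp add: free_ring_def)
  show "f \<in> S_ideal \<alpha> \<Longrightarrow> g \<in> S_ideal \<alpha> \<Longrightarrow> f + g \<in> S_ideal \<alpha>"
    using sub(2)[of f g] by (simp add: free_ring_def)
  show "f \<in> S_ideal \<alpha> \<Longrightarrow> - f \<in> S_ideal \<alpha>"
    using sub(3)[of f] by (simp add: free_ring_minus)
  show "f \<in> S_ideal \<alpha> \<Longrightarrow> h * f \<in> S_ideal \<alpha>"
    using I_l_closed[of f h] by (simp add: free_ring_def)
  show "f \<in> S_ideal \<alpha> \<Longrightarrow> f * h \<in> S_ideal \<alpha>"
    using I_r_closed[of f h] by (simp add: free_ring_def)
qed

lemma S_relations_subset: "S_relations \<alpha> \<subseteq> S_ideal \<alpha>"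
  unfolding S_ideal_def
  by (rule ring.genideal_self[OF ring_free_ring]) (simp add: free_ring_def)

lemma S_ideal_minimal:
  assumes "S_relations \<alpha> \<subseteq> I" and "0 \<in> I"
    and "\<And>f g. f \<in> I \<Longrightarrow> g \<in> I \<Longrightarrow> f + g \<in> I" and "\<And>f. f \<in> I \<Longrightarrow> - f \<in> I"
    and "\<And>f h. f \<in> I \<Longrightarrow> h * f \<in> I" and "\<And>f h. f \<in> I \<Longrightarrow> f * h \<in> I"
  shows "S_ideal \<alpha> \<subseteq> I"
  unfolding S_ideal_def
proof (rule ring.genideal_minimal[OF ring_free_ring])
  show "ideal I free_ring"
  proof (intro idealI ring_free_ring subgroup.intro)
    fix x assume "x \<in> I"
    then show "inv\<^bsub>add_monoid free_ring\<^esub> x \<in> I"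
      using assms(4) free_ring_minus[of x] by (simp only: a_inv_def)
  qed (use assms in \<open>auto simp: free_ring_def\<close>)
qed (use assms in auto)

lemma S_class_eq_iff: "S_class \<alpha> f = S_class \<alpha> g \<longleftrightarrow> f - g \<in> S_ideal \<alpha>"
proof -
  have coset: "S_class \<alpha> h = (\<lambda>i. i + h) ` S_ideal \<alpha>" for h
    unfolding S_class_def a_r_coset_def' by (auto simp: free_ring_def)
  show ?thesis
  proof
    assume "S_class \<alpha> f = S_class \<alpha> g"
    moreover have "f \<in> S_class \<alpha> f"
      unfolding coset using S_ideal_zero by force
    ultimately show "f - g \<in> S_ideal \<alpha>"
      by (auto simp: coset)
  next
    assume d: "f - g \<in> S_ideal \<alpha>"
    then have d': "g - f \<in> S_ideal \<alpha>"
      using S_ideal_uminus by fastforce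
    have "i + f \<in> (\<lambda>i. i + g) ` S_ideal \<alpha>" if "i \<in> S_ideal \<alpha>" for i
      by (rule image_eqI[of _ _ "i + (f - g)"]) (use S_ideal_add[OF that d] in auto)
    moreover have "i + g \<in> (\<lambda>i. i + f) ` S_ideal \<alpha>" if "i \<in> S_ideal \<alpha>" for i
      by (rule image_eqI[of _ _ "i + (g - f)"]) (use S_ideal_add[OF that d'] in auto)
    ultimately show "S_class \<alpha> f = S_class \<alpha> g"
      unfolding coset by blast
  qed
qed

lemma S_class_mem_iff: "h \<in> S_class \<alpha> f \<longleftrightarrow> h - f \<in> S_ideal \<alpha>"
proof -
  have "S_class \<alpha> f = (\<lambda>i. i + f) ` S_ideal \<alpha>"
    unfolding S_class_def a_r_coset_def' by (auto simp: free_ring_def)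
  moreover have "h \<in> (\<lambda>i. i + f) ` S_ideal \<alpha>" if "h - f \<in> S_ideal \<alpha>"
    by (rule image_eqI[OF _ that]) simp
  ultimately show ?thesis by auto
qed

lemma carrier_S_alg: "carrier (S_alg \<alpha>) = range (S_class \<alpha>)"
  unfolding S_alg_def FactRing_def S_class_def A_RCOSETS_def' by (auto simp: free_ring_def)

lemma S_class_add: "S_class \<alpha> f \<oplus>\<^bsub>S_alg \<alpha>\<^esub> S_class \<alpha> g = S_class \<alpha> (f + g)"
  and S_class_mult: "S_class \<alpha> f \<otimes>\<^bsub>S_alg \<alpha>\<^esub> S_class \<alpha> g = S_class \<alpha> (f * g)"
  and S_class_one: "\<one>\<^bsub>S_alg \<alpha>\<^esub> = S_class \<alpha> 1"
  and S_class_zero: "\<zero>\<^bsub>S_alg \<alpha>\<^esub> = S_class \<alpha> 0"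
proof -
  interpret I: ideal "S_ideal \<alpha>" free_ring by (rule ideal_S_ideal)
  interpret h: ring_hom_ring free_ring "S_alg \<alpha>" "S_class \<alpha>"
    using I.rcos_ring_hom_ring unfolding S_alg_def S_class_def .
  show "S_class \<alpha> f \<oplus>\<^bsub>S_alg \<alpha>\<^esub> S_class \<alpha> g = S_class \<alpha> (f + g)"
    using h.hom_add[of f g] by (simp add: free_ring_def)
  show "S_class \<alpha> f \<otimes>\<^bsub>S_alg \<alpha>\<^esub> S_class \<alpha> g = S_class \<alpha> (f * g)"
    using h.hom_mult[of f g] by (simp add: free_ring_def)
  show "\<one>\<^bsub>S_alg \<alpha>\<^esub> = S_class \<alpha> 1"
    using h.hom_one by (simp add: free_ring_def)
  show "\<zero>\<^bsub>S_alg \<alpha>\<^esub> = S_class \<alpha> 0"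
    using h.hom_zero by (simp add: free_ring_def)
qed

lemma fgen_mult: "fgen i * fgen k = Poly_Mapping.single [i, k] 1"
  by (simp add: fgen_def mult_single plus_list_def)

lemma fconst_mult_single: "fconst d * Poly_Mapping.single w c = Poly_Mapping.single w (d * c)"
  by (simp add: fconst_def mult_single plus_list_def)

lemma fconst_one: "fconst 1 = 1"
  unfolding fconst_def using single_one[where ?'a = "ix list"] by (simp only: zero_list_def)

lemma fconst_central: "fconst c * f = f * fconst c"
  by (induction f rule: poly_mapping_single_induct)
    (auto simp: fconst_def mult_single plus_list_def mult.commute distrib_left distrib_right)

definition word_sign :: "ix \<Rightarrow> ix list \<Rightarrow> 'k::field" where
  "word_sign g w = prod_list (map (gen_sign g) w)"

lemma word_sign_append: "word_sign g (u @ w) = word_sign g u * word_sign g w"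
  by (simp add: word_sign_def)

lemma lookup_free_act: "Poly_Mapping.lookup (free_act g f) w = word_sign g w * Poly_Mapping.lookup f w"
  by (auto simp: free_act_def lookup_mapp word_sign_def when_def in_keys_iff)

lemma free_act_single: "free_act g (Poly_Mapping.single w c) = Poly_Mapping.single w (word_sign g w * c)"
  by (intro poly_mapping_eqI) (auto simp: lookup_free_act lookup_single when_def)

lemma free_act_add: "free_act g (f + h) = free_act g f + free_act g h"
  by (intro poly_mapping_eqI) (simp add: lookup_free_act lookup_add distrib_left)

lemma free_act_diff: "free_act g (f - h) = free_act g f - free_act g h"
  by (intro poly_mapping_eqI) (simp add: lookup_free_act lookup_minus right_diff_distrib)

lemma free_act_zero: "free_act g 0 = 0"
  by (intro poly_mapping_eqI) (simp add: lookup_free_act)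

lemma free_act_uminus: "free_act g (- f) = - free_act g f"
  by (intro poly_mapping_eqI) (simp add: lookup_free_act)

lemma free_act_mult: "free_act g (f * h) = free_act g f * free_act g h"
proof (induction f rule: poly_mapping_single_induct)
  case (single u c)
  show ?case
    by (induction h rule: poly_mapping_single_induct)
      (auto simp: free_act_single mult_single plus_list_def word_sign_append distrib_left
        free_act_add mult_ac free_act_zero)
qed (auto simp: free_act_add distrib_right free_act_zero)

lemma gen_sign_cases: "gen_sign g i = 1 \<or> gen_sign g i = (-1)"
  by (simp add: gen_sign_def)

lemma gen_sign_I0 [simp]: "gen_sign I0 i = 1"  "gen_sign g I0 = 1"
  by (simp_all add: gen_sign_def)

text \<open>
  All words occurring in one defining relation carry the same sign, because the sign of
  \<open>g\<close> on \<open>x\<^sub>i\<close> is the product of its signs on the other two generators \<open>x\<^sub>k\<close> and \<open>x\<^sub>l\<close>.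
\<close>

lemma free_act_S_relations:
  assumes "f \<in> S_relations \<alpha>"
  shows "free_act g f = f \<or> free_act g f = - f"
proof -
  obtain i j k where c: "(i, j, k) \<in> cyclic_perms"
    and "f \<in> {fgen I0 * fgen i - fgen i * fgen I0
          - fconst (\<alpha> i) * (fgen j * fgen k + fgen k * fgen j),
        fgen I0 * fgen i + fgen i * fgen I0
          - (fgen j * fgen k - fgen k * fgen j)}"
    using assms unfolding S_relations_def by (elim UN_E) (simp only: split_paired_all prod.case)
  then have f: "f = Poly_Mapping.single [I0, i] 1 - Poly_Mapping.single [i, I0] 1
          - (Poly_Mapping.single [j, k] (\<alpha> i) + Poly_Mapping.single [k, j] (\<alpha> i)) \<or>
        f = Poly_Mapping.single [I0, i] 1 + Poly_Mapping.single [i, I0] 1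
          - (Poly_Mapping.single [j, k] 1 - Poly_Mapping.single [k, j] 1)"
    by (simp add: fgen_mult fconst_mult_single distrib_left)
  have sgn: "word_sign g [i, I0] = (gen_sign g i :: 'a)" "word_sign g [I0, i] = (gen_sign g i :: 'a)"
    "word_sign g [j, k] = (gen_sign g i :: 'a)" "word_sign g [k, j] = (gen_sign g i :: 'a)"
    using c by (cases g; auto simp: cyclic_perms_def word_sign_def gen_sign_def)+
  show ?thesis
  proof (cases "gen_sign g i = (1 :: 'a)")
    case True
    with f show ?thesis
      by (elim disjE; simp add: free_act_add free_act_diff free_act_single sgn)
  next
    case False
    then have "gen_sign g i = (-1 :: 'a)" using gen_sign_cases by blast
    with f show ?thesis
      by (elim disjE; simp add: free_act_add free_act_diff free_act_single sgn single_uminus)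
  qed
qed

lemma free_act_S_ideal:
  assumes "f \<in> S_ideal \<alpha>"
  shows "free_act g f \<in> S_ideal \<alpha>"
proof -
  have "S_ideal \<alpha> \<subseteq> {f. free_act g f \<in> S_ideal \<alpha>}"
  proof (rule S_ideal_minimal)
    show "S_relations \<alpha> \<subseteq> {f. free_act g f \<in> S_ideal \<alpha>}"
    proof
      fix f assume f: "f \<in> S_relations \<alpha>"
      then have "f \<in> S_ideal \<alpha>" using S_relations_subset by blast
      with free_act_S_relations[OF f, of g] S_ideal_uminus[of f \<alpha>]
      show "f \<in> {f. free_act g f \<in> S_ideal \<alpha>}" by (elim disjE) simp_all
    qed
  qed (simp_all add: free_act_zero free_act_add free_act_uminus free_act_mult
      S_ideal_zero S_ideal_add S_ideal_uminus S_ideal_mult_left S_ideal_mult_right)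
  with assms show ?thesis by auto
qed

lemma free_act_idem: "free_act g (free_act g f) = f"
proof (rule poly_mapping_eqI)
  fix w :: "ix list"
  have "word_sign g w * word_sign g w = (1::'a)"
    by (induction w) (use gen_sign_cases[of g, where ?'a = 'a] in \<open>auto simp: word_sign_def gen_sign_def\<close>)
  then show "Poly_Mapping.lookup (free_act g (free_act g f)) w = Poly_Mapping.lookup f w"
    by (simp add: lookup_free_act mult.assoc[symmetric])
qed

lemma S_act_S_class: "S_act g (S_class \<alpha> f) = S_class \<alpha> (free_act g f)"
proof -
  have "h \<in> free_act g ` S_class \<alpha> f" if "h \<in> S_class \<alpha> (free_act g f)" for h
  proof (rule image_eqI)
    show "h = free_act g (free_act g h)" by (simp add: free_act_idem)
    show "free_act g h \<in> S_class \<alpha> f"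
      using that free_act_S_ideal[of "h - free_act g f" \<alpha> g]
      by (simp add: S_class_mem_iff free_act_diff free_act_idem)
  qed
  moreover have "free_act g h \<in> S_class \<alpha> (free_act g f)" if "h \<in> S_class \<alpha> f" for h
    using that free_act_S_ideal[of "h - f" \<alpha> g] by (simp add: S_class_mem_iff free_act_diff)
  ultimately show ?thesis
    by (auto simp: S_act_def)
qed


section \<open>Matrices over the free algebra as representatives for \<open>S'\<close>\<close>

lemmas mat2_simps = vec_eq_iff forall_2 matrix_matrix_mult_def sum_2 mat_def

text \<open>
  Every element of \<open>S'\<close> is the class of a matrix over the free algebra. Calculations in
  \<open>S'\<close> are done on such representatives, where the ring laws come from the type class and
  matrix product is \<open>**\<close>.
\<close>

definition S'_class :: "(ix \<Rightarrow> 'k::field) \<Rightarrow> 'k free_alg^2^2 \<Rightarrow> 'k free_alg set^2^2" where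
  "S'_class \<alpha> P = (\<chi> r c. S_class \<alpha> (P $ r $ c))"

lemma S'_class_eq_iff: "S'_class \<alpha> P = S'_class \<alpha> Q \<longleftrightarrow> (\<forall>r c. (P - Q) $ r $ c \<in> S_ideal \<alpha>)"
  by (simp add: S'_class_def vec_eq_iff S_class_eq_iff)

lemma carrier_S'_alg: "carrier (S'_alg \<alpha>) = range (S'_class \<alpha>)"
proof -
  have "X \<in> range (S'_class \<alpha>)" if X: "\<And>r c. X $ r $ c \<in> range (S_class \<alpha>)" for X :: "'a free_alg set^2^2"
  proof -
    define f where "f r c = (SOME f. X $ r $ c = S_class \<alpha> f)" for r c
    have f: "X $ r $ c = S_class \<alpha> (f r c)" for r c
      unfolding f_def by (rule someI_ex) (use X[of r c] in blast)
    then have "X = S'_class \<alpha> (\<chi> r c. f r c)"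
      by (simp add: S'_class_def vec_eq_iff)
    then show ?thesis by blast
  qed
  then show ?thesis
    by (auto simp: S'_alg_def mat2_ring_def carrier_S_alg S'_class_def)
qed

lemma S'_class_add: "S'_class \<alpha> P \<oplus>\<^bsub>S'_alg \<alpha>\<^esub> S'_class \<alpha> Q = S'_class \<alpha> (P + Q)"
  and S'_class_mult: "S'_class \<alpha> P \<otimes>\<^bsub>S'_alg \<alpha>\<^esub> S'_class \<alpha> Q = S'_class \<alpha> (P ** Q)"
  and S'_class_one: "\<one>\<^bsub>S'_alg \<alpha>\<^esub> = S'_class \<alpha> (mat 1)"
  and S'_class_zero: "\<zero>\<^bsub>S'_alg \<alpha>\<^esub> = S'_class \<alpha> 0"
  by (simp_all add: S'_alg_def mat2_ring_def S'_class_def vec_eq_iff S_class_add S_class_mult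
      S_class_one S_class_zero matrix_matrix_mult_def sum_2 mat_def)

lemma matrix_mult_add_right: "A ** (B + C) = A ** B + A ** (C :: 'a::semiring_1^2^2)"
  and matrix_mult_add_left: "(A + B) ** C = A ** C + B ** (C :: 'a::semiring_1^2^2)"
  by (simp_all add: mat2_simps algebra_simps)

lemma matrix_mult_diff_right: "A ** (B - C) = A ** B - A ** (C :: 'a::ring_1^2^2)"
  and matrix_mult_diff_left: "(A - B) ** C = A ** C - B ** (C :: 'a::ring_1^2^2)"
  by (simp_all add: mat2_simps algebra_simps)

lemma ring_S'_alg: "ring (S'_alg \<alpha>)"
proof (intro ringI abelian_groupI monoidI)
  fix x assume "x \<in> carrier (S'_alg \<alpha>)"
  then obtain P where P: "x = S'_class \<alpha> P"
    by (auto simp: carrier_S'_alg)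
  show "\<exists>y\<in>carrier (S'_alg \<alpha>). y \<oplus>\<^bsub>S'_alg \<alpha>\<^esub> x = \<zero>\<^bsub>S'_alg \<alpha>\<^esub>"
    by (rule bexI[of _ "S'_class \<alpha> (- P)"])
      (auto simp: P carrier_S'_alg S'_class_add S'_class_zero)
qed (auto simp: carrier_S'_alg S'_class_add S'_class_mult S'_class_one S'_class_zero
    matrix_mult_add_right matrix_mult_add_left matrix_mul_assoc add_ac)

lemma S'_class_uminus: "\<ominus>\<^bsub>S'_alg \<alpha>\<^esub> S'_class \<alpha> P = S'_class \<alpha> (- P)"
proof -
  interpret ring "S'_alg \<alpha>" by (rule ring_S'_alg)
  show ?thesis
    by (rule minus_equality) (auto simp: carrier_S'_alg S'_class_add S'_class_zero)
qed

text \<open>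
  \<open>word_mat w m\<close> represents \<open>w \<otimes> m\<close>.
\<close>

definition word_mat :: "ix list \<Rightarrow> 'k::field^2^2 \<Rightarrow> 'k free_alg^2^2" where
  "word_mat w m = (\<chi> r c. Poly_Mapping.single w (m $ r $ c))"

lemma word_mat_mult: "word_mat u m ** word_mat w n = word_mat (u @ w) (m ** n)"
  by (simp add: word_mat_def mat2_simps mult_single plus_list_def single_add)

lemma word_mat_add: "word_mat w (m + n) = word_mat w m + word_mat w n"
  by (simp add: word_mat_def vec_eq_iff single_add)

lemma word_mat_zero: "word_mat w 0 = 0"
  by (simp add: word_mat_def vec_eq_iff)

lemma word_mat_Nil_mat: "word_mat [] (mat c) = mat (fconst c)"
  by (simp add: word_mat_def mat2_simps fconst_def)

lemma word_mat_one: "word_mat [] (mat 1) = mat 1"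
  by (simp add: word_mat_Nil_mat fconst_one)

definition supported_in :: "ix list set \<Rightarrow> 'k::field free_alg^2^2 \<Rightarrow> bool" where
  "supported_in W P \<longleftrightarrow> (\<forall>r c. Poly_Mapping.keys (P $ r $ c) \<subseteq> W)"

lemma supported_in_word_mat: "w \<in> W \<Longrightarrow> supported_in W (word_mat w m)"
  by (simp add: supported_in_def word_mat_def)

lemma supported_in_add: "supported_in W P \<Longrightarrow> supported_in W Q \<Longrightarrow> supported_in W (P + Q)"
  unfolding supported_in_def vector_add_component
  by (intro allI order_trans[OF keys_add Un_least]) simp_all

lemma matrix_support_induct [consumes 1, case_names word_mat zero add]:
  assumes W: "supported_in W P"
    and word: "\<And>w m. w \<in> W \<Longrightarrow> R (word_mat w m)" and zero: "R 0"
    and add: "\<And>P Q. R P \<Longrightarrow> R Q \<Longrightarrow> R (P + Q)"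
  shows "R P"
proof -
  define E :: "2 \<Rightarrow> 2 \<Rightarrow> 'a free_alg \<Rightarrow> 'a free_alg^2^2"
    where "E r c f = (\<chi> r' c'. if r' = r \<and> c' = c then f else 0)" for r c f
  have "R (E r c (P $ r $ c))" for r c
  proof -
    have "Poly_Mapping.keys (P $ r $ c) \<subseteq> W" using W by (simp add: supported_in_def)
    then show ?thesis
    proof (induction rule: poly_mapping_support_induct)
      case (single w x)
      have "E r c (Poly_Mapping.single w x) = word_mat w (\<chi> r' c'. if r' = r \<and> c' = c then x else 0)"
        by (simp add: E_def word_mat_def vec_eq_iff)
      with word[OF single] show ?case by simp
    next
      case zero
      have "E r c 0 = 0" by (simp add: E_def vec_eq_iff)
      then show ?case using assms(3) by simp
    next
      case (add f g)
      have "E r c (f + g) = E r c f + E r c g" by (simp add: E_def vec_eq_iff)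
      then show ?case using add assms(4) by simp
    qed
  qed
  then have "R ((E 1 1 (P $ 1 $ 1) + E 1 2 (P $ 1 $ 2)) + (E 2 1 (P $ 2 $ 1) + E 2 2 (P $ 2 $ 2)))"
    by (intro add)
  moreover have "(E 1 1 (P $ 1 $ 1) + E 1 2 (P $ 1 $ 2)) + (E 2 1 (P $ 2 $ 1) + E 2 2 (P $ 2 $ 2)) = P"
    by (simp add: E_def vec_eq_iff forall_2)
  ultimately show ?thesis
    by (simp only:)
qed

lemma matrix_word_induct [case_names word_mat add]:
  assumes "\<And>w m. R (word_mat w m)" and "\<And>P Q. R P \<Longrightarrow> R Q \<Longrightarrow> R (P + Q)"
  shows "R P"
proof -
  have "R 0" using assms(1)[of _ 0] by (simp add: word_mat_zero)
  with assms show ?thesis by (intro matrix_support_induct[of UNIV P R]) (simp_all add: supported_in_def)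
qed

lemma tens_S_class: "tens \<alpha> (S_class \<alpha> (Poly_Mapping.single w 1)) m = S'_class \<alpha> (word_mat w m)"
  by (simp add: tens_def S'_class_def word_mat_def S_class_mult fconst_mult_single)

lemma tens_one: "tens \<alpha> \<one>\<^bsub>S_alg \<alpha>\<^esub> m = S'_class \<alpha> (word_mat [] m)"
  using tens_S_class[of \<alpha> "[]" m] fconst_one[where ?'a = 'a] by (simp add: S_class_one fconst_def)

lemma S'_const_eq: "S'_const \<alpha> d = S'_class \<alpha> (word_mat [] (mat d))"
  by (simp add: S'_const_def tens_one)

lemma y_gen_eq: "y_gen \<alpha> \<iota> i = S'_class \<alpha> (word_mat [i] (qmat \<iota> i))"
  by (simp add: y_gen_def fgen_def tens_S_class)

lemma scale_mat_nth [simp]: "scale_mat d m $ r $ c = d * m $ r $ c"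
  by (simp add: map_matrix_def)

lemma scale_mat_mult_left: "scale_mat d m ** n = scale_mat d (m ** (n :: 'k::field^2^2))"
  and scale_mat_mult_right: "m ** scale_mat d n = scale_mat d (m ** (n :: 'k::field^2^2))"
  and scale_mat_scale_mat: "scale_mat d (scale_mat e m) = scale_mat (d * e) (m :: 'k::field^2^2)"
  and scale_mat_one [simp]: "scale_mat 1 m = (m :: 'k::field^2^2)"
  and scale_mat_zero: "scale_mat 0 m = (0 :: 'k::field^2^2)"
  and scale_mat_add: "scale_mat d (m + n) = scale_mat d m + scale_mat d (n :: 'k::field^2^2)"
  and scale_mat_add_left: "scale_mat (d + e) m = scale_mat d m + scale_mat e (m :: 'k::field^2^2)"
  and mat_mult_eq_scale_mat: "mat d ** m = scale_mat d (m :: 'k::field^2^2)"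
  and mult_mat_eq_scale_mat: "m ** mat d = scale_mat d (m :: 'k::field^2^2)"
  by (simp_all add: mat2_simps algebra_simps)

lemma qmat_sqrt:
  assumes "\<iota>^2 = (-1 :: 'k::field)"
  shows "\<iota> * \<iota> = -1" "\<iota> * (\<iota> * x) = - x"
  using assms by (simp_all add: power2_eq_square mult.assoc[symmetric])

lemmas qmat_simps = mat2_simps vector_2

lemma qmat_square:
  assumes "\<iota>^2 = (-1 :: 'k::field)"
  shows "qmat \<iota> g ** qmat \<iota> g = (if g = I0 then mat 1 else mat (-1))"
  by (cases g) (simp_all add: qmat_simps qmat_sqrt[OF assms])

lemma qmat_inverse:
  assumes "\<iota>^2 = (-1 :: 'k::field)"
  shows "qmat \<iota> g ** matrix_inv (qmat \<iota> g) = mat 1" "matrix_inv (qmat \<iota> g) ** qmat \<iota> g = mat 1"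
proof -
  define d :: 'k where "d = (if g = I0 then 1 else -1)"
  have "qmat \<iota> g ** scale_mat d (qmat \<iota> g) = mat 1 \<and> scale_mat d (qmat \<iota> g) ** qmat \<iota> g = mat 1"
    by (auto simp: scale_mat_mult_left scale_mat_mult_right qmat_square[OF assms] d_def)
       (simp_all add: mat2_simps)
  then have "qmat \<iota> g ** matrix_inv (qmat \<iota> g) = mat 1 \<and> matrix_inv (qmat \<iota> g) ** qmat \<iota> g = mat 1"
    unfolding matrix_inv_def
    by (rule someI[where P = "\<lambda>B. qmat \<iota> g ** B = mat 1 \<and> B ** qmat \<iota> g = mat 1"])
  then show "qmat \<iota> g ** matrix_inv (qmat \<iota> g) = mat 1" "matrix_inv (qmat \<iota> g) ** qmat \<iota> g = mat 1"
    by auto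
qed

text \<open>
  The diagonal action of \<open>\<Gamma>\<close>, lifted to representatives.
\<close>

definition free_mat_act :: "'k::field \<Rightarrow> ix \<Rightarrow> 'k free_alg^2^2 \<Rightarrow> 'k free_alg^2^2" where
  "free_mat_act \<iota> g P = word_mat [] (qmat \<iota> g) ** (\<chi> r c. free_act g (P $ r $ c)) **
     word_mat [] (matrix_inv (qmat \<iota> g))"

lemma S'_act_S'_class: "S'_act \<alpha> \<iota> g (S'_class \<alpha> P) = S'_class \<alpha> (free_mat_act \<iota> g P)"
proof -
  have "(\<chi> r c. S_act g (S'_class \<alpha> P $ r $ c)) = S'_class \<alpha> (\<chi> r c. free_act g (P $ r $ c))"
    by (simp add: S'_class_def S_act_S_class vec_eq_iff)
  then show ?thesis
    by (simp add: S'_act_def tens_one S'_class_mult free_mat_act_def)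
qed

lemma free_mat_act_add: "free_mat_act \<iota> g (P + Q) = free_mat_act \<iota> g P + free_mat_act \<iota> g Q"
proof -
  have "(\<chi> r c. free_act g ((P + Q) $ r $ c)) =
      (\<chi> r c. free_act g (P $ r $ c)) + (\<chi> r c. free_act g (Q $ r $ c))"
    by (simp add: free_act_add vec_eq_iff)
  then show ?thesis
    by (simp add: free_mat_act_def matrix_mult_add_left matrix_mult_add_right)
qed

lemma free_mat_act_word_mat:
  "free_mat_act \<iota> g (word_mat w m) =
     word_mat w (scale_mat (word_sign g w) (qmat \<iota> g ** m ** matrix_inv (qmat \<iota> g)))"
proof -
  have "(\<chi> r c. free_act g (word_mat w m $ r $ c)) = word_mat w (scale_mat (word_sign g w) m)"
    by (simp add: word_mat_def free_act_single vec_eq_iff)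
  then show ?thesis
    by (simp add: free_mat_act_def word_mat_mult scale_mat_mult_left scale_mat_mult_right)
qed

lemma free_mat_act_mult:
  assumes "\<iota>^2 = (-1 :: 'k::field)"
  shows "free_mat_act \<iota> g (P ** Q) = free_mat_act \<iota> g P ** free_mat_act \<iota> g Q"
proof (induction P rule: matrix_word_induct)
  case (word_mat u m)
  show ?case
  proof (induction Q rule: matrix_word_induct)
    case (word_mat w n)
    have "matrix_inv (qmat \<iota> g) ** (qmat \<iota> g ** (n ** X)) = n ** X" for X :: "'k^2^2"
      by (simp add: matrix_mul_assoc qmat_inverse[OF assms])
    then show ?case
      by (simp add: word_mat_mult free_mat_act_word_mat word_sign_append scale_mat_mult_left
          scale_mat_mult_right scale_mat_scale_mat matrix_mul_assoc[symmetric] mult.commute)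
  qed (simp add: free_mat_act_add matrix_mult_add_right)
qed (simp add: free_mat_act_add matrix_mult_add_left)

lemma free_mat_act_uminus: "free_mat_act \<iota> g (- P) = - free_mat_act \<iota> g P"
proof -
  have "free_mat_act \<iota> g 0 = 0"
    using free_mat_act_word_mat[of \<iota> g "[]" 0] by (simp add: word_mat_zero mat2_simps)
       (simp add: word_mat_def mat2_simps)
  then show ?thesis
    using free_mat_act_add[of \<iota> g "- P" P] by (simp add: eq_neg_iff_add_eq_0)
qed

lemma free_mat_act_one:
  assumes "\<iota>^2 = (-1 :: 'k::field)"
  shows "free_mat_act \<iota> g (word_mat [] (mat d)) = word_mat [] (mat d)"
  by (simp add: free_mat_act_word_mat word_sign_def mult_mat_eq_scale_mat scale_mat_mult_left
      qmat_inverse[OF assms]) (simp add: word_mat_def mat2_simps)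

section \<open>The ring \<open>A\<close>\<close>

lemma mem_A_alg_iff:
  "S'_class \<alpha> P \<in> carrier (A_alg \<alpha> \<iota>) \<longleftrightarrow> (\<forall>g. S'_class \<alpha> (free_mat_act \<iota> g P) = S'_class \<alpha> P)"
  by (simp add: A_alg_def carrier_S'_alg S'_act_S'_class)

lemma carrier_A_alg_subset: "carrier (A_alg \<alpha> \<iota>) \<subseteq> range (S'_class \<alpha>)"
  by (auto simp: A_alg_def carrier_S'_alg)

lemma A_alg_sel:
  "mult (A_alg \<alpha> \<iota>) = mult (S'_alg \<alpha>)" "add (A_alg \<alpha> \<iota>) = add (S'_alg \<alpha>)"
  "one (A_alg \<alpha> \<iota>) = one (S'_alg \<alpha>)" "zero (A_alg \<alpha> \<iota>) = zero (S'_alg \<alpha>)"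
  by (simp_all add: A_alg_def)

lemma ring_A_alg:
  assumes "\<iota>^2 = (-1 :: 'k::field)"
  shows "ring (A_alg \<alpha> \<iota>)"
proof -
  interpret S': ring "S'_alg \<alpha>" by (rule ring_S'_alg)
  define H where "H = carrier (A_alg \<alpha> \<iota>)"
  have rep: "\<exists>P. x = S'_class \<alpha> P" if "x \<in> H" for x
    using that carrier_A_alg_subset unfolding H_def by blast
  have sub: "x \<in> carrier (S'_alg \<alpha>)" if "x \<in> H" for x
    using that by (auto simp: H_def A_alg_def)
  have one: "\<one>\<^bsub>S'_alg \<alpha>\<^esub> \<in> H"
    by (simp add: H_def S'_class_one mem_A_alg_iff free_mat_act_one[OF assms, of _ 1] flip: word_mat_one)
  have zero: "\<zero>\<^bsub>S'_alg \<alpha>\<^esub> \<in> H"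
    using free_mat_act_add[of \<iota> _ 0 0] by (simp add: H_def S'_class_zero mem_A_alg_iff)
  have neg: "\<ominus>\<^bsub>S'_alg \<alpha>\<^esub> x \<in> H" if x: "x \<in> H" for x
  proof -
    obtain P where P: "x = S'_class \<alpha> P" using rep[OF x] by blast
    show ?thesis
      using x unfolding P H_def
      by (simp add: S'_class_uminus mem_A_alg_iff free_mat_act_uminus) (simp flip: S'_class_uminus)
  qed
  have closed: "x \<otimes>\<^bsub>S'_alg \<alpha>\<^esub> y \<in> H" "x \<oplus>\<^bsub>S'_alg \<alpha>\<^esub> y \<in> H" if xy: "x \<in> H" "y \<in> H" for x y
  proof -
    obtain P Q where PQ: "x = S'_class \<alpha> P" "y = S'_class \<alpha> Q"
      using rep[OF xy(1)] rep[OF xy(2)] by blast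
    show "x \<otimes>\<^bsub>S'_alg \<alpha>\<^esub> y \<in> H"
      using xy unfolding PQ H_def
      by (simp add: S'_class_mult mem_A_alg_iff free_mat_act_mult[OF assms]) (simp flip: S'_class_mult)
    show "x \<oplus>\<^bsub>S'_alg \<alpha>\<^esub> y \<in> H"
      using xy unfolding PQ H_def
      by (simp add: S'_class_add mem_A_alg_iff free_mat_act_add) (simp flip: S'_class_add)
  qed
  have "\<exists>y\<in>H. y \<oplus>\<^bsub>S'_alg \<alpha>\<^esub> x = \<zero>\<^bsub>S'_alg \<alpha>\<^esub>" if x: "x \<in> H" for x
    by (rule bexI[OF _ neg[OF x]]) (rule S'.l_neg[OF sub[OF x]])
  then show ?thesis
    unfolding H_def[symmetric]
    by (intro ringI abelian_groupI monoidI)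
      (simp_all add: A_alg_sel H_def[symmetric] one zero closed sub S'.a_assoc S'.m_assoc
        S'.l_distr S'.r_distr S'.a_comm S'.a_lcomm)
qed


section \<open>\<open>F\<close> as a module over the free algebra and over \<open>S\<close>\<close>

locale twist_parameters =
  fixes \<alpha> :: "ix \<Rightarrow> 'k::field" and a b c \<iota> :: 'k
  assumes sqrt_I1: "a^2 = \<alpha> I1" and sqrt_I2: "b^2 = \<alpha> I2" and sqrt_I3: "c^2 = \<alpha> I3"
    and iota: "\<iota>^2 = -1"
begin

abbreviation X :: "ix \<Rightarrow> ix \<Rightarrow> 'k^2^2" where "X \<equiv> V_mat a b c \<iota>"
abbreviation Fdot :: "ix \<Rightarrow> 'k free_alg \<Rightarrow> ('k^2) poly \<Rightarrow> ('k^2) poly" where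
  "Fdot \<equiv> F_free_act a b c \<iota>"

definition Xword :: "ix \<Rightarrow> ix list \<Rightarrow> 'k^2^2" where
  "Xword j w = foldr (\<lambda>i m. X j i ** m) w (mat 1)"

lemma Xword_Nil [simp]: "Xword j [] = mat 1"
  and Xword_Cons: "Xword j (i # w) = X j i ** Xword j w"
  by (simp_all add: Xword_def)

lemma Xword_append: "Xword j (u @ w) = Xword j u ** Xword j w"
  by (induction u) (simp_all add: Xword_Cons matrix_mul_assoc)

lemma V_word_eq: "V_word a b c \<iota> j w v = Xword j w *v v"
  by (induction w) (simp_all add: V_word_def Xword_Cons matrix_vector_mul_assoc)

lemma scale_mat_vector: "scale_mat x m *v v = x *s (m *v v)" for m :: "'k^2^2"
  by (simp add: vec_eq_iff matrix_vector_mult_def sum_2 algebra_simps)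

lemma coeff_F_free_act_support:
  assumes "finite W" and "Poly_Mapping.keys f \<subseteq> W"
  shows "coeff (Fdot j f p) n = (\<Sum>w\<in>W. if length w \<le> n
     then scale_mat (Poly_Mapping.lookup f w) (Xword j w) *v coeff p (n - length w) else 0)"
    (is "_ = (\<Sum>w\<in>W. ?t w)")
proof -
  have "coeff (\<Sum>m\<le>degree p. monom (Poly_Mapping.lookup f w *s V_word a b c \<iota> j w (coeff p m)) (m + length w)) n
      = ?t w" for w
  proof (cases "length w \<le> n")
    case True
    have "(\<Sum>m\<le>degree p. if m + length w = n then Poly_Mapping.lookup f w *s V_word a b c \<iota> j w (coeff p m) else 0)
       = (\<Sum>m\<le>degree p. if m = n - length w then Poly_Mapping.lookup f w *s V_word a b c \<iota> j w (coeff p m) else 0)"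
      using True by (intro sum.cong) auto
    also have "\<dots> = ?t w"
      using True by (auto simp: V_word_eq scale_mat_vector coeff_eq_0)
    finally show ?thesis by (simp add: coeff_sum)
  next
    case False
    then show ?thesis by (auto simp: coeff_sum intro!: sum.neutral)
  qed
  then have "coeff (Fdot j f p) n = (\<Sum>w\<in>Poly_Mapping.keys f. ?t w)"
    by (simp add: F_free_act_def coeff_sum)
  also have "\<dots> = (\<Sum>w\<in>W. ?t w)"
    using assms by (intro sum.mono_neutral_left) (auto simp: in_keys_iff scale_mat_zero)
  finally show ?thesis .
qed

lemma coeff_F_free_act_single:
  "coeff (Fdot j (Poly_Mapping.single w x) p) n =
     (if length w \<le> n then scale_mat x (Xword j w) *v coeff p (n - length w) else 0)"
  by (subst coeff_F_free_act_support[of "{w}"]) simp_all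

lemma F_free_act_add_left: "Fdot j (f + g) p = Fdot j f p + Fdot j g p"
proof (rule poly_eqI)
  fix n
  let ?W = "Poly_Mapping.keys f \<union> Poly_Mapping.keys g"
  have "Poly_Mapping.keys (f + g) \<subseteq> ?W" by (rule keys_add)
  then show "coeff (Fdot j (f + g) p) n = coeff (Fdot j f p + Fdot j g p) n"
    unfolding coeff_add
    by (subst (1 2 3) coeff_F_free_act_support[of ?W])
      (auto simp: lookup_add scale_mat_add_left matrix_vector_mult_add_rdistrib
        simp flip: sum.distrib intro!: sum.cong)
qed

lemma F_free_act_diff_left: "Fdot j (f - g) p = Fdot j f p - Fdot j g p"
  using F_free_act_add_left[of j "f - g" g p] by (simp add: eq_diff_eq)

lemma F_free_act_zero_left: "Fdot j 0 p = 0"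
  by (simp add: F_free_act_def)

lemma F_free_act_uminus_left: "Fdot j (- f) p = - Fdot j f p"
  using F_free_act_diff_left[of j 0 f p] by (simp add: F_free_act_zero_left)

lemma F_free_act_add_right: "Fdot j f (p + q) = Fdot j f p + Fdot j f q"
proof (rule poly_eqI)
  fix n
  show "coeff (Fdot j f (p + q)) n = coeff (Fdot j f p + Fdot j f q) n"
    unfolding coeff_add
    by (subst (1 2 3) coeff_F_free_act_support[of "Poly_Mapping.keys f"])
      (auto simp: matrix_vector_right_distrib simp flip: sum.distrib intro!: sum.cong)
qed

lemma F_free_act_zero_right: "Fdot j f 0 = 0"
  using F_free_act_add_right[of j f 0 0] by simp

lemma F_free_act_mult: "Fdot j (f * g) p = Fdot j f (Fdot j g p)"
proof (induction f rule: poly_mapping_single_induct)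
  case (single u x)
  show ?case
  proof (induction g rule: poly_mapping_single_induct)
    case (single w y)
    show ?case
    proof (rule poly_eqI)
      fix n
      have "n - (length u + length w) = n - length u - length w" by simp
      moreover have "length u + length w \<le> n \<longleftrightarrow> length u \<le> n \<and> length w \<le> n - length u" by auto
      ultimately show "coeff (Fdot j (Poly_Mapping.single u x * Poly_Mapping.single w y) p) n =
          coeff (Fdot j (Poly_Mapping.single u x) (Fdot j (Poly_Mapping.single w y) p)) n"
        by (simp add: mult_single plus_list_def coeff_F_free_act_single Xword_append
            matrix_vector_mul_assoc scale_mat_mult_left scale_mat_mult_right scale_mat_scale_mat mult.commute)
    qed
  qed (simp add: distrib_left F_free_act_add_left F_free_act_add_right)
qed (simp add: distrib_right F_free_act_add_left)

lemma F_free_act_one: "Fdot j 1 p = p"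
proof -
  have "Fdot j (fconst 1) p = p"
    unfolding fconst_def by (rule poly_eqI) (simp add: coeff_F_free_act_single)
  then show ?thesis by (simp add: fconst_one)
qed

text \<open>
  This is the assertion that \<open>V(\<tau> + \<xi>\<^sub>j)\<close> is a module over \<open>S\<close>. All products in one
  relation are multiples of the same \<open>q\<close>, so each case is an identity between coefficients,
  and the square roots of the \<open>\<alpha>\<^sub>i\<close> were chosen to make it hold.
\<close>

lemma X_relations:
  assumes "(i, k, l) \<in> cyclic_perms"
  shows "X j I0 ** X j i - X j i ** X j I0 = scale_mat (\<alpha> i) (X j k ** X j l + X j l ** X j k)"
    and "X j I0 ** X j i + X j i ** X j I0 = X j k ** X j l - X j l ** X j k"
proof -
  note [simp] = qmat_simps qmat_sqrt[OF iota] sqrt_I1[symmetric] sqrt_I2[symmetric] sqrt_I3[symmetric]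
    power2_eq_square mult_ac
  show "X j I0 ** X j i - X j i ** X j I0 = scale_mat (\<alpha> i) (X j k ** X j l + X j l ** X j k)"
    using assms unfolding cyclic_perms_def by (cases j; elim insertE emptyE; clarsimp)
  show "X j I0 ** X j i + X j i ** X j I0 = X j k ** X j l - X j l ** X j k"
    using assms unfolding cyclic_perms_def by (cases j; elim insertE emptyE; clarsimp)
qed

lemma F_free_act_S_relations:
  assumes "f \<in> S_relations \<alpha>"
  shows "Fdot j f p = 0"
proof -
  have f2: "Fdot j (fgen i * fgen k) p = Fdot j (Poly_Mapping.single [i, k] 1) p" for i k
    by (simp add: fgen_mult)
  have quad: "coeff (Fdot j (Poly_Mapping.single [i, k] x) p) n =
      (if 2 \<le> n then scale_mat x (X j i ** X j k) *v coeff p (n - 2) else 0)" for i k n x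
    by (simp add: coeff_F_free_act_single Xword_Cons numeral_2_eq_2)
  obtain i k l where ikl: "(i, k, l) \<in> cyclic_perms"
    and "f \<in> {fgen I0 * fgen i - fgen i * fgen I0
          - fconst (\<alpha> i) * (fgen k * fgen l + fgen l * fgen k),
        fgen I0 * fgen i + fgen i * fgen I0
          - (fgen k * fgen l - fgen l * fgen k)}"
    using assms unfolding S_relations_def by (elim UN_E) (simp only: split_paired_all prod.case)
  then consider
    (comm) "f = Poly_Mapping.single [I0, i] 1 - Poly_Mapping.single [i, I0] 1
          - (Poly_Mapping.single [k, l] (\<alpha> i) + Poly_Mapping.single [l, k] (\<alpha> i))" |
    (anti) "f = Poly_Mapping.single [I0, i] 1 + Poly_Mapping.single [i, I0] 1
          - (Poly_Mapping.single [k, l] 1 - Poly_Mapping.single [l, k] 1)"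
    by (auto simp: fgen_mult fconst_mult_single distrib_left)
  then show ?thesis
  proof cases
    case comm
    have "coeff (Fdot j f p) n = 0" for n
      using X_relations(1)[OF ikl, of j]
      by (simp add: comm F_free_act_diff_left F_free_act_add_left quad
        flip: matrix_vector_mult_diff_rdistrib matrix_vector_mult_add_rdistrib scale_mat_add)
    then show ?thesis by (intro poly_eqI) simp
  next
    case anti
    have "coeff (Fdot j f p) n = 0" for n
      using X_relations(2)[OF ikl, of j]
      by (simp add: anti F_free_act_diff_left F_free_act_add_left quad
        flip: matrix_vector_mult_diff_rdistrib matrix_vector_mult_add_rdistrib)
    then show ?thesis by (intro poly_eqI) simp
  qed
qed

lemma F_free_act_S_ideal:
  assumes "f \<in> S_ideal \<alpha>"
  shows "Fdot j f p = 0"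
proof -
  have "S_ideal \<alpha> \<subseteq> {f. \<forall>p. Fdot j f p = 0}"
    by (rule S_ideal_minimal)
      (auto simp: F_free_act_S_relations F_free_act_zero_left F_free_act_add_left
        F_free_act_uminus_left F_free_act_mult F_free_act_zero_right)
  with assms show ?thesis by auto
qed

text \<open>
  The ideal of relations acts as zero, so the image under which \<open>F_act\<close> is defined is a
  singleton.
\<close>

lemma F_act_S_class: "F_act a b c \<iota> j (S_class \<alpha> f) p = Fdot j f p"
proof -
  have const: "Fdot j h p = Fdot j f p" if "h \<in> S_class \<alpha> f" for h
    using that F_free_act_S_ideal[of "h - f" j p] by (simp add: S_class_mem_iff F_free_act_diff_left)
  have mem: "f \<in> S_class \<alpha> f" by (simp add: S_class_mem_iff S_ideal_zero)
  show ?thesis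
    unfolding F_act_def
  proof (rule the_elem_image_unique)
    show "S_class \<alpha> f \<noteq> {}" using mem by (metis empty_iff)
  qed (rule const)
qed

section \<open>\<open>F \<otimes> k\<^sup>2\<close> as a graded space of matrices\<close>

abbreviation M :: "ix \<Rightarrow> ('k free_alg set^2^2, ('k^2) poly^2) graded_module" where
  "M \<equiv> Fk2_module a b c \<iota>"

definition col_act :: "ix \<Rightarrow> 'k free_alg^2^2 \<Rightarrow> ('k^2) poly^2 \<Rightarrow> ('k^2) poly^2" where
  "col_act j P v = (\<chi> r. Fdot j (P $ r $ 1) (v $ 1) + Fdot j (P $ r $ 2) (v $ 2))"

lemma M_sel: "carrier (M j) = UNIV" "add (M j) = (+)" "zero (M j) = 0"
  by (auto simp: Fk2_module_def column_module_def F_module_def plus_vec_def zero_vec_def)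

lemma M_smult: "smult (M j) (S'_class \<alpha> P) v = col_act j P v"
  by (simp add: Fk2_module_def column_module_def F_module_def S'_class_def F_act_S_class
      col_act_def vec_eq_iff)

lemma col_act_add_left: "col_act j (P + Q) v = col_act j P v + col_act j Q v"
  by (simp add: col_act_def vec_eq_iff F_free_act_add_left)

lemma col_act_zero_left: "col_act j 0 v = 0"
  by (simp add: col_act_def vec_eq_iff F_free_act_zero_left)

lemma col_act_zero_right: "col_act j P 0 = 0"
  by (simp add: col_act_def vec_eq_iff F_free_act_zero_right)

lemma col_act_mult: "col_act j (P ** Q) v = col_act j P (col_act j Q v)"
  by (simp add: col_act_def vec_eq_iff F_free_act_add_right F_free_act_add_left
      F_free_act_mult matrix_matrix_mult_def sum_2 add_ac)

lemma col_act_one: "col_act j (mat 1) v = v"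
  by (simp add: col_act_def mat_def vec_eq_iff forall_2 F_free_act_one F_free_act_zero_left)

text \<open>
  The matrix \<open>N\<close> for which the part of degree \<open>n\<close> of \<open>v\<close> is \<open>N \<otimes> t\<^sup>n\<close>. Its row index is
  that of the tensor factor \<open>k\<^sup>2\<close>, its column index that of \<open>V\<close>; hence matrices over \<open>k\<close>
  multiply it from the left and elements of \<open>S\<close> act from the right by transposed matrices.
\<close>

definition coeff_mat :: "('k^2) poly^2 \<Rightarrow> nat \<Rightarrow> 'k^2^2" where
  "coeff_mat v n = (\<chi> r. coeff (v $ r) n)"

definition hom_vec :: "'k^2^2 \<Rightarrow> nat \<Rightarrow> ('k^2) poly^2" where
  "hom_vec N n = (\<chi> r. monom (N $ r) n)"

lemma coeff_mat_eqI: "(\<And>n. coeff_mat v n = coeff_mat v' n) \<Longrightarrow> v = v'"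
  by (simp add: coeff_mat_def vec_eq_iff poly_eq_iff)

lemma coeff_mat_add: "coeff_mat (v + v') n = coeff_mat v n + coeff_mat v' n"
  and coeff_mat_zero: "coeff_mat 0 n = 0"
  and coeff_mat_hom_vec: "coeff_mat (hom_vec N m) n = (if m = n then N else 0)"
  by (simp_all add: coeff_mat_def hom_vec_def vec_eq_iff)

lemma hom_vec_zero: "hom_vec 0 n = 0"
  by (rule coeff_mat_eqI) (simp add: coeff_mat_hom_vec coeff_mat_zero)

lemma degpart_M: "degpart (M j) n = range (\<lambda>N. hom_vec N n)"
proof -
  have deg: "degpart (M j) n = {v. \<forall>r. \<exists>u. v $ r = monom u n}"
    by (auto simp: Fk2_module_def column_module_def F_module_def)
  show ?thesis
    unfolding deg
  proof (intro equalityI subsetI)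
    fix v :: "('k^2) poly^2"
    assume "v \<in> {v. \<forall>r. \<exists>u. v $ r = monom u n}"
    then have v: "\<exists>u. v $ r = monom u n" for r by simp
    define u where "u r = (SOME u. v $ r = monom u n)" for r
    have "v $ r = monom (u r) n" for r
      unfolding u_def by (rule someI_ex) (rule v)
    then have "v = hom_vec (\<chi> r. u r) n"
      by (simp add: hom_vec_def vec_eq_iff)
    then show "v \<in> range (\<lambda>N. hom_vec N n)" by (rule range_eqI)
  qed (auto simp: hom_vec_def)
qed

lemma sum_hom_vec: "\<exists>d. v = (\<Sum>n\<le>d. hom_vec (coeff_mat v n) n)"
proof -
  define d where "d = max (degree (v $ 1)) (degree (v $ 2))"
  have "coeff_mat v n = coeff_mat (\<Sum>m\<le>d. hom_vec (coeff_mat v m) m) n" for n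
  proof -
    have "coeff_mat v n = 0" if "n > d"
      using that by (auto simp: d_def coeff_mat_def vec_eq_iff forall_2 coeff_eq_0)
    moreover have "coeff_mat (\<Sum>m\<in>A. hom_vec (coeff_mat v m) m) n =
        (\<Sum>m\<in>A. if m = n then coeff_mat v m else 0)" if "finite A" for A
      using that by (induction rule: finite_induct) (auto simp: coeff_mat_add coeff_mat_zero coeff_mat_hom_vec)
    ultimately show ?thesis by simp
  qed
  then have "v = (\<Sum>m\<le>d. hom_vec (coeff_mat v m) m)" by (rule coeff_mat_eqI)
  then show ?thesis ..
qed

lemma coeff_mat_col_act:
  "coeff_mat (col_act j (word_mat w m) v) n =
     (if length w \<le> n then m ** coeff_mat v (n - length w) ** transpose (Xword j w) else 0)"
  by (simp add: coeff_mat_def col_act_def word_mat_def coeff_F_free_act_single vec_eq_iff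
      matrix_vector_mult_def matrix_matrix_mult_def sum_2 transpose_def algebra_simps)

lemma col_act_hom_vec:
  "col_act j (word_mat w m) (hom_vec N n) = hom_vec (m ** N ** transpose (Xword j w)) (n + length w)"
  by (rule coeff_mat_eqI) (auto simp: coeff_mat_col_act coeff_mat_hom_vec)

end


section \<open>Generation of \<open>A\<close> in degree one\<close>

lemma matrix_inv_qmat:
  assumes "\<iota>^2 = (-1 :: 'k::field)"
  shows "matrix_inv (qmat \<iota> g) = scale_mat (if g = I0 then 1 else -1) (qmat \<iota> g)"
proof -
  define d :: 'k where "d = (if g = I0 then 1 else -1)"
  have "qmat \<iota> g ** scale_mat d (qmat \<iota> g) = mat 1"
    by (auto simp: scale_mat_mult_right qmat_square[OF assms] d_def) (simp_all add: mat2_simps)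
  then have "matrix_inv (qmat \<iota> g) = matrix_inv (qmat \<iota> g) ** (qmat \<iota> g ** scale_mat d (qmat \<iota> g))"
    by simp
  then show ?thesis
    unfolding matrix_mul_assoc qmat_inverse[OF assms] by (simp add: d_def)
qed

lemma qmat_commute:
  assumes "\<iota>^2 = (-1 :: 'k::field)"
  shows "qmat \<iota> g ** qmat \<iota> i = scale_mat (gen_sign g i) (qmat \<iota> i ** qmat \<iota> g)"
  by (cases g; cases i) (simp_all add: qmat_simps qmat_sqrt[OF assms] gen_sign_def)

lemma qmat_mult:
  assumes "\<iota>^2 = (-1 :: 'k::field)"
  shows "\<exists>e\<in>{1, -1}. qmat \<iota> g ** qmat \<iota> h = scale_mat e (qmat \<iota> (klein_mult g h))"
  by (cases g; cases h) (simp_all add: qmat_simps qmat_sqrt[OF assms])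

lemma gen_sign_klein_mult: "gen_sign g (klein_mult h i) = (gen_sign g h * gen_sign g i :: 'k::field)"
  by (cases g; cases h; cases i) (simp_all add: gen_sign_def)

lemma gen_sign_commute: "gen_sign g h = (gen_sign h g :: 'k::field)"
  by (auto simp: gen_sign_def)

lemma sum_ix: "sum f UNIV = f I0 + f I1 + f I2 + f I3"
  by (simp add: UNIV_ix add_ac)

context vector_space
begin

text \<open>
  The first unknown is eliminated by Cramer's rule: the multipliers of the three relations
  are the first row of the adjugate matrix, and the coefficient that remains is the
  determinant.
\<close>

lemma cyclic_system_first:
  assumes L: "subspace L"
    and d1: "d\<^sub>1 - (scale r\<^sub>3 d\<^sub>2 + scale r\<^sub>2 d\<^sub>3) \<in> L"
    and d2: "d\<^sub>2 - (scale r\<^sub>1 d\<^sub>3 + scale r\<^sub>3 d\<^sub>1) \<in> L"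
    and d3: "d\<^sub>3 - (scale r\<^sub>2 d\<^sub>1 + scale r\<^sub>1 d\<^sub>2) \<in> L"
    and det: "1 - (r\<^sub>1^2 + r\<^sub>2^2 + r\<^sub>3^2) - 2 * r\<^sub>1 * r\<^sub>2 * r\<^sub>3 \<noteq> 0"
  shows "d\<^sub>1 \<in> L"
proof -
  define D where "D = 1 - (r\<^sub>1^2 + r\<^sub>2^2 + r\<^sub>3^2) - 2 * r\<^sub>1 * r\<^sub>2 * r\<^sub>3"
  have "scale (1 - r\<^sub>1^2) (d\<^sub>1 - (scale r\<^sub>3 d\<^sub>2 + scale r\<^sub>2 d\<^sub>3))
      + scale (r\<^sub>3 + r\<^sub>1 * r\<^sub>2) (d\<^sub>2 - (scale r\<^sub>1 d\<^sub>3 + scale r\<^sub>3 d\<^sub>1))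
      + scale (r\<^sub>2 + r\<^sub>1 * r\<^sub>3) (d\<^sub>3 - (scale r\<^sub>2 d\<^sub>1 + scale r\<^sub>1 d\<^sub>2)) \<in> L"
    by (intro subspace_add[OF L] subspace_scale[OF L] d1 d2 d3)
  also have "scale (1 - r\<^sub>1^2) (d\<^sub>1 - (scale r\<^sub>3 d\<^sub>2 + scale r\<^sub>2 d\<^sub>3))
      + scale (r\<^sub>3 + r\<^sub>1 * r\<^sub>2) (d\<^sub>2 - (scale r\<^sub>1 d\<^sub>3 + scale r\<^sub>3 d\<^sub>1))
      + scale (r\<^sub>2 + r\<^sub>1 * r\<^sub>3) (d\<^sub>3 - (scale r\<^sub>2 d\<^sub>1 + scale r\<^sub>1 d\<^sub>2))
    = scale (1 - r\<^sub>1^2 - (r\<^sub>3 + r\<^sub>1 * r\<^sub>2) * r\<^sub>3 - (r\<^sub>2 + r\<^sub>1 * r\<^sub>3) * r\<^sub>2) d\<^sub>1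
      + scale (- (1 - r\<^sub>1^2) * r\<^sub>3 + (r\<^sub>3 + r\<^sub>1 * r\<^sub>2) - (r\<^sub>2 + r\<^sub>1 * r\<^sub>3) * r\<^sub>1) d\<^sub>2
      + scale (- (1 - r\<^sub>1^2) * r\<^sub>2 - (r\<^sub>3 + r\<^sub>1 * r\<^sub>2) * r\<^sub>1 + (r\<^sub>2 + r\<^sub>1 * r\<^sub>3)) d\<^sub>3"
    by (simp only: scale_right_diff_distrib scale_right_distrib scale_scale
        scale_left_diff_distrib scale_left_distrib scale_minus_left mult_minus_left)
      (simp add: algebra_simps)
  also have "\<dots> = scale D d\<^sub>1"
    by (simp add: D_def algebra_simps power2_eq_square)
  finally have "scale (inverse D) (scale D d\<^sub>1) \<in> L"
    by (rule subspace_scale[OF L])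
  then show ?thesis
    using det by (simp add: D_def[symmetric])
qed

lemma cyclic_system:
  assumes L: "subspace L"
    and d1: "d\<^sub>1 - (scale r\<^sub>3 d\<^sub>2 + scale r\<^sub>2 d\<^sub>3) \<in> L"
    and d2: "d\<^sub>2 - (scale r\<^sub>1 d\<^sub>3 + scale r\<^sub>3 d\<^sub>1) \<in> L"
    and d3: "d\<^sub>3 - (scale r\<^sub>2 d\<^sub>1 + scale r\<^sub>1 d\<^sub>2) \<in> L"
    and det: "1 - (r\<^sub>1^2 + r\<^sub>2^2 + r\<^sub>3^2) - 2 * r\<^sub>1 * r\<^sub>2 * r\<^sub>3 \<noteq> 0"
  shows "d\<^sub>1 \<in> L" "d\<^sub>2 \<in> L" "d\<^sub>3 \<in> L"
  using cyclic_system_first[OF L d1 d2 d3 det]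
    cyclic_system_first[OF L d2 d3 d1] cyclic_system_first[OF L d3 d1 d2] det
  by (simp_all add: algebra_simps)

end

definition fscale :: "'k::field \<Rightarrow> 'k free_alg^2^2 \<Rightarrow> 'k free_alg^2^2" where
  "fscale x P = word_mat [] (mat x) ** P"

interpretation free_mat: vector_space fscale
proof
  fix x y :: "'a::field" and P Q :: "'a free_alg^2^2"
  show "fscale x (P + Q) = fscale x P + fscale x Q"
    by (simp add: fscale_def matrix_mult_add_right)
  have "(mat (x + y) :: 'a^2^2) = mat x + mat y" by (simp add: mat2_simps)
  then show "fscale (x + y) P = fscale x P + fscale y P"
    by (simp add: fscale_def matrix_mult_add_left word_mat_add)
  show "fscale x (fscale y P) = fscale (x * y) P"
    by (simp add: fscale_def matrix_mul_assoc word_mat_mult mat_mult_eq_scale_mat)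
      (simp add: word_mat_def mat2_simps)
  show "fscale 1 P = P"
    by (simp add: fscale_def word_mat_one)
qed

lemma fscale_word_mat: "fscale x (word_mat w m) = word_mat w (scale_mat x m)"
  by (simp add: fscale_def word_mat_mult mat_mult_eq_scale_mat)

lemma fscale_nth: "fscale x P $ r $ c = fconst x * P $ r $ c"
  unfolding fscale_def word_mat_Nil_mat using exhaust_2[of r] by (auto simp: mat2_simps)

lemma mult_fscale: "P ** fscale x Q = fscale x (P ** Q)"
proof -
  have "p * (fconst x * q) = fconst x * (p * q)" for p q
    using fconst_central[of x p] by (simp flip: mult.assoc)
  then show ?thesis
    by (simp add: vec_eq_iff fscale_nth matrix_matrix_mult_def sum_2 distrib_left)
qed

lemma S'_class_diff_cong:
  assumes "S'_class \<alpha> P = S'_class \<alpha> Q"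
  shows "S'_class \<alpha> (P - R) = S'_class \<alpha> (Q - R)"
proof -
  have "(P - R) - (Q - R) = P - Q" by simp
  then show ?thesis using assms unfolding S'_class_eq_iff by simp
qed

context twist_parameters
begin

definition qword :: "ix list \<Rightarrow> 'k^2^2" where
  "qword w = foldr (\<lambda>i m. qmat \<iota> i ** m) w (mat 1)"

text \<open>
  The product of the generators \<open>y\<^sub>i\<close> along the word \<open>w\<close>.
\<close>

definition Y :: "ix list \<Rightarrow> 'k free_alg^2^2" where
  "Y w = word_mat w (qword w)"

lemma Y_Cons: "Y (i # w) = Y [i] ** Y w"
  by (simp add: Y_def qword_def word_mat_mult)

lemma Y_replicate_I0: "fscale x (Y (replicate n I0)) = word_mat (replicate n I0) (mat x)"
proof -
  have "qword (replicate n I0) = mat 1" by (induction n) (simp_all add: qword_def)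
  then show ?thesis by (simp add: Y_def fscale_word_mat) (simp add: word_mat_def mat2_simps)
qed

lemma qmat_conj_qword:
  "scale_mat (word_sign g w) (qmat \<iota> g ** qword w ** matrix_inv (qmat \<iota> g)) = qword w"
proof (induction w)
  case Nil
  show ?case
    unfolding qword_def word_sign_def foldr.simps list.map prod_list.Nil id_apply scale_mat_one
      matrix_mul_rid by (rule qmat_inverse[OF iota])
next
  case (Cons i w)
  have sq: "gen_sign g i * gen_sign g i = (1::'k)" by (simp add: gen_sign_def)
  have "scale_mat (word_sign g (i # w)) (qmat \<iota> g ** qword (i # w) ** matrix_inv (qmat \<iota> g))
    = scale_mat (gen_sign g i * word_sign g w) ((qmat \<iota> g ** qmat \<iota> i) ** qword w ** matrix_inv (qmat \<iota> g))"
    by (simp add: qword_def word_sign_def matrix_mul_assoc)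
  also have "\<dots> = scale_mat (gen_sign g i * gen_sign g i)
      (qmat \<iota> i ** scale_mat (word_sign g w) (qmat \<iota> g ** qword w ** matrix_inv (qmat \<iota> g)))"
    by (simp add: qmat_commute[OF iota, of g i] scale_mat_mult_left scale_mat_mult_right
        scale_mat_scale_mat matrix_mul_assoc mult_ac)
  also have "\<dots> = qword (i # w)"
    unfolding Cons.IH sq scale_mat_one by (simp add: qword_def)
  finally show ?case .
qed

lemma Y_in_A: "S'_class \<alpha> (Y w) \<in> carrier (A_alg \<alpha> \<iota>)"
  by (simp add: mem_A_alg_iff Y_def free_mat_act_word_mat qmat_conj_qword)

text \<open>
  A product of matrices \<open>q\<close> is, up to sign, the \<open>q\<close> of the product in \<open>\<Gamma>\<close>.
\<close>

lemma qword_eq_qmat: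
  "\<exists>h e. (\<forall>g. word_sign g w = (gen_sign g h :: 'k)) \<and> qmat \<iota> h = scale_mat e (qword w)"
proof (induction w)
  case Nil
  show ?case
    by (intro exI[of _ I0] exI[of _ 1]) (simp add: word_sign_def qword_def map_matrix_def vec_eq_iff)
next
  case (Cons i w)
  then obtain h e where h: "\<And>g. word_sign g w = (gen_sign g h :: 'k)"
    and e: "qmat \<iota> h = scale_mat e (qword w)" by blast
  obtain d :: 'k where d: "d \<in> {1, -1}"
    and prod: "qmat \<iota> i ** qmat \<iota> h = scale_mat d (qmat \<iota> (klein_mult i h))"
    using qmat_mult[OF iota, of i h] by blast
  have "d * d = 1" using d by auto
  then have "qmat \<iota> (klein_mult i h) = scale_mat d (qmat \<iota> i ** qmat \<iota> h)"
    by (simp add: prod scale_mat_scale_mat)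
  also have "\<dots> = scale_mat (d * e) (qword (i # w))"
    by (simp add: e qword_def scale_mat_mult_right scale_mat_scale_mat)
  finally have "qmat \<iota> (klein_mult i h) = scale_mat (d * e) (qword (i # w))" .
  moreover have "word_sign g (i # w) = (gen_sign g (klein_mult i h) :: 'k)" for g
    using h[of g] by (simp add: word_sign_def gen_sign_klein_mult)
  ultimately show ?case by blast
qed

definition conj_sum :: "(ix \<Rightarrow> 'k) \<Rightarrow> 'k^2^2 \<Rightarrow> 'k^2^2" where
  "conj_sum s m = (\<Sum>g\<in>UNIV. scale_mat (s g) (qmat \<iota> g ** m ** matrix_inv (qmat \<iota> g)))"

text \<open>
  The sum over \<open>\<Gamma>\<close>, weighted by a character, is a multiple of the projection of \<open>M\<^sub>2(k)\<close>
  to the eigenline \<open>k q\<^sub>h\<close> of that character; the coefficient is a trace.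
\<close>

lemma conj_sum_eq: "\<exists>x. conj_sum (\<lambda>g. gen_sign g h) m = scale_mat x (qmat \<iota> h)"
proof -
  define t where "t = (matrix_inv (qmat \<iota> h) ** m) $ 1 $ 1 + (matrix_inv (qmat \<iota> h) ** m) $ 2 $ 2"
  have "conj_sum (\<lambda>g. gen_sign g h) m = scale_mat (2 * t) (qmat \<iota> h)"
    unfolding conj_sum_def sum_ix t_def matrix_inv_qmat[OF iota]
    by (cases h) (simp_all add: qmat_simps qmat_sqrt[OF iota] gen_sign_def algebra_simps)
  then show ?thesis ..
qed

text \<open>
  \<open>A\<close> is spanned by the products of the \<open>y\<^sub>i\<close>. Averaging a representative over \<open>\<Gamma>\<close> does
  not change the class of an invariant element, and it turns \<open>w \<otimes> m\<close> into a multiple of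
  \<open>w \<otimes> q\<close>, where \<open>q\<close> is the product of the \<open>q\<^sub>i\<close> along \<open>w\<close>.
\<close>

lemma A_alg_induct [consumes 2, case_names word zero add cong]:
  assumes P: "S'_class \<alpha> P \<in> carrier (A_alg \<alpha> \<iota>)" and two: "(2::'k) \<noteq> 0"
    and word: "\<And>w x. R (fscale x (Y w))" and zero: "R 0"
    and add: "\<And>P Q. R P \<Longrightarrow> R Q \<Longrightarrow> R (P + Q)"
    and cong: "\<And>P Q. S'_class \<alpha> P = S'_class \<alpha> Q \<Longrightarrow> R P \<Longrightarrow> R Q"
  shows "R P"
proof -
  define avg :: "'k free_alg^2^2 \<Rightarrow> 'k free_alg^2^2" where
    "avg Q = fscale (inverse 4) (\<Sum>g\<in>UNIV. free_mat_act \<iota> g Q)" for Q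
  have four: "(4::'k) \<noteq> 0"
    using two by (metis mult_2 numeral_Bit0 mult_eq_0_iff)
  have avg_add: "avg (Q + Q') = avg Q + avg Q'" for Q Q'
    by (simp add: avg_def free_mat_act_add sum.distrib free_mat.scale_right_distrib)
  have avg_word: "\<exists>x. avg (word_mat w m) = fscale x (Y w)" for w m
  proof -
    obtain h e where h: "\<And>g. word_sign g w = (gen_sign g h :: 'k)"
      and e: "qmat \<iota> h = scale_mat e (qword w)" using qword_eq_qmat by blast
    obtain x where x: "conj_sum (\<lambda>g. gen_sign g h) m = scale_mat x (qmat \<iota> h)"
      using conj_sum_eq by blast
    have "(\<Sum>g\<in>UNIV. free_mat_act \<iota> g (word_mat w m)) = word_mat w (conj_sum (\<lambda>g. gen_sign g h) m)"
      by (simp add: sum_ix free_mat_act_word_mat h conj_sum_def word_mat_add)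
    then have "avg (word_mat w m) = fscale (inverse 4 * x * e) (Y w)"
      by (simp add: avg_def x e Y_def fscale_word_mat scale_mat_scale_mat mult.assoc)
    then show ?thesis ..
  qed
  have "R (avg P)"
  proof (induction P rule: matrix_word_induct)
    case (word_mat w m)
    with avg_word[of w m] word show ?case by metis
  next
    case (add P Q)
    then show ?case by (simp add: avg_add assms(5))
  qed
  moreover have "S'_class \<alpha> (avg P) = S'_class \<alpha> P"
  proof -
    have inv: "S'_class \<alpha> (free_mat_act \<iota> g P) = S'_class \<alpha> P" for g
      using P by (simp add: mem_A_alg_iff)
    have "S'_class \<alpha> (\<Sum>g\<in>UNIV. free_mat_act \<iota> g P) = S'_class \<alpha> (P + P + P + P)"
      by (simp add: sum_ix inv flip: S'_class_add)
    then have "S'_class \<alpha> (avg P) = S'_class \<alpha> (fscale (inverse 4) (P + P + P + P))"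
      by (simp add: avg_def fscale_def flip: S'_class_mult)
    also have "P + P + P + P = fscale 4 P"
      using free_mat.scale_left_distrib[of 2 2 P] free_mat.scale_left_distrib[of 1 1 P] by (simp add: add_ac)
    finally show ?thesis using four by simp
  qed
  ultimately show ?thesis using cong by blast
qed

text \<open>
  The second family of relations of \<open>S\<close>. The sign of \<open>x\<^sub>l x\<^sub>k\<close> changes because
  \<open>q\<^sub>k q\<^sub>l = q\<^sub>i = - q\<^sub>l q\<^sub>k\<close>.
\<close>

lemma Y_relation:
  assumes "(i, k, l) \<in> cyclic_perms"
  shows "S'_class \<alpha> (Y [I0] ** Y [i] + Y [i] ** Y [I0] - Y [k] ** Y [l] - Y [l] ** Y [k]) = S'_class \<alpha> 0"
proof -
  define rel :: "'k free_alg" where "rel = fgen I0 * fgen i + fgen i * fgen I0 - (fgen k * fgen l - fgen l * fgen k)"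
  have "rel \<in> S_relations \<alpha>"
    unfolding S_relations_def rel_def using assms by (intro UN_I[of "(i, k, l)"]) simp_all
  then have rel: "rel \<in> S_ideal \<alpha>" using S_relations_subset by blast
  have q: "qmat \<iota> k ** qmat \<iota> l = qmat \<iota> i" "qmat \<iota> l ** qmat \<iota> k = - qmat \<iota> i"
    using assms by (auto simp: cyclic_perms_def qmat_simps qmat_sqrt[OF iota])
  have "(Y [I0] ** Y [i] + Y [i] ** Y [I0] - Y [k] ** Y [l] - Y [l] ** Y [k]) $ r $ c = fconst (qmat \<iota> i $ r $ c) * rel"
    for r c
    by (simp add: Y_def qword_def word_mat_mult q rel_def fgen_mult distrib_left right_diff_distrib
      fconst_mult_single) (simp add: word_mat_def single_uminus)
  then show ?thesis
    by (simp add: S'_class_eq_iff S_ideal_mult_left[OF rel])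
qed

end

section \<open>Reduction of \<open>A\<close> modulo the forms vanishing at a point\<close>

text \<open>
  The conditions on the affine coordinates of a point under which the induction on the degree
  works: the linear system for the next point is nonsingular, and it is solved by the image
  of the point under \<open>g\<^sub>j\<close>.
\<close>

definition regular_point :: "ix \<Rightarrow> (ix \<Rightarrow> 'k::field) \<Rightarrow> bool" where
  "regular_point j r \<longleftrightarrow> r I0 = 1 \<and>
     1 - ((r I1)^2 + (r I2)^2 + (r I3)^2) - 2 * r I1 * r I2 * r I3 \<noteq> 0 \<and>
     (\<forall>(i, k, l)\<in>cyclic_perms.
        gen_sign j i * r i + r i = r l * (gen_sign j k * r k) + r k * (gen_sign j l * r l))"

text \<open>
  Two of the three coordinates change sign, or none. This preserves the determinant, and it
  exchanges the two points in the linear equations, which are symmetric in them.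
\<close>

lemma regular_point_shift:
  assumes "regular_point j r"
  shows "regular_point j (\<lambda>i. gen_sign j i * r i)"
  using assms by (cases j) (auto simp: regular_point_def cyclic_perms_def gen_sign_def algebra_simps)

locale left_ideal_of_A = twist_parameters \<alpha> a b c \<iota>
  for \<alpha> :: "ix \<Rightarrow> 'k::field" and a b c \<iota> +
  fixes L :: "('k free_alg set^2^2) set"
  assumes two: "(2::'k) \<noteq> 0"
    and subgroup_L: "additive_subgroup L (A_alg \<alpha> \<iota>)"
    and mult_L: "x \<in> carrier (A_alg \<alpha> \<iota>) \<Longrightarrow> l \<in> L \<Longrightarrow> x \<otimes>\<^bsub>A_alg \<alpha> \<iota>\<^esub> l \<in> L"
begin

text \<open>
  The preimage of \<open>L\<close> in the matrices over the free algebra, where congruences modulo \<open>L\<close>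
  become membership in a vector subspace.
\<close>

definition Lrep :: "('k free_alg^2^2) set" where
  "Lrep = {P. S'_class \<alpha> P \<in> L}"

lemma Lrep_mult: "S'_class \<alpha> Q \<in> carrier (A_alg \<alpha> \<iota>) \<Longrightarrow> P \<in> Lrep \<Longrightarrow> Q ** P \<in> Lrep"
  using mult_L[of "S'_class \<alpha> Q" "S'_class \<alpha> P"] by (simp add: Lrep_def A_alg_sel S'_class_mult)

lemma Lrep_cong: "S'_class \<alpha> P = S'_class \<alpha> Q \<Longrightarrow> P \<in> Lrep \<Longrightarrow> Q \<in> Lrep"
  by (simp add: Lrep_def)

lemma const_in_A: "S'_class \<alpha> (word_mat [] (mat x)) \<in> carrier (A_alg \<alpha> \<iota>)"
  by (simp add: mem_A_alg_iff free_mat_act_one[OF iota])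

lemma subspace_Lrep: "free_mat.subspace Lrep"
proof (rule free_mat.subspaceI)
  show "0 \<in> Lrep"
    using additive_subgroup.zero_closed[OF subgroup_L] by (simp add: Lrep_def A_alg_sel S'_class_zero)
  show "P + Q \<in> Lrep" if "P \<in> Lrep" "Q \<in> Lrep" for P Q
    using additive_subgroup.a_closed[OF subgroup_L] that
    by (simp add: Lrep_def A_alg_sel flip: S'_class_add)
  show "fscale x P \<in> Lrep" if "P \<in> Lrep" for x P
    unfolding fscale_def using const_in_A that by (rule Lrep_mult)
qed

lemmas Lrep_add = free_mat.subspace_add[OF subspace_Lrep]
  and Lrep_diff = free_mat.subspace_diff[OF subspace_Lrep]
  and Lrep_scale = free_mat.subspace_scale[OF subspace_Lrep]
  and Lrep_zero = free_mat.subspace_0[OF subspace_Lrep]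

text \<open>
  If \<open>u\<close> behaves like a generator of a module at the point \<open>r\<close>, then \<open>y\<^sub>0 u\<close> behaves like
  one at \<open>g\<^sub>j r\<close>: the errors \<open>d\<^sub>i\<close> satisfy the homogeneous linear system, modulo \<open>L\<close>.
\<close>

lemma point_step:
  assumes r: "regular_point j r" and U: "\<And>i. Y [i] ** U - fscale (r i) (Y [I0] ** U) \<in> Lrep"
  shows "Y [i] ** (Y [I0] ** U) - fscale (gen_sign j i * r i) (Y [I0] ** (Y [I0] ** U)) \<in> Lrep"
proof -
  define s where "s i = gen_sign j i * r i" for i
  define z where "z i = Y [i] ** (Y [I0] ** U)" for i
  define d where "d i = z i - fscale (s i) (z I0)" for i
  have eq: "d i - (fscale (r l) (d k) + fscale (r k) (d l)) \<in> Lrep"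
    if ikl: "(i, k, l) \<in> cyclic_perms" for i k l
  proof -
    have lin: "s i + r i = r l * s k + r k * s l"
      using r ikl by (auto simp: regular_point_def s_def)
    define rel where "rel = Y [I0] ** Y [i] + Y [i] ** Y [I0] - Y [k] ** Y [l] - Y [l] ** Y [k]"
    have "S'_class \<alpha> (rel ** U) = S'_class \<alpha> (0 ** U)"
      using Y_relation[OF ikl] by (simp only: rel_def flip: S'_class_mult)
    then have rel: "rel ** U \<in> Lrep"
      using Lrep_zero by (simp add: Lrep_def)
    have "rel ** U - Y [I0] ** (Y [i] ** U - fscale (r i) (Y [I0] ** U))
        + Y [k] ** (Y [l] ** U - fscale (r l) (Y [I0] ** U))
        + Y [l] ** (Y [k] ** U - fscale (r k) (Y [I0] ** U)) \<in> Lrep"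
      by (intro Lrep_add Lrep_diff rel Lrep_mult Y_in_A U)
    also have "rel ** U - Y [I0] ** (Y [i] ** U - fscale (r i) (Y [I0] ** U))
        + Y [k] ** (Y [l] ** U - fscale (r l) (Y [I0] ** U))
        + Y [l] ** (Y [k] ** U - fscale (r k) (Y [I0] ** U))
      = z i + fscale (r i) (z I0) - fscale (r l) (z k) - fscale (r k) (z l)"
      by (simp add: rel_def z_def matrix_mult_diff_left matrix_mult_diff_right matrix_mult_add_left
          mult_fscale matrix_mul_assoc algebra_simps)
    also have "\<dots> = d i - (fscale (r l) (d k) + fscale (r k) (d l))
        + fscale (s i + r i - (r l * s k + r k * s l)) (z I0)"
      by (simp only: d_def free_mat.scale_right_diff_distrib free_mat.scale_left_diff_distrib
          free_mat.scale_left_distrib free_mat.scale_scale) (simp add: algebra_simps)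
    finally show ?thesis by (simp add: lin)
  qed
  have "d I1 \<in> Lrep" "d I2 \<in> Lrep" "d I3 \<in> Lrep"
    using r eq[of I1 I2 I3] eq[of I2 I3 I1] eq[of I3 I1 I2]
      free_mat.cyclic_system[OF subspace_Lrep, of "d I1" "r I3" "d I2" "r I2" "d I3" "r I1"]
    by (simp_all add: cyclic_perms_def regular_point_def)
  moreover have "d I0 \<in> Lrep"
    using r Lrep_zero by (simp add: d_def s_def regular_point_def)
  ultimately have "d i \<in> Lrep" by (cases i) simp_all
  then show ?thesis by (simp add: d_def s_def z_def)
qed

context
  fixes j r
  assumes regular: "regular_point j r"
    and point: "\<And>i. Y [i] - fscale (r i) (Y [I0]) \<in> Lrep"
begin

lemma Y_power_reduce:
  "\<exists>r. regular_point j r \<and> (\<forall>i. Y [i] ** Y (replicate n I0) - fscale (r i) (Y [I0] ** Y (replicate n I0)) \<in> Lrep)"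
proof (induction n)
  case 0
  have "Y [i] ** Y [] = Y [i]" for i
    by (simp flip: Y_Cons)
  with regular point show ?case by auto
next
  case (Suc n)
  then obtain r' where "regular_point j r'"
    and "\<And>i. Y [i] ** Y (replicate n I0) - fscale (r' i) (Y [I0] ** Y (replicate n I0)) \<in> Lrep"
    by blast
  from point_step[OF this] regular_point_shift[OF this(1)] show ?case
    by (auto simp: Y_Cons[of I0 "replicate n I0"])
qed

lemma Y_word_reduce: "\<exists>x. Y w - fscale x (Y (replicate (length w) I0)) \<in> Lrep"
proof (induction w)
  case Nil
  show ?case using Lrep_zero by (intro exI[of _ 1]) simp
next
  case (Cons i w)
  define P where "P = Y (replicate (length w) I0)"
  from Cons obtain x where x: "Y w - fscale x P \<in> Lrep" by (auto simp: P_def)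
  obtain r' where r': "Y [i] ** P - fscale (r' i) (Y [I0] ** P) \<in> Lrep"
    using Y_power_reduce[of "length w"] by (auto simp: P_def)
  have "Y [i] ** (Y w - fscale x P) + fscale x (Y [i] ** P - fscale (r' i) (Y [I0] ** P)) \<in> Lrep"
    by (intro Lrep_add Lrep_scale Lrep_mult Y_in_A x r')
  also have "Y [i] ** (Y w - fscale x P) + fscale x (Y [i] ** P - fscale (r' i) (Y [I0] ** P))
     = Y (i # w) - fscale (x * r' i) (Y (I0 # replicate (length w) I0))"
    by (simp add: matrix_mult_diff_right mult_fscale free_mat.scale_right_diff_distrib
        Y_Cons[of i w] Y_Cons[of I0 "replicate (length w) I0"] P_def)
  finally show ?case by auto
qed

text \<open>
  Polynomials in \<open>y\<^sub>0\<close> represent all classes. They are encoded as \<open>mat f\<close> with \<open>f\<close> in the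
  span of the powers of \<open>x\<^sub>0\<close>, since \<open>q\<^sub>0 = 1\<close>.
\<close>

lemma A_reduce:
  assumes "S'_class \<alpha> P \<in> carrier (A_alg \<alpha> \<iota>)"
  shows "\<exists>f. Poly_Mapping.keys f \<subseteq> range (\<lambda>n. replicate n I0) \<and> P - mat f \<in> Lrep"
  using assms two
proof (induction rule: A_alg_induct)
  case (word w x)
  obtain y where "Y w - fscale y (Y (replicate (length w) I0)) \<in> Lrep"
    using Y_word_reduce by blast
  then have "fscale x (Y w - fscale y (Y (replicate (length w) I0))) \<in> Lrep"
    by (rule Lrep_scale)
  moreover have "fscale x (Y w - fscale y (Y (replicate (length w) I0))) =
      fscale x (Y w) - mat (Poly_Mapping.single (replicate (length w) I0) (x * y))"
    unfolding free_mat.scale_right_diff_distrib Y_replicate_I0 fscale_word_mat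
    by (simp add: word_mat_def mat2_simps)
  moreover have "Poly_Mapping.keys (Poly_Mapping.single (replicate (length w) I0) (x * y))
      \<subseteq> range (\<lambda>n. replicate n I0)"
    by auto
  ultimately show ?case by (metis (no_types))
next
  case zero
  show ?case using Lrep_zero by (intro exI[of _ 0]) simp
next
  case (add P Q)
  then obtain f g where fg: "Poly_Mapping.keys f \<subseteq> range (\<lambda>n. replicate n I0)"
      "Poly_Mapping.keys g \<subseteq> range (\<lambda>n. replicate n I0)"
    and "P - mat f \<in> Lrep" "Q - mat g \<in> Lrep" by blast
  then have "(P - mat f) + (Q - mat g) \<in> Lrep" by (intro Lrep_add)
  moreover have "(P - mat f) + (Q - mat g) = P + Q - mat (f + g)"
    by (simp add: mat2_simps)
  ultimately show ?case
    using order_trans[OF keys_add Un_least[OF fg]] by (intro exI[of _ "f + g"]) simp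
next
  case (cong P Q)
  then obtain f where f: "Poly_Mapping.keys f \<subseteq> range (\<lambda>n. replicate n I0)" and P: "P - mat f \<in> Lrep"
    by blast
  have "S'_class \<alpha> (Q - mat f) = S'_class \<alpha> (P - mat f)"
    using S'_class_diff_cong[OF cong(1)[symmetric]] .
  with P f show ?case using Lrep_cong by metis
qed

end

end


section \<open>Left ideals and cyclic modules\<close>

context ring
begin

lemma left_ideal_gen_additive_subgroup:
  assumes "P \<subseteq> carrier R"
  shows "additive_subgroup (left_ideal_gen R P) R"
proof (rule additive_subgroupI)
  have "subgroup (carrier R) (add_monoid R)"
    using add.subgroup_self by simp
  then have "additive_subgroup (carrier R) R" by (rule additive_subgroupI)
  then show "subgroup (left_ideal_gen R P) (add_monoid R)"
    unfolding left_ideal_gen_def using assms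
    by (intro add.subgroups_Inter) (auto intro: additive_subgroup.a_subgroup)
qed

lemma left_ideal_gen_mult:
  "x \<in> carrier R \<Longrightarrow> l \<in> left_ideal_gen R P \<Longrightarrow> x \<otimes> l \<in> left_ideal_gen R P"
  by (auto simp: left_ideal_gen_def)

lemma left_ideal_gen_superset: "P \<subseteq> left_ideal_gen R P"
  by (auto simp: left_ideal_gen_def)

lemma left_ideal_gen_minimal:
  "additive_subgroup L R \<Longrightarrow> (\<And>x l. x \<in> carrier R \<Longrightarrow> l \<in> L \<Longrightarrow> x \<otimes> l \<in> L) \<Longrightarrow> P \<subseteq> L \<Longrightarrow>
    left_ideal_gen R P \<subseteq> L"
  by (auto simp: left_ideal_gen_def)

context
  fixes L
  assumes L: "additive_subgroup L R" and mult: "\<forall>x\<in>carrier R. \<forall>l\<in>L. x \<otimes> l \<in> L"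
begin

interpretation L: abelian_subgroup L R
  by (rule abelian_subgroupI3[OF L]) (rule abelian_group_axioms)

lemma left_coset_eq_iff:
  assumes "x \<in> carrier R" "y \<in> carrier R"
  shows "L +> x = L +> y \<longleftrightarrow> x \<ominus> y \<in> L"
proof
  assume "L +> x = L +> y"
  then have "x \<in> L +> y" using L.a_rcos_self[OF assms(1)] by simp
  then show "x \<ominus> y \<in> L" using L.a_rcos_module[OF assms(2,1)] by (simp add: a_minus_def)
next
  assume "x \<ominus> y \<in> L"
  then have "x \<in> L +> y" using L.a_rcos_module[OF assms(2,1)] by (simp add: a_minus_def)
  then show "L +> x = L +> y" using a_repr_independence[OF _ assms(2) L.a_subgroup] by simp
qed

lemma quotient_module_smult:
  assumes x: "x \<in> carrier R" and y: "y \<in> carrier R"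
  shows "smult (quotient_module R gr L) x (L +> y) = L +> (x \<otimes> y)"
proof -
  have "L +> (x \<otimes> l) = L +> (x \<otimes> y)" if l: "l \<in> L +> y" for l
  proof -
    have lc: "l \<in> carrier R"
      using l a_r_coset_subset_G[OF L.a_subset y] by blast
    have "l \<ominus> y \<in> L" using L.a_rcos_module[OF y lc] l by (simp add: a_minus_def)
    then have "x \<otimes> (l \<ominus> y) \<in> L" using mult x by blast
    moreover have "x \<otimes> (l \<ominus> y) = x \<otimes> l \<ominus> x \<otimes> y"
      using x y lc by (simp add: a_minus_def r_distr r_minus)
    ultimately show ?thesis using x y lc by (subst left_coset_eq_iff) simp_all
  qed
  then have "(\<Union>l\<in>L +> y. L +> (x \<otimes> l)) = L +> (x \<otimes> y)"
    by (intro UN_constant_eq[of y] ballI L.a_rcos_self[OF y])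
  then show ?thesis by (simp add: quotient_module_def)
qed

lemma quotient_module_add:
  assumes "x \<in> carrier R" "y \<in> carrier R"
  shows "add (quotient_module R gr L) (L +> x) (L +> y) = L +> (x \<oplus> y)"
  using L.a_rcos_sum[OF assms] by (simp add: quotient_module_def)

lemma carrier_quotient_module: "carrier (quotient_module R gr L) = (\<lambda>x. L +> x) ` carrier R"
  by (auto simp: quotient_module_def A_RCOSETS_def')

lemma degpart_quotient_module: "degpart (quotient_module R gr L) n = (\<lambda>x. L +> x) ` gr n"
  by (auto simp: quotient_module_def)

lemma left_ideal_coset_eq: "l \<in> L \<Longrightarrow> L +> l = L"
  by (rule L.a_rcos_const)

text \<open>
  The homomorphism theorem for \<open>R / L\<close>; in the application, \<open>h x = x e\<close> for a generator \<open>e\<close>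
  of \<open>N\<close> with annihilator \<open>L\<close>.
\<close>

lemma quotient_module_isomorphic_cyclic:
  fixes N :: "('a, 'c, 'n) graded_module_scheme"
  assumes add: "\<And>x y. x \<in> carrier R \<Longrightarrow> y \<in> carrier R \<Longrightarrow> h (x \<oplus> y) = h x \<oplus>\<^bsub>N\<^esub> h y"
    and smult: "\<And>x y. x \<in> carrier R \<Longrightarrow> y \<in> carrier R \<Longrightarrow> h (x \<otimes> y) = x \<odot>\<^bsub>N\<^esub> h y"
    and kernel: "\<And>x y. x \<in> carrier R \<Longrightarrow> y \<in> carrier R \<Longrightarrow> h x = h y \<longleftrightarrow> x \<ominus> y \<in> L"
    and onto: "h ` carrier R = carrier N"
    and deg: "\<And>n. gr n \<subseteq> carrier R" "\<And>n. h ` gr n = degpart N n"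
  shows "graded_isomorphic R (quotient_module R gr L) N"
proof -
  define f where "f Z = h (SOME x. x \<in> carrier R \<and> Z = L +> x)" for Z
  have f: "f (L +> x) = h x" if x: "x \<in> carrier R" for x
  proof -
    define y where "y = (SOME y. y \<in> carrier R \<and> L +> x = L +> y)"
    have "y \<in> carrier R \<and> L +> x = L +> y"
      unfolding y_def by (rule someI[of _ x]) (simp add: x)
    then have "h x = h y" using kernel[OF x, of y] left_coset_eq_iff[OF x, of y] by blast
    then show ?thesis by (simp add: f_def y_def)
  qed
  have "inj_on f ((\<lambda>x. L +> x) ` carrier R)"
  proof (rule inj_onI)
    fix X Z assume "X \<in> (\<lambda>x. L +> x) ` carrier R" "Z \<in> (\<lambda>x. L +> x) ` carrier R" and eq: "f X = f Z"
    then obtain x z where xz: "x \<in> carrier R" "z \<in> carrier R" and X: "X = L +> x" "Z = L +> z"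
      by (elim imageE)
    from eq have "h x = h z" by (simp add: X f xz)
    then show "X = Z" using xz by (simp add: X kernel left_coset_eq_iff)
  qed
  moreover have img: "f ` (\<lambda>x. L +> x) ` B = h ` B" if "B \<subseteq> carrier R" for B
    unfolding image_image using that by (intro image_cong) (auto simp: f)
  ultimately have "bij_betw f (carrier (quotient_module R gr L)) (carrier N)"
    by (simp add: bij_betw_def carrier_quotient_module onto)
  then have "graded_iso R (quotient_module R gr L) N f"
    by (auto simp: graded_iso_def carrier_quotient_module degpart_quotient_module img deg
        quotient_module_add quotient_module_smult f add smult)
  then show ?thesis unfolding graded_isomorphic_def by blast
qed

end

end

section \<open>Equivariant structures on \<open>F \<otimes> k\<^sup>2\<close>\<close>

lemma transpose_scale_mat: "transpose (scale_mat x m) = scale_mat x (transpose (m :: 'k::field^2^2))"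
  by (simp add: transpose_def vec_eq_iff)

text \<open>
  A matrix that commutes with \<open>q\<^sub>1\<close> is diagonal, and \<open>q\<^sub>2\<close> then makes its entries equal. This
  takes the place of Schur's lemma.
\<close>

lemma commutes_with_qmat_imp_scalar:
  assumes "\<iota>^2 = (-1 :: 'k::field)" and two: "(2::'k) \<noteq> 0"
    and comm: "\<And>i. qmat \<iota> i ** K = K ** qmat \<iota> i"
  shows "K = mat (K $ 1 $ 1)"
proof -
  have iota: "\<iota> \<noteq> 0" using assms(1) by auto
  have c1: "(qmat \<iota> I1 ** K) $ r $ s = (K ** qmat \<iota> I1) $ r $ s"
    and c2: "(qmat \<iota> I2 ** K) $ r $ s = (K ** qmat \<iota> I2) $ r $ s" for r s
    by (simp_all only: comm)
  have "\<iota> * (2 * K $ 1 $ 2) = 0"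
    using c1[of 1 2] by (simp add: matrix_matrix_mult_def sum_2 algebra_simps)
  moreover have "\<iota> * (2 * K $ 2 $ 1) = 0"
    using c1[of 2 1] by (simp add: matrix_matrix_mult_def sum_2 algebra_simps)
  moreover have "\<iota> * K $ 2 $ 2 = \<iota> * K $ 1 $ 1"
    using c2[of 1 2] by (simp add: matrix_matrix_mult_def sum_2 mult.commute)
  ultimately show ?thesis
    using iota two by (simp add: mat2_simps)
qed

context twist_parameters
begin

text \<open>
  The factors by which the matrices of the \<open>x\<^sub>i\<close> on \<open>V(\<tau> + \<xi>\<^sub>j)\<close> differ from matrices
  \<open>q\<close>. They are also the coordinates of the point that is listed first in \<open>\<PP>\<^sub>j\<close>.
\<close>

definition base_point :: "ix \<Rightarrow> ix \<Rightarrow> 'k" where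
  "base_point j = (case j of
     I0 \<Rightarrow> case_ix 1 1 1 1
   | I1 \<Rightarrow> case_ix (b * c) (- \<iota>) (- \<iota> * b) (- c)
   | I2 \<Rightarrow> case_ix (a * c) (- a) (- \<iota>) (- \<iota> * c)
   | I3 \<Rightarrow> case_ix (a * b) (- \<iota> * a) (- b) (- \<iota>))"

lemma X_eq_qmat: "X j i = scale_mat (base_point j i) (qmat \<iota> (klein_mult i j))"
  by (cases j; cases i) (simp_all add: base_point_def qmat_simps)

lemma qmat_X_commute:
  "scale_mat (gen_sign g j) (qmat \<iota> g ** X j i) = scale_mat (gen_sign g i) (X j i ** qmat \<iota> g)"
proof -
  have sq: "gen_sign g j * (gen_sign g j * y) = y" for y :: 'k by (simp add: gen_sign_def)
  show ?thesis
    unfolding X_eq_qmat scale_mat_mult_left scale_mat_mult_right qmat_commute[OF iota, of g] gen_sign_klein_mult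
      scale_mat_scale_mat by (simp add: mult_ac sq)
qed

lemma qmat_Xword_commute:
  "scale_mat (gen_sign g j ^ length w) (qmat \<iota> g ** Xword j w) =
     scale_mat (word_sign g w) (Xword j w ** qmat \<iota> g)"
proof (induction w)
  case Nil
  show ?case by (simp add: word_sign_def)
next
  case (Cons i w)
  have "scale_mat (gen_sign g j ^ length (i # w)) (qmat \<iota> g ** Xword j (i # w))
     = scale_mat (gen_sign g j ^ length w) (scale_mat (gen_sign g j) (qmat \<iota> g ** X j i) ** Xword j w)"
    by (simp add: Xword_Cons matrix_mul_assoc scale_mat_mult_left scale_mat_scale_mat mult_ac)
  also have "\<dots> = scale_mat (gen_sign g i) (X j i ** scale_mat (gen_sign g j ^ length w) (qmat \<iota> g ** Xword j w))"
    by (simp add: qmat_X_commute matrix_mul_assoc scale_mat_mult_left scale_mat_mult_right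
        scale_mat_scale_mat mult_ac)
  also have "\<dots> = scale_mat (word_sign g (i # w)) (Xword j (i # w) ** qmat \<iota> g)"
    by (simp add: Cons.IH Xword_Cons matrix_mul_assoc scale_mat_mult_left scale_mat_mult_right
        scale_mat_scale_mat word_sign_def)
  finally show ?case .
qed

text \<open>
  The multiplier in degree \<open>0\<close> is a character of \<open>\<Gamma>\<close>, and every character has the form
  \<open>\<lambda>g. gen_sign g h\<close>. The power of \<open>gen_sign g j\<close> is forced by compatibility with \<open>x\<^sub>0\<close>,
  which acts on \<open>V\<close> as a multiple of \<open>q\<^sub>j\<close> and is fixed by \<open>\<Gamma>\<close>.
\<close>

definition structure_map :: "ix \<Rightarrow> ix \<Rightarrow> ix \<Rightarrow> ('k^2) poly^2 \<Rightarrow> ('k^2) poly^2" where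
  "structure_map j h g v = (\<chi> r. Abs_poly (\<lambda>n.
     (scale_mat (gen_sign g h * gen_sign g j ^ n) (qmat \<iota> g ** coeff_mat v n ** transpose (qmat \<iota> g))) $ r))"

lemma coeff_mat_structure_map:
  "coeff_mat (structure_map j h g v) n =
     scale_mat (gen_sign g h * gen_sign g j ^ n) (qmat \<iota> g ** coeff_mat v n ** transpose (qmat \<iota> g))"
proof -
  define d where "d = max (degree (v $ 1)) (degree (v $ 2))"
  have "coeff_mat v i = 0" if "i > d" for i
    using that by (auto simp: d_def coeff_mat_def vec_eq_iff forall_2 coeff_eq_0)
  moreover have "scale_mat x (qmat \<iota> g ** 0 ** transpose (qmat \<iota> g)) = 0" for x
    by (simp add: vec_eq_iff)
  ultimately have "coeff (structure_map j h g v $ r) n =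
     (scale_mat (gen_sign g h * gen_sign g j ^ n) (qmat \<iota> g ** coeff_mat v n ** transpose (qmat \<iota> g))) $ r" for r
    unfolding structure_map_def vec_lambda_beta by (subst coeff_Abs_poly[of d]) auto
  then show ?thesis by (simp add: coeff_mat_def vec_eq_iff)
qed

lemma structure_map_add:
  "structure_map j h g (v + v') = structure_map j h g v + structure_map j h g v'"
  by (rule coeff_mat_eqI) (simp add: coeff_mat_structure_map coeff_mat_add matrix_mult_add_left
      matrix_mult_add_right scale_mat_add)

lemma structure_map_col_act:
  "structure_map j h g (col_act j P v) = col_act j (free_mat_act \<iota> g P) (structure_map j h g v)"
proof (induction P rule: matrix_word_induct)
  case (word_mat w m)
  define s :: 'k where "s = word_sign g w"
  define Q where "Q = qmat \<iota> g"
  define W where "W = transpose (Xword j w)"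
  have comm: "scale_mat (gen_sign g j ^ length w) (W ** transpose Q) = scale_mat s (transpose Q ** W)"
    using arg_cong[OF qmat_Xword_commute[of g j w], of transpose]
    by (simp add: transpose_scale_mat matrix_transpose_mul s_def Q_def W_def)
  have inv: "matrix_inv Q ** Q = mat 1"
    unfolding Q_def by (rule qmat_inverse[OF iota])
  show ?case
  proof (rule coeff_mat_eqI)
    fix n
    show "coeff_mat (structure_map j h g (col_act j (word_mat w m) v)) n =
        coeff_mat (col_act j (free_mat_act \<iota> g (word_mat w m)) (structure_map j h g v)) n"
    proof (cases "length w \<le> n")
      case True
      define k where "k = n - length w"
      define N where "N = coeff_mat v k"
      have n: "n = k + length w" using True by (simp add: k_def)
      have "coeff_mat (structure_map j h g (col_act j (word_mat w m) v)) n
          = scale_mat (gen_sign g h * gen_sign g j ^ n) (Q ** (m ** N ** W) ** transpose Q)"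
        using True by (simp add: coeff_mat_structure_map coeff_mat_col_act Q_def W_def N_def k_def)
      also have "\<dots> = scale_mat (gen_sign g h * gen_sign g j ^ k)
          (Q ** m ** N ** scale_mat (gen_sign g j ^ length w) (W ** transpose Q))"
        by (simp add: n power_add scale_mat_mult_right scale_mat_scale_mat matrix_mul_assoc mult_ac)
      also have "\<dots> = scale_mat s (Q ** m ** (matrix_inv Q ** Q)) **
          scale_mat (gen_sign g h * gen_sign g j ^ k) (N ** transpose Q) ** W"
        unfolding comm inv
        by (simp add: scale_mat_mult_right scale_mat_mult_left scale_mat_scale_mat matrix_mul_assoc mult_ac)
      also have "\<dots> = coeff_mat (col_act j (free_mat_act \<iota> g (word_mat w m)) (structure_map j h g v)) n"
        using True
        by (simp add: free_mat_act_word_mat coeff_mat_structure_map coeff_mat_col_act Q_def W_def N_def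
            k_def s_def scale_mat_mult_right scale_mat_mult_left scale_mat_scale_mat matrix_mul_assoc mult_ac)
      finally show ?thesis .
    next
      case False
      moreover have "scale_mat x (qmat \<iota> g ** 0 ** transpose (qmat \<iota> g)) = 0" for x
        by (simp add: vec_eq_iff)
      ultimately show ?thesis
        by (simp add: free_mat_act_word_mat coeff_mat_structure_map coeff_mat_col_act)
    qed
  qed
next
  case (add P Q)
  then show ?case by (simp add: col_act_add_left structure_map_add free_mat_act_add)
qed

lemma structure_map_hom_vec:
  "structure_map j h g (hom_vec N n) =
     hom_vec (scale_mat (gen_sign g h * gen_sign g j ^ n) (qmat \<iota> g ** N ** transpose (qmat \<iota> g))) n"
proof -
  have "scale_mat x (qmat \<iota> g ** 0 ** transpose (qmat \<iota> g)) = 0" for x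
    by (simp add: vec_eq_iff)
  then show ?thesis
    by (intro coeff_mat_eqI) (simp add: coeff_mat_structure_map coeff_mat_hom_vec)
qed

text \<open>
  The matrices \<open>q\<close> represent \<open>\<Gamma>\<close> only up to sign, but each of them occurs twice.
\<close>

lemma structure_map_klein_mult:
  "structure_map j h (klein_mult g g') v = structure_map j h g (structure_map j h g' v)"
proof (rule coeff_mat_eqI)
  fix n
  obtain e :: 'k where e: "e \<in> {1, -1}"
    and prod: "qmat \<iota> g ** qmat \<iota> g' = scale_mat e (qmat \<iota> (klein_mult g g'))"
    using qmat_mult[OF iota, of g g'] by blast
  define x :: 'k where "x = gen_sign (klein_mult g g') h * gen_sign (klein_mult g g') j ^ n"
  have x: "x = (gen_sign g h * gen_sign g j ^ n) * (gen_sign g' h * gen_sign g' j ^ n)"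
    by (simp add: x_def gen_sign_commute[of _ h] gen_sign_commute[of _ j] gen_sign_klein_mult
        power_mult_distrib mult_ac)
  have ee: "e * e = 1" using e by auto
  have "coeff_mat (structure_map j h g (structure_map j h g' v)) n
     = scale_mat x ((qmat \<iota> g ** qmat \<iota> g') ** coeff_mat v n ** transpose (qmat \<iota> g ** qmat \<iota> g'))"
    by (simp add: coeff_mat_structure_map x matrix_transpose_mul scale_mat_mult_left
        scale_mat_mult_right scale_mat_scale_mat matrix_mul_assoc mult_ac)
  also have "\<dots> = scale_mat (x * (e * e))
      (qmat \<iota> (klein_mult g g') ** coeff_mat v n ** transpose (qmat \<iota> (klein_mult g g')))"
    unfolding prod transpose_scale_mat scale_mat_mult_left scale_mat_mult_right scale_mat_scale_mat
    by (simp add: mult_ac)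
  also have "\<dots> = coeff_mat (structure_map j h (klein_mult g g') v) n"
    unfolding ee by (simp add: coeff_mat_structure_map x_def)
  finally show "coeff_mat (structure_map j h (klein_mult g g') v) n =
      coeff_mat (structure_map j h g (structure_map j h g' v)) n" ..
qed

lemma equivariant_structure_map: "equivariant_structure \<alpha> \<iota> (M j) (structure_map j h)"
  unfolding equivariant_structure_def
proof (intro conjI allI ballI)
  fix g n v assume "v \<in> degpart (M j) n"
  then show "structure_map j h g v \<in> degpart (M j) n"
    by (auto simp: degpart_M structure_map_hom_vec)
next
  fix v show "structure_map j h I0 v = v"
    by (rule coeff_mat_eqI) (simp add: coeff_mat_structure_map transpose_mat map_matrix_def vec_eq_iff)
next
  fix g d v
  show "structure_map j h g (S'_const \<alpha> d \<odot>\<^bsub>M j\<^esub> v) = S'_const \<alpha> d \<odot>\<^bsub>M j\<^esub> structure_map j h g v"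
    by (simp add: S'_const_eq M_smult structure_map_col_act free_mat_act_one[OF iota])
next
  fix g x v assume "x \<in> carrier (S'_alg \<alpha>)"
  then show "structure_map j h g (x \<odot>\<^bsub>M j\<^esub> v) = S'_act \<alpha> \<iota> g x \<odot>\<^bsub>M j\<^esub> structure_map j h g v"
    by (auto simp: carrier_S'_alg M_smult S'_act_S'_class structure_map_col_act)
qed (simp_all add: M_sel structure_map_add structure_map_klein_mult)

end


section \<open>The four points of \<open>\<PP>\<^sub>j\<close> and their generators\<close>

lemma matrix_mult_right_cancel:
  fixes A B C :: "'k::field^2^2"
  assumes "invertible C" and "A ** C = B ** C"
  shows "A = B"
proof -
  obtain D where D: "C ** D = mat 1" using assms(1) by (auto simp: invertible_def)
  have "A ** (C ** D) = B ** (C ** D)" using assms(2) by (simp add: matrix_mul_assoc)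
  then show ?thesis by (simp add: D)
qed

lemma invertible_scale_mat:
  fixes A :: "'k::field^2^2"
  assumes "invertible A" "x \<noteq> 0"
  shows "invertible (scale_mat x A)"
proof -
  obtain A' where A: "A ** A' = mat 1" "A' ** A = mat 1"
    using assms by (auto simp: invertible_def)
  have "scale_mat x A ** scale_mat (inverse x) A' = scale_mat (x * inverse x) (A ** A')"
    "scale_mat (inverse x) A' ** scale_mat x A = scale_mat (x * inverse x) (A' ** A)"
    by (simp_all only: scale_mat_mult_left scale_mat_mult_right scale_mat_scale_mat mult.commute)
  then have "scale_mat x A ** scale_mat (inverse x) A' = mat 1 \<and> scale_mat (inverse x) A' ** scale_mat x A = mat 1"
    by (simp only: A right_inverse[OF assms(2)] scale_mat_one)
  then show ?thesis unfolding invertible_def by blast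
qed

lemma invertible_transpose_mat:
  fixes A :: "'k::field^2^2"
  assumes "invertible A"
  shows "invertible (transpose A)"
proof -
  obtain A' where A: "A ** A' = mat 1" "A' ** A = mat 1"
    using assms by (auto simp: invertible_def)
  have "transpose A ** transpose A' = transpose (A' ** A)" "transpose A' ** transpose A = transpose (A ** A')"
    by (simp_all only: matrix_transpose_mul)
  then have "transpose A ** transpose A' = mat 1 \<and> transpose A' ** transpose A = mat 1"
    by (simp only: A transpose_mat)
  then show ?thesis unfolding invertible_def by blast
qed

lemma invertible_not_zero: "invertible (m :: 'k::field^2^2) \<Longrightarrow> m \<noteq> 0"
  by (auto simp: invertible_def mat2_simps)

lemma sum_scale_mat: "(\<Sum>i\<in>UNIV. scale_mat (d i) m) = scale_mat (\<Sum>i\<in>UNIV. d i) m"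
  for d :: "ix \<Rightarrow> 'k::field" and m :: "'k^2^2"
  by (simp add: sum_ix scale_mat_add_left)

locale sklyanin_parameters = twist_parameters \<alpha> a b c \<iota>
  for \<alpha> :: "ix \<Rightarrow> 'k::field" and a b c \<iota> +
  assumes two: "(2::'k) \<noteq> 0"
    and nondegenerate: "\<alpha> I1 \<notin> {0, 1, -1}" "\<alpha> I2 \<notin> {0, 1, -1}" "\<alpha> I3 \<notin> {0, 1, -1}"
begin

lemma parameters_nonzero: "a \<noteq> 0" "b \<noteq> 0" "c \<noteq> 0" "\<iota> \<noteq> 0"
  using nondegenerate sqrt_I1 sqrt_I2 sqrt_I3 iota by auto

lemma base_point_nonzero: "base_point j i \<noteq> 0"
  using parameters_nonzero by (cases j; cases i) (simp_all add: base_point_def)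

lemma invertible_qmat: "invertible (qmat \<iota> g)"
  unfolding invertible_def using qmat_inverse[OF iota] by blast

lemma invertible_X: "invertible (X j i)"
  unfolding X_eq_qmat by (intro invertible_scale_mat invertible_qmat base_point_nonzero)

lemma invertible_Xword: "invertible (Xword j w)"
proof (induction w)
  case Nil
  show ?case using invertible_qmat[of I0] by simp
qed (simp add: Xword_Cons invertible_mult invertible_X)

text \<open>
  The four points of \<open>\<PP>\<^sub>j\<close> are the images of the first one under \<open>\<Gamma>\<close>.
\<close>

lemma PP_cases:
  assumes "p \<in> PP a b c \<iota> j"
  obtains h where "p = {\<lambda>i. l * (base_point j i * gen_sign i h) | l. l \<noteq> 0}"
proof -
  define pp where "pp h = proj_point (base_point j I0) (base_point j I1 * gen_sign I1 h)
    (base_point j I2 * gen_sign I2 h) (base_point j I3 * gen_sign I3 h)" for h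
  have "PP a b c \<iota> j = {pp I0, pp I1, pp I2, pp I3}"
    by (cases j) (simp_all add: pp_def base_point_def gen_sign_def)
  with assms obtain h where h: "p = pp h" by blast
  have "case_ix (base_point j I0) (base_point j I1 * gen_sign I1 h)
    (base_point j I2 * gen_sign I2 h) (base_point j I3 * gen_sign I3 h) i = base_point j i * gen_sign i h" for i
    by (cases i) simp_all
  then have "p = {\<lambda>i. l * (base_point j i * gen_sign i h) | l. l \<noteq> 0}"
    unfolding h pp_def proj_point_def by simp
  then show ?thesis by (rule that)
qed

lemma regular_point_normalize:
  assumes "v I0 \<noteq> 0"
    and "(v I0)^3 - v I0 * ((v I1)^2 + (v I2)^2 + (v I3)^2) - 2 * v I1 * v I2 * v I3 \<noteq> 0"
    and "\<And>i k l. (i, k, l) \<in> cyclic_perms \<Longrightarrow>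
      (gen_sign j i * v i + v i) * v I0 = v l * (gen_sign j k * v k) + v k * (gen_sign j l * v l)"
  shows "regular_point j (\<lambda>i. v i / (v I0 :: 'k))"
proof -
  have "(1 - ((v I1 / v I0)^2 + (v I2 / v I0)^2 + (v I3 / v I0)^2) - 2 * (v I1 / v I0) * (v I2 / v I0) * (v I3 / v I0)) * (v I0)^3
     = (v I0)^3 - v I0 * ((v I1)^2 + (v I2)^2 + (v I3)^2) - 2 * v I1 * v I2 * v I3"
    using assms(1) by (simp add: field_simps power2_eq_square power3_eq_cube)
  then have "1 - ((v I1 / v I0)^2 + (v I2 / v I0)^2 + (v I3 / v I0)^2) - 2 * (v I1 / v I0) * (v I2 / v I0) * (v I3 / v I0) \<noteq> 0"
    using assms(2) by auto
  moreover have "gen_sign j i * (v i / v I0) + v i / v I0 =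
      v l / v I0 * (gen_sign j k * (v k / v I0)) + v k / v I0 * (gen_sign j l * (v l / v I0))"
    if "(i, k, l) \<in> cyclic_perms" for i k l
  proof -
    have "gen_sign j i * (v i / v I0) + v i / v I0 = ((gen_sign j i * v i + v i) * v I0) / (v I0 * v I0)"
      using assms(1) by (simp add: field_simps)
    also have "\<dots> = v l / v I0 * (gen_sign j k * (v k / v I0)) + v k / v I0 * (gen_sign j l * (v l / v I0))"
      unfolding assms(3)[OF that] by (simp add: add_divide_distrib)
    finally show ?thesis .
  qed
  ultimately show ?thesis
    using assms(1) by (auto simp: regular_point_def)
qed

text \<open>
  Here the assumption \<open>\<alpha>\<^sub>i \<notin> {1, -1}\<close> enters: the homogenized determinant is a product of
  square roots times factors \<open>\<alpha>\<^sub>i - 1\<close> and \<open>\<alpha>\<^sub>i + 1\<close>, or \<open>-4\<close> when \<open>j\<close> is \<open>I0\<close>.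
\<close>

lemma base_point_discriminant:
  "(base_point j I0)^3 - base_point j I0 * ((base_point j I1)^2 + (base_point j I2)^2 + (base_point j I3)^2)
    - 2 * base_point j I1 * base_point j I2 * base_point j I3 \<noteq> 0" (is "?D \<noteq> 0")
proof -
  have ne: "a^2 - 1 \<noteq> 0" "a^2 + 1 \<noteq> 0" "b^2 - 1 \<noteq> 0" "b^2 + 1 \<noteq> 0" "c^2 - 1 \<noteq> 0" "c^2 + 1 \<noteq> 0"
    using nondegenerate by (auto simp: sqrt_I1 sqrt_I2 sqrt_I3 add_eq_0_iff2)
  have four: "(4::'k) \<noteq> 0" using two by (metis mult_2 numeral_Bit0 mult_eq_0_iff)
  have "?D = (case j of I0 \<Rightarrow> - (2 * 2) | I1 \<Rightarrow> b * c * ((b^2 - 1) * (c^2 + 1))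
      | I2 \<Rightarrow> a * c * ((c^2 - 1) * (a^2 + 1)) | I3 \<Rightarrow> a * b * ((a^2 - 1) * (b^2 + 1)))"
    by (cases j) (simp_all add: base_point_def qmat_sqrt[OF iota] power2_eq_square power3_eq_cube algebra_simps)
  also have "\<dots> \<noteq> 0"
    using ne parameters_nonzero four by (cases j) simp_all
  finally show ?thesis .
qed

lemma regular_point_PP:
  "regular_point j (\<lambda>i. base_point j i * gen_sign i h / base_point j I0)"
proof -
  define v where "v i = base_point j i * gen_sign i h" for i
  have "regular_point j (\<lambda>i. v i / v I0)"
  proof (rule regular_point_normalize)
    show "v I0 \<noteq> 0" by (simp add: v_def base_point_nonzero)
    show "(v I0)^3 - v I0 * ((v I1)^2 + (v I2)^2 + (v I3)^2) - 2 * v I1 * v I2 * v I3 \<noteq> 0"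
      using base_point_discriminant[of j] by (cases h) (simp_all add: v_def gen_sign_def)
    fix i k l assume "(i, k, l) \<in> cyclic_perms"
    then show "(gen_sign j i * v i + v i) * v I0 = v l * (gen_sign j k * v k) + v k * (gen_sign j l * v l)"
      unfolding cyclic_perms_def
      by (cases j; cases h; elim insertE emptyE)
        (simp_all add: v_def gen_sign_def base_point_def qmat_sqrt[OF iota] algebra_simps)
  qed
  then show ?thesis by (simp add: v_def)
qed

text \<open>
  If \<open>e\<close> is one of the matrices \<open>q\<close>, in degree \<open>0\<close>, the elements \<open>y\<^sub>i e\<close> are proportional,
  and their ratios are those of a point of \<open>\<PP>\<^sub>j\<close>. This is the index that gives the first
  point, found by comparing signs; the others arise by left multiplication with \<open>q\<^sub>h\<close>.
\<close>

definition base_index :: "ix \<Rightarrow> ix" where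
  "base_index j = (case j of I0 \<Rightarrow> I3 | I1 \<Rightarrow> I1 | I2 \<Rightarrow> I0 | I3 \<Rightarrow> I2)"

lemma qmat_base_index:
  "scale_mat (base_point j I0) (qmat \<iota> i ** qmat \<iota> (base_index j) ** transpose (X j i)) =
     scale_mat (base_point j i) (qmat \<iota> (base_index j) ** transpose (X j I0))"
  by (cases j; cases i)
    (simp_all add: base_index_def base_point_def qmat_simps transpose_def qmat_sqrt[OF iota] mult_ac)

lemma qmat_transpose: "qmat \<iota> g ** transpose (qmat \<iota> g) = scale_mat (gen_sign g I3) (mat 1)"
  by (cases g) (simp_all add: qmat_simps transpose_def qmat_sqrt[OF iota] gen_sign_def)

end

text \<open>
  A point, its affine coordinates \<open>r\<close>, a matrix \<open>E\<close> that generates its point module inside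
  \<open>F \<otimes> k\<^sup>2\<close>, and the index \<open>k\<close> of the structure for which \<open>E\<close> is invariant.
\<close>

locale point_datum = sklyanin_parameters \<alpha> a b c \<iota>
  for \<alpha> :: "ix \<Rightarrow> 'k::field" and a b c \<iota> +
  fixes j :: ix and p :: "(ix \<Rightarrow> 'k) set" and r :: "ix \<Rightarrow> 'k" and E :: "'k^2^2" and k :: ix
  assumes r_in_p: "r \<in> p" and p_multiples: "\<And>v. v \<in> p \<Longrightarrow> \<exists>l. v = (\<lambda>i. l * r i)"
    and regular: "regular_point j r" and invertible_E: "invertible E"
    and eigen: "\<And>i. qmat \<iota> i ** E ** transpose (X j i) = scale_mat (r i) (E ** transpose (X j I0))"
    and invariant: "\<And>g. scale_mat (gen_sign g k) (qmat \<iota> g ** E ** transpose (qmat \<iota> g)) = E"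

lemma (in sklyanin_parameters) exists_point_datum:
  assumes "p \<in> PP a b c \<iota> j"
  shows "\<exists>r E k. point_datum \<alpha> a b c \<iota> j p r E k"
proof -
  obtain h where p: "p = {\<lambda>i. l * (base_point j i * gen_sign i h) | l. l \<noteq> 0}"
    using PP_cases[OF assms] .
  define z where "z = base_point j I0"
  have z: "z \<noteq> 0" by (simp add: z_def base_point_nonzero)
  define r where "r i = base_point j i * gen_sign i h / z" for i
  define m where "m = base_index j"
  define E where "E = qmat \<iota> h ** qmat \<iota> m"
  define k where "k = klein_mult h (klein_mult m I3)"
  have "point_datum \<alpha> a b c \<iota> j p r E k"
  proof
    show "r \<in> p"
      unfolding p using z by (auto simp: r_def fun_eq_iff intro!: exI[of _ "inverse z"] simp: field_simps)
    show "\<exists>l. v = (\<lambda>i. l * r i)" if v: "v \<in> p" for v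
    proof -
      obtain l where "v = (\<lambda>i. l * (base_point j i * gen_sign i h))" using v unfolding p by blast
      then have "v = (\<lambda>i. (l * z) * r i)" using z by (simp add: r_def fun_eq_iff)
      then show ?thesis ..
    qed
    show "regular_point j r"
      using regular_point_PP[of j h] unfolding z_def[symmetric] r_def[symmetric] by simp
    show "invertible E"
      unfolding E_def by (intro invertible_mult invertible_qmat)
    show "qmat \<iota> i ** E ** transpose (X j i) = scale_mat (r i) (E ** transpose (X j I0))" for i
    proof -
      have "qmat \<iota> i ** E ** transpose (X j i)
          = scale_mat (gen_sign i h / z) (qmat \<iota> h ** scale_mat z (qmat \<iota> i ** qmat \<iota> m ** transpose (X j i)))"
        unfolding E_def matrix_mul_assoc qmat_commute[OF iota, of i h] scale_mat_mult_left
          scale_mat_mult_right scale_mat_scale_mat using z by simp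
      also have "\<dots> = scale_mat (r i) (E ** transpose (X j I0))"
        unfolding z_def m_def qmat_base_index
        by (simp add: scale_mat_mult_right scale_mat_scale_mat r_def z_def E_def m_def matrix_mul_assoc)
          (simp add: mult.commute)
      finally show ?thesis .
    qed
    show "scale_mat (gen_sign g k) (qmat \<iota> g ** E ** transpose (qmat \<iota> g)) = E" for g
    proof -
      have "qmat \<iota> g ** E ** transpose (qmat \<iota> g)
         = scale_mat (gen_sign g h) (qmat \<iota> h ** (qmat \<iota> g ** qmat \<iota> m) ** transpose (qmat \<iota> g))"
        unfolding E_def matrix_mul_assoc qmat_commute[OF iota, of g h] scale_mat_mult_left ..
      also have "\<dots> = scale_mat (gen_sign g h * gen_sign g m) (E ** (qmat \<iota> g ** transpose (qmat \<iota> g)))"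
        unfolding qmat_commute[OF iota, of g m] scale_mat_mult_left scale_mat_mult_right
          scale_mat_scale_mat E_def matrix_mul_assoc ..
      also have "\<dots> = scale_mat (gen_sign g k) E"
        unfolding qmat_transpose scale_mat_mult_right scale_mat_scale_mat matrix_mul_rid
        by (simp add: k_def gen_sign_klein_mult mult.assoc)
      finally have "qmat \<iota> g ** E ** transpose (qmat \<iota> g) = scale_mat (gen_sign g k) E" .
      moreover have "gen_sign g k * gen_sign g k = (1::'k)" by (simp add: gen_sign_def)
      ultimately show ?thesis by (simp only: scale_mat_scale_mat scale_mat_one)
    qed
  qed
  then show ?thesis by blast
qed

section \<open>The invariants are the point module\<close>

lemma S'_deg_iff:
  "x \<in> S'_deg \<alpha> n \<longleftrightarrow> (\<exists>P. x = S'_class \<alpha> P \<and> supported_in {w. length w = n} P)"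
proof
  assume x: "x \<in> S'_deg \<alpha> n"
  define f where "f r c = (SOME f. x $ r $ c = S_class \<alpha> f \<and> (\<forall>w\<in>Poly_Mapping.keys f. length w = n))" for r c
  have f: "x $ r $ c = S_class \<alpha> (f r c) \<and> (\<forall>w\<in>Poly_Mapping.keys (f r c). length w = n)" for r c
    unfolding f_def by (rule someI_ex) (use x in \<open>simp add: S'_deg_def S_deg_def\<close>)
  then have "x = S'_class \<alpha> (\<chi> r c. f r c)"
    by (simp add: S'_class_def vec_eq_iff)
  moreover have "supported_in {w. length w = n} (\<chi> r c. f r c)"
    using f by (auto simp: supported_in_def)
  ultimately show "\<exists>P. x = S'_class \<alpha> P \<and> supported_in {w. length w = n} P" by blast
next
  assume "\<exists>P. x = S'_class \<alpha> P \<and> supported_in {w. length w = n} P"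
  then obtain P where P: "x = S'_class \<alpha> P" "supported_in {w. length w = n} P" by blast
  have "S_class \<alpha> (P $ r $ c) \<in> S_deg \<alpha> n" for r c
    unfolding S_deg_def using P(2) by (intro CollectI exI[of _ "P $ r $ c"]) (auto simp: supported_in_def)
  then show "x \<in> S'_deg \<alpha> n"
    by (simp add: P(1) S'_deg_def S'_class_def)
qed

lemma finsum_S'_class:
  "finite F \<Longrightarrow> (\<Oplus>\<^bsub>S'_alg \<alpha>\<^esub>i\<in>F. S'_class \<alpha> (Q i)) = S'_class \<alpha> (\<Sum>i\<in>F. Q i)"
proof (induction F rule: finite_induct)
  interpret ring "S'_alg \<alpha>" by (rule ring_S'_alg)
  {
    case empty
    show ?case by (simp add: S'_class_zero)
  next
    case (insert i F)
    then show ?case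
      by (subst finsum_insert) (auto simp: carrier_S'_alg S'_class_add)
  }
qed

context twist_parameters
begin

definition fixed :: "'k free_alg^2^2 \<Rightarrow> bool" where
  "fixed P \<longleftrightarrow> (\<forall>g. free_mat_act \<iota> g P = P)"

lemma fixed_in_A: "fixed P \<Longrightarrow> S'_class \<alpha> P \<in> carrier (A_alg \<alpha> \<iota>)"
  by (simp add: fixed_def mem_A_alg_iff)

lemma fixed_add: "fixed P \<Longrightarrow> fixed Q \<Longrightarrow> fixed (P + Q)"
  by (simp add: fixed_def free_mat_act_add)

lemma fixed_fscale_Y: "fixed (fscale x (Y w))"
proof -
  have "scale_mat (word_sign g w) (qmat \<iota> g ** scale_mat x (qword w) ** matrix_inv (qmat \<iota> g))
     = scale_mat x (qword w)" for g
  proof -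
    have "scale_mat (word_sign g w) (qmat \<iota> g ** scale_mat x (qword w) ** matrix_inv (qmat \<iota> g))
      = scale_mat x (scale_mat (word_sign g w) (qmat \<iota> g ** qword w ** matrix_inv (qmat \<iota> g)))"
      by (simp only: scale_mat_mult_left scale_mat_mult_right scale_mat_scale_mat mult.commute)
    then show ?thesis unfolding qmat_conj_qword .
  qed
  then show ?thesis
    by (simp add: fixed_def Y_def fscale_word_mat free_mat_act_word_mat)
qed

lemma fixed_sum: "finite F \<Longrightarrow> (\<And>i. i \<in> F \<Longrightarrow> fixed (Q i)) \<Longrightarrow> fixed (\<Sum>i\<in>F. Q i)"
proof (induction F rule: finite_induct)
  case empty
  show ?case using fixed_fscale_Y[of 0 "[]"] by simp
qed (simp add: fixed_add)

definition linear_form :: "(ix \<Rightarrow> 'k) \<Rightarrow> 'k free_alg^2^2" where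
  "linear_form d = (\<Sum>i\<in>UNIV. fscale (d i) (Y [i]))"

lemma perp_eq: "perp \<alpha> \<iota> p = {S'_class \<alpha> (linear_form d) | d. \<forall>v\<in>p. (\<Sum>i\<in>UNIV. d i * v i) = 0}"
proof -
  have "(\<Oplus>\<^bsub>S'_alg \<alpha>\<^esub>i\<in>UNIV. S'_const \<alpha> (d i) \<otimes>\<^bsub>S'_alg \<alpha>\<^esub> y_gen \<alpha> \<iota> i) = S'_class \<alpha> (linear_form d)" for d
    by (simp add: S'_const_eq y_gen_eq S'_class_mult linear_form_def fscale_def Y_def qword_def
        finsum_S'_class)
  moreover have "S'_class \<alpha> (linear_form d) \<in> A_deg \<alpha> \<iota> 1" for d
  proof -
    have "supported_in {w. length w = 1} (linear_form d)"
      by (simp add: linear_form_def sum_ix Y_def fscale_word_mat supported_in_add supported_in_word_mat)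
    moreover have "fixed (linear_form d)"
      unfolding linear_form_def by (intro fixed_sum fixed_fscale_Y) simp
    ultimately show ?thesis
      unfolding A_deg_def by (auto simp: S'_deg_iff fixed_in_A)
  qed
  ultimately show ?thesis by (auto simp: perp_def)
qed

lemma hom_vec_add: "hom_vec N n + hom_vec N' n = hom_vec (N + N') n"
  by (rule coeff_mat_eqI) (simp add: coeff_mat_add coeff_mat_hom_vec)

lemma hom_vec_eq_iff: "hom_vec N n = hom_vec N' n \<longleftrightarrow> N = N'"
proof
  assume "hom_vec N n = hom_vec N' n"
  then have "coeff_mat (hom_vec N n) n = coeff_mat (hom_vec N' n) n" by simp
  then show "N = N'" by (simp add: coeff_mat_hom_vec)
qed simp

lemma linear_form_hom_vec:
  "col_act j (linear_form d) (hom_vec N 0) =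
     hom_vec (\<Sum>i\<in>UNIV. scale_mat (d i) (qmat \<iota> i ** N ** transpose (X j i))) 1"
  by (simp add: linear_form_def sum_ix col_act_add_left Y_def qword_def fscale_word_mat
      col_act_hom_vec hom_vec_add scale_mat_mult_left Xword_Cons)

lemma col_act_homogeneous:
  assumes "supported_in {w. length w = n} P"
  shows "col_act j P (hom_vec N 0) \<in> range (\<lambda>N. hom_vec N n)"
  using assms
proof (induction rule: matrix_support_induct)
  case (word_mat w m)
  then show ?case by (auto simp: col_act_hom_vec)
next
  case zero
  show ?case by (rule range_eqI[of _ _ 0]) (simp add: col_act_zero_left hom_vec_zero)
next
  case (add P Q)
  then show ?case by (auto simp: col_act_add_left hom_vec_add)
qed

lemma col_act_sum:
  "finite F \<Longrightarrow> col_act j (\<Sum>i\<in>F. Q i) v = (\<Sum>i\<in>F. col_act j (Q i) v)"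
  by (induction F rule: finite_induct) (simp_all add: col_act_zero_left col_act_add_left)

end

context point_datum
begin

abbreviation A where "A \<equiv> A_alg \<alpha> \<iota>"

definition e :: "('k^2) poly^2" where "e = hom_vec E 0"

text \<open>
  The matrix of \<open>y\<^sub>0\<^sup>n e\<close>.
\<close>

definition orbit :: "nat \<Rightarrow> 'k^2^2" where
  "orbit n = E ** transpose (Xword j (replicate n I0))"

definition power :: "nat \<Rightarrow> 'k \<Rightarrow> 'k free_alg^2^2" where
  "power n x = fscale x (Y (replicate n I0))"

lemma invertible_orbit: "invertible (orbit n)"
  unfolding orbit_def by (intro invertible_mult invertible_E invertible_transpose_mat invertible_Xword)

lemma power_e: "col_act j (power n x) e = hom_vec (scale_mat x (orbit n)) n"
  by (simp add: power_def Y_replicate_I0 e_def col_act_hom_vec orbit_def mat_mult_eq_scale_mat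
      scale_mat_mult_left)

text \<open>
  The matrix of \<open>y\<^sub>0\<^sup>n e\<close> is invertible, so left multiplication by \<open>M\<^sub>2(k)\<close> takes it to any
  matrix.
\<close>

lemma generates: "\<exists>P. v = col_act j P e"
proof -
  obtain d where d: "v = (\<Sum>n\<le>d. hom_vec (coeff_mat v n) n)" using sum_hom_vec[of v] by (elim exE)
  define B where "B n = matrix_inv (orbit n)" for n
  have B: "B n ** orbit n = mat 1" for n
    using invertible_orbit[of n] unfolding B_def matrix_inv_def invertible_def
    by (rule someI2_ex) blast
  define P where "P n = word_mat (replicate n I0) (coeff_mat v n ** B n)" for n
  have "col_act j (P n) e = hom_vec (coeff_mat v n) n" for n
  proof -
    have "col_act j (P n) e = hom_vec (coeff_mat v n ** (B n ** orbit n)) n"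
      by (simp add: P_def e_def col_act_hom_vec orbit_def matrix_mul_assoc)
    then show ?thesis by (simp add: B)
  qed
  then have "col_act j (\<Sum>n\<le>d. P n) e = v"
    using d by (simp add: col_act_sum)
  then show ?thesis by blast
qed

lemma structure_map_e: "structure_map j k g e = e"
  using invariant[of g] by (simp add: e_def structure_map_hom_vec)

lemma structure_map_fixes:
  assumes "S'_class \<alpha> P \<in> carrier A"
  shows "structure_map j k g (col_act j P e) = col_act j P e"
proof -
  have "S'_class \<alpha> (free_mat_act \<iota> g P) = S'_class \<alpha> P" using assms by (simp add: mem_A_alg_iff)
  then have "col_act j (free_mat_act \<iota> g P) e = col_act j P e" by (simp flip: M_smult)
  then show ?thesis by (simp add: structure_map_col_act structure_map_e)
qed

text \<open>
  Both \<open>N\<close> and the matrix of \<open>y\<^sub>0\<^sup>n e\<close> are eigenvectors for the same character of \<open>\<Gamma>\<close>, so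
  their quotient \<open>K\<close> commutes with every \<open>q\<^sub>g\<close>.
\<close>

lemma fixed_multiple_of_orbit:
  assumes "\<And>g. structure_map j k g (hom_vec N n) = hom_vec N n"
  shows "\<exists>x. N = scale_mat x (orbit n)"
proof -
  obtain B where B: "orbit n ** B = mat 1" "B ** orbit n = mat 1"
    using invertible_orbit[of n] by (auto simp: invertible_def)
  define K where "K = N ** B"
  have N: "N = K ** orbit n" unfolding K_def by (simp add: B flip: matrix_mul_assoc)
  define s :: "ix \<Rightarrow> 'k" where "s g = gen_sign g k * gen_sign g j ^ n" for g
  have "qmat \<iota> g ** K = K ** qmat \<iota> g" for g
  proof -
    have 1: "scale_mat (s g) (qmat \<iota> g ** orbit n ** transpose (qmat \<iota> g)) = orbit n"
    proof -
      have "S'_class \<alpha> (power n 1) \<in> carrier A"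
        unfolding power_def by (intro fixed_in_A fixed_fscale_Y)
      from structure_map_fixes[OF this, of g] show ?thesis
        unfolding power_e structure_map_hom_vec hom_vec_eq_iff s_def scale_mat_one .
    qed
    have 2: "scale_mat (s g) (qmat \<iota> g ** (K ** orbit n) ** transpose (qmat \<iota> g)) = K ** orbit n"
      using assms[of g] unfolding structure_map_hom_vec hom_vec_eq_iff s_def N .
    define T where "T = scale_mat (s g) (orbit n ** transpose (qmat \<iota> g))"
    have "s g \<noteq> 0" by (simp add: s_def gen_sign_def)
    then have "invertible T"
      unfolding T_def
      by (intro invertible_scale_mat invertible_mult invertible_orbit invertible_transpose_mat invertible_qmat)
    moreover have "(qmat \<iota> g ** K) ** T = K ** orbit n"
      using 2 by (simp add: T_def scale_mat_mult_right matrix_mul_assoc)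
    moreover have "(K ** qmat \<iota> g) ** T = K ** orbit n"
      using arg_cong[OF 1, of "\<lambda>m. K ** m"] by (simp add: T_def scale_mat_mult_right matrix_mul_assoc)
    ultimately show ?thesis by (metis matrix_mult_right_cancel)
  qed
  then have "K = mat (K $ 1 $ 1)"
    by (rule commutes_with_qmat_imp_scalar[OF iota two])
  then have "N = scale_mat (K $ 1 $ 1) (orbit n)"
    using N mat_mult_eq_scale_mat by metis
  then show ?thesis ..
qed

lemma perp_annihilates: "x \<in> perp \<alpha> \<iota> p \<Longrightarrow> x \<odot>\<^bsub>M j\<^esub> e = 0"
proof -
  assume "x \<in> perp \<alpha> \<iota> p"
  then obtain d where x: "x = S'_class \<alpha> (linear_form d)" and d: "(\<Sum>i\<in>UNIV. d i * r i) = 0"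
    using r_in_p unfolding perp_eq by blast
  have "(\<Sum>i\<in>UNIV. scale_mat (d i) (qmat \<iota> i ** E ** transpose (X j i))) = 0"
    by (simp only: eigen scale_mat_scale_mat sum_scale_mat d scale_mat_zero)
  then show "x \<odot>\<^bsub>M j\<^esub> e = 0"
    by (simp only: x M_smult e_def linear_form_hom_vec hom_vec_zero)
qed

lemma point_relation: "S'_class \<alpha> (Y [i] - fscale (r i) (Y [I0])) \<in> perp \<alpha> \<iota> p"
proof -
  define d where "d l = (if l = i then 1 else 0) - (if l = I0 then r i else 0)" for l
  have r0: "r I0 = 1" using regular by (simp add: regular_point_def)
  have "(\<Sum>l\<in>UNIV. d l * v l) = 0" if "v \<in> p" for v
  proof -
    obtain m where "v = (\<lambda>l. m * r l)" using p_multiples[OF \<open>v \<in> p\<close>] by blast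
    then show ?thesis by (cases i) (simp_all add: sum_ix d_def r0)
  qed
  moreover have "linear_form d = Y [i] - fscale (r i) (Y [I0])"
    by (cases i) (simp_all add: linear_form_def sum_ix d_def free_mat.scale_left_diff_distrib)
  ultimately show ?thesis unfolding perp_eq by (intro CollectI exI[of _ d]) simp
qed

definition L where "L = left_ideal_gen A (perp \<alpha> \<iota> p)"

lemma ring_A: "ring A"
  by (rule ring_A_alg[OF iota])

lemma perp_subset: "perp \<alpha> \<iota> p \<subseteq> carrier A"
  by (auto simp: perp_def A_deg_def)

lemma L_subgroup: "additive_subgroup L A"
  unfolding L_def by (rule ring.left_ideal_gen_additive_subgroup[OF ring_A perp_subset])

lemma L_mult: "x \<in> carrier A \<Longrightarrow> l \<in> L \<Longrightarrow> x \<otimes>\<^bsub>A\<^esub> l \<in> L"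
  unfolding L_def by (rule ring.left_ideal_gen_mult[OF ring_A])

lemma L_left_ideal: "\<forall>x\<in>carrier A. \<forall>l\<in>L. x \<otimes>\<^bsub>A\<^esub> l \<in> L"
  using L_mult by blast

lemma perp_in_L: "perp \<alpha> \<iota> p \<subseteq> L"
  unfolding L_def by (rule ring.left_ideal_gen_superset[OF ring_A])

sublocale left_ideal_of_A \<alpha> a b c \<iota> L
  by (rule left_ideal_of_A.intro[OF twist_parameters_axioms
        left_ideal_of_A_axioms.intro[OF two L_subgroup L_mult]])

lemma A_uminus: "x \<in> carrier A \<Longrightarrow> x = S'_class \<alpha> P \<Longrightarrow> \<ominus>\<^bsub>A\<^esub> x = S'_class \<alpha> (- P)"
proof -
  assume x: "x \<in> carrier A" and P: "x = S'_class \<alpha> P"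
  interpret ring A by (rule ring_A)
  have "S'_class \<alpha> (- P) \<in> carrier A"
    using x unfolding P mem_A_alg_iff free_mat_act_uminus by (simp flip: S'_class_uminus)
  then show "\<ominus>\<^bsub>A\<^esub> x = S'_class \<alpha> (- P)"
    using x by (intro minus_equality) (simp_all add: P A_alg_sel S'_class_add S'_class_zero)
qed

lemma L_annihilates: "x \<in> L \<Longrightarrow> x \<odot>\<^bsub>M j\<^esub> e = 0"
proof -
  define N where "N = {x \<in> carrier A. x \<odot>\<^bsub>M j\<^esub> e = 0}"
  interpret ring A by (rule ring_A)
  have rep: "\<exists>P. x = S'_class \<alpha> P" if "x \<in> carrier A" for x
    using that carrier_A_alg_subset by blast
  have "L \<subseteq> N"
    unfolding L_def
  proof (rule left_ideal_gen_minimal)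
    show "additive_subgroup N A"
    proof (intro additive_subgroupI subgroup.intro)
      show "N \<subseteq> carrier (add_monoid A)" by (auto simp: N_def)
      show "\<one>\<^bsub>add_monoid A\<^esub> \<in> N"
        using zero_closed by (simp add: N_def A_alg_sel S'_class_zero M_smult col_act_zero_left)
      fix x assume "x \<in> N"
      then have x: "x \<in> carrier A" "x \<odot>\<^bsub>M j\<^esub> e = 0" by (auto simp: N_def)
      obtain P where P: "x = S'_class \<alpha> P" using rep[OF x(1)] by blast
      have "col_act j (- P) e = 0"
        using x(2) col_act_add_left[of j "- P" P e] by (simp add: P M_smult col_act_zero_left)
      then have "\<ominus>\<^bsub>A\<^esub> x \<in> N"
        using x(1) A_uminus[OF x(1) P] by (simp add: N_def M_smult a_inv_closed[OF x(1), unfolded A_uminus[OF x(1) P]])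
      then show "inv\<^bsub>add_monoid A\<^esub> x \<in> N" by (simp only: a_inv_def)
      fix y assume "y \<in> N"
      then have y: "y \<in> carrier A" "y \<odot>\<^bsub>M j\<^esub> e = 0" by (auto simp: N_def)
      obtain Q where Q: "y = S'_class \<alpha> Q" using rep[OF y(1)] by blast
      have "x \<oplus>\<^bsub>A\<^esub> y = S'_class \<alpha> (P + Q)" by (simp add: P Q A_alg_sel S'_class_add)
      then have "(x \<oplus>\<^bsub>A\<^esub> y) \<odot>\<^bsub>M j\<^esub> e = 0"
        using x(2) y(2) by (simp add: P Q M_smult col_act_add_left)
      then show "x \<otimes>\<^bsub>add_monoid A\<^esub> y \<in> N"
        using a_closed[OF x(1) y(1)] by (simp add: N_def)
    qed
    show "x \<otimes>\<^bsub>A\<^esub> y \<in> N" if x: "x \<in> carrier A" and "y \<in> N" for x y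
    proof -
      have y: "y \<in> carrier A" "y \<odot>\<^bsub>M j\<^esub> e = 0" using \<open>y \<in> N\<close> by (auto simp: N_def)
      obtain P Q where P: "x = S'_class \<alpha> P" and Q: "y = S'_class \<alpha> Q"
        using rep[OF x] rep[OF y(1)] by blast
      have "x \<otimes>\<^bsub>A\<^esub> y = S'_class \<alpha> (P ** Q)" by (simp add: P Q A_alg_sel S'_class_mult)
      then have "(x \<otimes>\<^bsub>A\<^esub> y) \<odot>\<^bsub>M j\<^esub> e = 0"
        using y(2) by (simp add: Q M_smult col_act_mult col_act_zero_right)
      then show ?thesis
        using m_closed[OF x y(1)] by (simp add: N_def)
    qed
    show "perp \<alpha> \<iota> p \<subseteq> N"
      using perp_subset perp_annihilates by (auto simp: N_def)
  qed
  then show "x \<in> L \<Longrightarrow> x \<odot>\<^bsub>M j\<^esub> e = 0" by (auto simp: N_def)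
qed

text \<open>
  The elements \<open>y\<^sub>0\<^sup>n e\<close> are nonzero and have different degrees.
\<close>

lemma powers_act_freely:
  assumes f: "Poly_Mapping.keys f \<subseteq> range (\<lambda>n. replicate n I0)" and zero: "col_act j (mat f) e = 0"
  shows "f = 0"
proof -
  have "Poly_Mapping.lookup f (replicate n I0) = 0" for n
  proof -
    have "Fdot j f (e $ s) = 0" for s
      using arg_cong[OF zero, of "\<lambda>v. v $ s"] exhaust_2[of s]
      by (auto simp: col_act_def mat_def F_free_act_zero_left)
    then have "0 = coeff (Fdot j f (e $ s)) n" for s by simp
    moreover have "coeff (Fdot j f (e $ s)) n =
        scale_mat (Poly_Mapping.lookup f (replicate n I0)) (Xword j (replicate n I0)) *v (E $ s)" for s
    proof -
      define W where "W = insert (replicate n I0) (Poly_Mapping.keys f)"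
      define t where "t w = scale_mat (Poly_Mapping.lookup f w) (Xword j w) *v E $ s" for w
      have e: "coeff (e $ s) l = (if l = 0 then E $ s else 0)" for l
        by (simp add: e_def hom_vec_def)
      have "coeff (Fdot j f (e $ s)) n = (\<Sum>w\<in>W. if length w \<le> n
          then scale_mat (Poly_Mapping.lookup f w) (Xword j w) *v coeff (e $ s) (n - length w) else 0)"
        by (rule coeff_F_free_act_support) (auto simp: W_def)
      also have "\<dots> = (\<Sum>w\<in>W. if w = replicate n I0 then t w else 0)"
      proof (rule sum.cong)
        fix w assume "w \<in> W"
        then obtain l where "w = replicate l I0" using f by (auto simp: W_def)
        moreover have "replicate l I0 = replicate n I0 \<longleftrightarrow> l = n"
          using length_replicate by metis
        ultimately show "(if length w \<le> n then scale_mat (Poly_Mapping.lookup f w) (Xword j w) *v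
            coeff (e $ s) (n - length w) else 0) = (if w = replicate n I0 then t w else 0)"
          by (simp add: e t_def)
      qed simp
      also have "\<dots> = t (replicate n I0)" by (simp add: W_def)
      finally show ?thesis by (simp add: t_def)
    qed
    ultimately have "scale_mat (Poly_Mapping.lookup f (replicate n I0)) (Xword j (replicate n I0)) *v (E $ s) = 0" for s
      by metis
    then have "scale_mat (Poly_Mapping.lookup f (replicate n I0)) (orbit n) = 0"
      by (simp add: orbit_def vec_eq_iff matrix_vector_mult_def matrix_matrix_mult_def transpose_def
          sum_2 forall_2 algebra_simps)
    moreover have "invertible (scale_mat x (orbit n))" if "x \<noteq> 0" for x
      using that by (intro invertible_scale_mat invertible_orbit)
    ultimately show ?thesis using invertible_not_zero by blast
  qed
  then have "w \<notin> Poly_Mapping.keys f" for w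
    using f by (metis in_keys_iff rangeE subsetD)
  then show ?thesis
    by (intro poly_mapping_eqI) (simp add: in_keys_iff)
qed

text \<open>
  Modulo \<open>L\<close>, which kills \<open>e\<close>, an element of \<open>A\<close> is a polynomial in \<open>y\<^sub>0\<close>, and such a
  polynomial kills \<open>e\<close> only if it is zero.
\<close>

lemma annihilator_in_L:
  assumes "S'_class \<alpha> P \<in> carrier A" and "col_act j P e = 0"
  shows "S'_class \<alpha> P \<in> L"
proof -
  have "Y [i] - fscale (r i) (Y [I0]) \<in> Lrep" for i
    using point_relation perp_in_L by (auto simp: Lrep_def)
  then obtain f where f: "Poly_Mapping.keys f \<subseteq> range (\<lambda>n. replicate n I0)" and P: "P - mat f \<in> Lrep"
    using A_reduce[OF regular _ assms(1)] by blast
  have "col_act j (P - mat f) e = 0"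
    using P L_annihilates by (simp add: Lrep_def flip: M_smult)
  then have "col_act j (mat f) e = 0"
    using col_act_add_left[of j "P - mat f" "mat f" e] assms(2) by simp
  then have "f = 0" by (rule powers_act_freely[OF f])
  moreover have "(mat 0 :: 'k free_alg^2^2) = 0" by (simp add: mat2_simps)
  ultimately show ?thesis using P by (simp add: Lrep_def)
qed

lemma point_module_isomorphic_invariants:
  "graded_isomorphic A (point_module \<alpha> \<iota> p) (invariants (M j) (structure_map j k))"
  unfolding point_module_def L_def[symmetric]
proof (rule ring.quotient_module_isomorphic_cyclic[OF ring_A L_subgroup L_left_ideal, where h = "\<lambda>x. x \<odot>\<^bsub>M j\<^esub> e"])
  interpret ring A by (rule ring_A)
  have rep: "\<exists>P. x = S'_class \<alpha> P" if "x \<in> carrier A" for x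
    using that carrier_A_alg_subset by blast
  {
    fix x y assume xy: "x \<in> carrier A" "y \<in> carrier A"
    obtain P Q where P: "x = S'_class \<alpha> P" and Q: "y = S'_class \<alpha> Q"
      using rep[OF xy(1)] rep[OF xy(2)] by blast
    show "(x \<oplus>\<^bsub>A\<^esub> y) \<odot>\<^bsub>M j\<^esub> e = x \<odot>\<^bsub>M j\<^esub> e \<oplus>\<^bsub>invariants (M j) (structure_map j k)\<^esub> y \<odot>\<^bsub>M j\<^esub> e"
      by (simp add: P Q A_alg_sel S'_class_add M_smult col_act_add_left invariants_def M_sel)
    show "(x \<otimes>\<^bsub>A\<^esub> y) \<odot>\<^bsub>M j\<^esub> e = x \<odot>\<^bsub>invariants (M j) (structure_map j k)\<^esub> (y \<odot>\<^bsub>M j\<^esub> e)"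
      by (simp add: P Q A_alg_sel S'_class_mult M_smult col_act_mult invariants_def)
    have diff: "x \<ominus>\<^bsub>A\<^esub> y = S'_class \<alpha> (P - Q)"
      by (simp add: a_minus_def A_uminus[OF xy(2) Q] P A_alg_sel S'_class_add)
    have "col_act j P e = col_act j Q e \<longleftrightarrow> col_act j (P - Q) e = 0"
      using col_act_add_left[of j "P - Q" Q e] by auto
    also have "\<dots> \<longleftrightarrow> x \<ominus>\<^bsub>A\<^esub> y \<in> L"
      using annihilator_in_L[of "P - Q"] L_annihilates[of "S'_class \<alpha> (P - Q)"] minus_closed[OF xy]
      by (auto simp: diff M_smult)
    finally show "x \<odot>\<^bsub>M j\<^esub> e = y \<odot>\<^bsub>M j\<^esub> e \<longleftrightarrow> x \<ominus>\<^bsub>A\<^esub> y \<in> L"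
      by (simp add: P Q M_smult)
  }
  show "(\<lambda>x. x \<odot>\<^bsub>M j\<^esub> e) ` carrier A = carrier (invariants (M j) (structure_map j k))"
  proof (intro equalityI subsetI)
    fix v assume "v \<in> (\<lambda>x. x \<odot>\<^bsub>M j\<^esub> e) ` carrier A"
    then obtain x where x: "x \<in> carrier A" and v: "v = x \<odot>\<^bsub>M j\<^esub> e" by blast
    obtain P where P: "x = S'_class \<alpha> P" using rep[OF x] by blast
    show "v \<in> carrier (invariants (M j) (structure_map j k))"
      using structure_map_fixes x by (simp add: v P M_smult invariants_def M_sel)
  next
    fix v assume "v \<in> carrier (invariants (M j) (structure_map j k))"
    then have inv: "structure_map j k g v = v" for g by (simp add: invariants_def)
    have "\<exists>x. coeff_mat v n = scale_mat x (orbit n)" for n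
    proof (rule fixed_multiple_of_orbit)
      fix g
      show "structure_map j k g (hom_vec (coeff_mat v n) n) = hom_vec (coeff_mat v n) n"
        using arg_cong[OF inv[of g], of "\<lambda>v. coeff_mat v n"]
        by (simp add: structure_map_hom_vec coeff_mat_structure_map)
    qed
    then obtain x where x: "\<And>n. coeff_mat v n = scale_mat (x n) (orbit n)" by metis
    obtain d where d: "v = (\<Sum>n\<le>d. hom_vec (coeff_mat v n) n)" using sum_hom_vec[of v] by (elim exE)
    define P where "P = (\<Sum>n\<le>d. power n (x n))"
    have "v = (\<Sum>n\<le>d. col_act j (power n (x n)) e)"
      using d by (simp only: x power_e)
    then have "v = col_act j P e" by (simp add: P_def col_act_sum)
    moreover have "fixed P"
      unfolding P_def power_def by (intro fixed_sum fixed_fscale_Y) simp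
    ultimately show "v \<in> (\<lambda>x. x \<odot>\<^bsub>M j\<^esub> e) ` carrier A"
      by (intro image_eqI[of _ _ "S'_class \<alpha> P"]) (simp_all add: M_smult fixed_in_A)
  qed
  fix n
  show "A_deg \<alpha> \<iota> n \<subseteq> carrier A" by (auto simp: A_deg_def)
  show "(\<lambda>x. x \<odot>\<^bsub>M j\<^esub> e) ` A_deg \<alpha> \<iota> n = degpart (invariants (M j) (structure_map j k)) n"
  proof (intro equalityI subsetI)
    fix v assume "v \<in> (\<lambda>x. x \<odot>\<^bsub>M j\<^esub> e) ` A_deg \<alpha> \<iota> n"
    then obtain P where P: "S'_class \<alpha> P \<in> carrier A" "supported_in {w. length w = n} P"
      and v: "v = col_act j P e"
      by (auto simp: A_deg_def S'_deg_iff M_smult)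
    show "v \<in> degpart (invariants (M j) (structure_map j k)) n"
      using structure_map_fixes[OF P(1)] col_act_homogeneous[OF P(2), of j E]
      by (simp add: invariants_def degpart_M v e_def)
  next
    fix v assume "v \<in> degpart (invariants (M j) (structure_map j k)) n"
    then obtain N where v: "v = hom_vec N n" and "\<And>g. structure_map j k g (hom_vec N n) = hom_vec N n"
      by (auto simp: invariants_def degpart_M)
    then obtain x where N: "N = scale_mat x (orbit n)" using fixed_multiple_of_orbit by blast
    have "supported_in {w. length w = n} (power n x)"
      by (simp add: power_def Y_def fscale_word_mat supported_in_word_mat)
    moreover have "fixed (power n x)" unfolding power_def by (rule fixed_fscale_Y)
    ultimately have "S'_class \<alpha> (power n x) \<in> A_deg \<alpha> \<iota> n"
      by (auto simp: A_deg_def S'_deg_iff fixed_in_A)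
    moreover have "v = S'_class \<alpha> (power n x) \<odot>\<^bsub>M j\<^esub> e" by (simp add: M_smult power_e v N)
    ultimately show "v \<in> (\<lambda>x. x \<odot>\<^bsub>M j\<^esub> e) ` A_deg \<alpha> \<iota> n" by (rule image_eqI[rotated])
  qed
qed

section \<open>Uniqueness\<close>

text \<open>
  The elements \<open>y\<^sub>i - r\<^sub>i y\<^sub>0\<close> of \<open>p\<^sup>\<bottom>\<close> already force the quotient \<open>K\<close> of \<open>N\<close> and \<open>E\<close> to
  commute with every \<open>q\<^sub>i\<close>.
\<close>

lemma annihilated_multiple_of_e:
  assumes "\<And>x. x \<in> perp \<alpha> \<iota> p \<Longrightarrow> x \<odot>\<^bsub>M j\<^esub> hom_vec N 0 = 0"
  shows "\<exists>x. N = scale_mat x E"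
proof -
  have eigen_N: "qmat \<iota> i ** N ** transpose (X j i) = scale_mat (r i) (N ** transpose (X j I0))" for i
  proof -
    have "col_act j (Y [i] - fscale (r i) (Y [I0])) (hom_vec N 0) = 0"
      using assms[OF point_relation[of i]] by (simp add: M_smult)
    then have "col_act j (Y [i]) (hom_vec N 0) = col_act j (fscale (r i) (Y [I0])) (hom_vec N 0)"
      using col_act_add_left[of j "Y [i] - fscale (r i) (Y [I0])" "fscale (r i) (Y [I0])" "hom_vec N 0"] by simp
    then show ?thesis
      by (simp add: Y_def qword_def fscale_word_mat col_act_hom_vec Xword_Cons hom_vec_eq_iff
          mat_mult_eq_scale_mat scale_mat_mult_left)
  qed
  obtain B where B: "E ** B = mat 1" "B ** E = mat 1"
    using invertible_E by (auto simp: invertible_def)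
  define K where "K = N ** B"
  have N: "N = K ** E" unfolding K_def by (simp add: B flip: matrix_mul_assoc)
  have "qmat \<iota> i ** K = K ** qmat \<iota> i" for i
  proof (rule matrix_mult_right_cancel)
    show "invertible (E ** transpose (X j i))"
      by (intro invertible_mult invertible_E invertible_transpose_mat invertible_X)
    have "qmat \<iota> i ** K ** (E ** transpose (X j i)) = qmat \<iota> i ** N ** transpose (X j i)"
      by (simp add: N matrix_mul_assoc)
    also have "\<dots> = K ** scale_mat (r i) (E ** transpose (X j I0))"
      unfolding eigen_N by (simp add: N scale_mat_mult_right matrix_mul_assoc)
    also have "\<dots> = K ** qmat \<iota> i ** (E ** transpose (X j i))"
      by (simp add: matrix_mul_assoc flip: eigen)
    finally show "qmat \<iota> i ** K ** (E ** transpose (X j i)) = K ** qmat \<iota> i ** (E ** transpose (X j i))" .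
  qed
  then have "K = mat (K $ 1 $ 1)"
    by (rule commutes_with_qmat_imp_scalar[OF iota two])
  then have "N = scale_mat (K $ 1 $ 1) E"
    using N mat_mult_eq_scale_mat by metis
  then show ?thesis ..
qed

text \<open>
  The vector is the image of the class of \<open>1\<close>; it is nonzero because \<open>1 \<notin> L\<close>.
\<close>

lemma point_module_generator:
  assumes "graded_isomorphic A (point_module \<alpha> \<iota> p) (invariants (M j) \<psi>)"
  shows "\<exists>N. N \<noteq> 0 \<and> (\<forall>g. \<psi> g (hom_vec N 0) = hom_vec N 0) \<and>
    (\<forall>x\<in>perp \<alpha> \<iota> p. x \<odot>\<^bsub>M j\<^esub> hom_vec N 0 = 0)"
proof -
  interpret ring A by (rule ring_A)
  note sub = L_subgroup L_left_ideal
  note zeroL = additive_subgroup.zero_closed[OF L_subgroup]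
  let ?Q = "quotient_module A (A_deg \<alpha> \<iota>) L"
  let ?I = "invariants (M j) \<psi>"
  obtain f where f: "graded_iso A ?Q ?I f"
    using assms unfolding graded_isomorphic_def point_module_def L_def[symmetric] by blast
  define u where "u = L +>\<^bsub>A\<^esub> \<one>\<^bsub>A\<^esub>"
  have u: "u \<in> carrier ?Q" unfolding u_def carrier_quotient_module[OF sub] by simp
  have LQ: "L \<in> carrier ?Q"
    unfolding carrier_quotient_module[OF sub]
    using left_ideal_coset_eq[OF sub zeroL] by (intro image_eqI[of _ _ "\<zero>\<^bsub>A\<^esub>"]) simp_all
  have inj: "inj_on f (carrier ?Q)" using f by (simp add: graded_iso_def bij_betw_def)
  have fL: "f L = 0"
  proof -
    have "L \<oplus>\<^bsub>?Q\<^esub> L = L"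
      using quotient_module_add[OF sub zero_closed zero_closed] left_ideal_coset_eq[OF sub zeroL] by simp
    then have "f L = f L \<oplus>\<^bsub>?I\<^esub> f L"
      using f LQ unfolding graded_iso_def by metis
    then show ?thesis by (simp add: invariants_def M_sel)
  qed
  have one_deg: "\<one>\<^bsub>A\<^esub> \<in> A_deg \<alpha> \<iota> 0"
  proof -
    have "\<one>\<^bsub>A\<^esub> = S'_class \<alpha> (word_mat [] (mat 1))" by (simp add: A_alg_sel S'_class_one word_mat_one)
    moreover have "supported_in {w. length w = 0} (word_mat [] (mat 1))" by (rule supported_in_word_mat) simp
    ultimately show ?thesis using one_closed by (auto simp: A_deg_def S'_deg_iff)
  qed
  then have "u \<in> degpart ?Q 0" unfolding degpart_quotient_module[OF sub] u_def by (rule imageI)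
  then have "f u \<in> degpart ?I 0" using f unfolding graded_iso_def by blast
  then obtain N where N: "f u = hom_vec N 0" and inv: "\<And>g. \<psi> g (hom_vec N 0) = hom_vec N 0"
    by (auto simp: invariants_def degpart_M)
  have "x \<odot>\<^bsub>M j\<^esub> hom_vec N 0 = 0" if x: "x \<in> perp \<alpha> \<iota> p" for x
  proof -
    have xA: "x \<in> carrier A" using x perp_subset by blast
    have "x \<odot>\<^bsub>?Q\<^esub> u = L"
      unfolding u_def quotient_module_smult[OF sub xA one_closed]
      using left_ideal_coset_eq[OF sub] x perp_in_L xA by (simp add: subset_iff)
    then have "0 = f (x \<odot>\<^bsub>?Q\<^esub> u)" using fL by simp
    also have "\<dots> = x \<odot>\<^bsub>?I\<^esub> f u" using f xA u unfolding graded_iso_def by blast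
    finally show ?thesis by (simp add: N invariants_def)
  qed
  moreover have "N \<noteq> 0"
  proof
    assume "N = 0"
    then have "f u = f L" by (simp add: N fL hom_vec_zero)
    then have "u = L" using inj u LQ by (simp add: inj_on_eq_iff)
    then have "\<one>\<^bsub>A\<^esub> \<ominus>\<^bsub>A\<^esub> \<zero>\<^bsub>A\<^esub> \<in> L"
      using left_coset_eq_iff[OF sub one_closed zero_closed] left_ideal_coset_eq[OF sub zeroL]
      by (simp add: u_def)
    then have "\<one>\<^bsub>A\<^esub> \<in> L" by (simp add: a_minus_def)
    then have "e = 0" using L_annihilates[of "S'_class \<alpha> (mat 1)"] by (simp add: A_alg_sel S'_class_one M_smult col_act_one)
    then have "E = 0" using hom_vec_eq_iff[of E 0 0] by (simp add: e_def hom_vec_zero)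
    then show False using invertible_not_zero[OF invertible_E] by simp
  qed
  ultimately show ?thesis using inv by blast
qed

text \<open>
  A structure that satisfies the hypotheses fixes \<open>e\<close>, and \<open>e\<close> generates the module. So the
  two structures are not merely isomorphic but equal.
\<close>

lemma structure_determined:
  assumes eq: "equivariant_structure \<alpha> \<iota> (M j) \<psi>"
    and iso: "graded_isomorphic A (point_module \<alpha> \<iota> p) (invariants (M j) \<psi>)"
  shows "\<psi> g v = structure_map j k g v"
proof -
  obtain N where N: "N \<noteq> 0" and inv: "\<And>g. \<psi> g (hom_vec N 0) = hom_vec N 0"
    and ann: "\<And>x. x \<in> perp \<alpha> \<iota> p \<Longrightarrow> x \<odot>\<^bsub>M j\<^esub> hom_vec N 0 = 0"
    using point_module_generator[OF iso] by blast
  obtain x where x: "N = scale_mat x E" using annihilated_multiple_of_e[OF ann] by blast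
  have "x \<noteq> 0" using N by (auto simp: x scale_mat_zero)
  have lin: "\<psi> g (S'_const \<alpha> d \<odot>\<^bsub>M j\<^esub> m) = S'_const \<alpha> d \<odot>\<^bsub>M j\<^esub> \<psi> g m"
    and act: "\<psi> g (S'_class \<alpha> P \<odot>\<^bsub>M j\<^esub> m) = S'_act \<alpha> \<iota> g (S'_class \<alpha> P) \<odot>\<^bsub>M j\<^esub> \<psi> g m" for d P m
    using eq by (simp_all add: equivariant_structure_def M_sel carrier_S'_alg)
  have "e = S'_const \<alpha> (inverse x) \<odot>\<^bsub>M j\<^esub> hom_vec N 0"
    using \<open>x \<noteq> 0\<close> unfolding S'_const_eq M_smult col_act_hom_vec mat_mult_eq_scale_mat x
    by (simp only: scale_mat_scale_mat left_inverse[OF \<open>x \<noteq> 0\<close>] scale_mat_one Xword_Nil transpose_mat matrix_mul_rid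
        list.size add_0_right e_def)
  then have "\<psi> g e = e" by (simp add: lin inv)
  moreover obtain P where "v = col_act j P e" using generates by blast
  ultimately have "\<psi> g v = col_act j (free_mat_act \<iota> g P) e"
    using act[of P e] by (simp add: M_smult S'_act_S'_class)
  also have "\<dots> = structure_map j k g v"
    by (simp add: \<open>v = _\<close> structure_map_col_act structure_map_e)
  finally show ?thesis .
qed

end

theorem corollary4p5:
  fixes \<alpha> :: "ix \<Rightarrow> 'k::alg_closed_field" and a b c \<iota> :: 'k
    and j :: ix and p :: "(ix \<Rightarrow> 'k) set"
  assumes "CHAR('k) \<noteq> 2" and "CHAR('k) \<noteq> 3"
    and "\<alpha> I1 \<notin> {0, 1, -1}" and "\<alpha> I2 \<notin> {0, 1, -1}" and "\<alpha> I3 \<notin> {0, 1, -1}"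
    and "\<alpha> I1 + \<alpha> I2 + \<alpha> I3 + \<alpha> I1 * \<alpha> I2 * \<alpha> I3 = 0"
    and "a ^ 2 = \<alpha> I1" and "b ^ 2 = \<alpha> I2" and "c ^ 2 = \<alpha> I3" and "\<iota> ^ 2 = -1"
    and "p \<in> PP a b c \<iota> j"
  shows "\<exists>\<phi>. equivariant_structure \<alpha> \<iota> (Fk2_module a b c \<iota> j) \<phi> \<and>
    graded_isomorphic (A_alg \<alpha> \<iota>) (point_module \<alpha> \<iota> p) (invariants (Fk2_module a b c \<iota> j) \<phi>) \<and>
    (\<forall>\<psi>. equivariant_structure \<alpha> \<iota> (Fk2_module a b c \<iota> j) \<psi> \<and>
      graded_isomorphic (A_alg \<alpha> \<iota>) (point_module \<alpha> \<iota> p) (invariants (Fk2_module a b c \<iota> j) \<psi>) \<longrightarrow>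
      equivariant_isomorphic \<alpha> (Fk2_module a b c \<iota> j) \<phi> \<psi>)"
proof -
  have two: "(2::'k) \<noteq> 0"
  proof
    assume "(2::'k) = 0"
    then have "CHAR('k) dvd 2" using of_nat_eq_0_iff_char_dvd[of 2, where ?'a = 'k] by simp
    then have "CHAR('k) = 1" using assms(1) prime_nat_iff[of 2] two_is_prime_nat by blast
    then have "of_nat 1 = (0::'k)" by (metis of_nat_CHAR)
    then show False by simp
  qed
  interpret sklyanin_parameters \<alpha> a b c \<iota>
    by unfold_locales (use assms two in simp_all)
  obtain r E k where "point_datum \<alpha> a b c \<iota> j p r E k"
    using exists_point_datum[OF assms(11)] by blast
  then interpret point_datum \<alpha> a b c \<iota> j p r E k .
  show ?thesis
  proof (intro exI[of _ "structure_map j k"] conjI allI impI)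
    show "equivariant_structure \<alpha> \<iota> (M j) (structure_map j k)" by (rule equivariant_structure_map)
    show "graded_isomorphic A (point_module \<alpha> \<iota> p) (invariants (M j) (structure_map j k))"
      by (rule point_module_isomorphic_invariants)
    fix \<psi> assume "equivariant_structure \<alpha> \<iota> (M j) \<psi> \<and>
      graded_isomorphic A (point_module \<alpha> \<iota> p) (invariants (M j) \<psi>)"
    then have "\<psi> g v = structure_map j k g v" for g v
      using structure_determined by blast
    moreover have "graded_iso (S'_alg \<alpha>) (M j) (M j) (\<lambda>v. v)"
      by (simp add: graded_iso_def bij_betw_def)
    ultimately show "equivariant_isomorphic \<alpha> (M j) (structure_map j k) \<psi>"
      unfolding equivariant_isomorphic_def by (intro exI[of _ "\<lambda>v. v"]) simp
  qed
qed

end
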